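(* Consider the one-dimensional Gaussian Volterra principal-agent model described in the context, with risk aversions $\gamma_A,\gamma_P>0$, effort cost $k(a)=\kappa a^2/2$ with $\kappa>0$, and agent reservation utility $R_0=U_A(y_0)$, $y_0\in\mathbb{R}$. Define $$\beta^*_t=\frac{\gamma_P+1/\kappa}{\gamma_A+\gamma_P+1/\kappa}\,K(T,t),\qquad 0\le t\le T,$$ and $$\xi^*=y_0-\frac{\gamma_P+1/\kappa}{\gamma_A+\gamma_P+1/\kappa}\,g_0(T)+\frac{\kappa\gamma_A-1}{2\kappa}\int_0^T(\beta^*_s)^2\,ds+\frac{\gamma_P+1/\kappa}{\gamma_A+\gamma_P+1/\kappa}\,X_T .$$ Then $\xi^*$, which is linear (affine) in the end-of-period profit $X_T$, is an optimal contract for the principal's problem: $\xi^*\in\Xi$, it satisfies the participation constraint, and it attains the supremum $$V_0^P=\sup_{\xi\in\Xi}\mathbb{E}^{a^*(\xi)}\big[U_P(X_T-\xi)\big]$$ taken under the participation constraint. Moreover, the optimal level of recommended effort, i.e. the effort maximizing the agent's problem $V_0^A(\xi^* )$ for the contract $\xi^*$, is deterministic and given by $a^*=\beta^*/\kappa$.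
   Context: Setting. Let $T>0$ and let $(\Omega,\mathcal{F},\mathbb{F}=(\mathcal{F}_t)_{t\le T},\mathbb{P}_0)$ be a filtered probability space carrying a one-dimensional $\mathbb{F}$-Brownian motion $B$. Let $g_0:[0,T]\to\mathbb{R}$ be a measurable deterministic function and $K:[0,T]^2\to\mathbb{R}$ a measurable Volterra kernel, i.e. $K(t,s)=0$ for $s\ge t$, with $\sup_{t\le T}\int_0^T K(t,s)^2ds<\infty$. The output process is $$X_t=g_0(t)+\int_0^tK(t,s)\,dB_s,\qquad t\le T.$$ $\mathbb{F}^X=(\mathcal{F}^X_t)_{t\le T}$ denotes the augmented filtration generated by $X$. Admissible processes: $\mathcal{A}$ is the set of $\mathbb{F}$-progressively measurable real processes $(a_t)_{t\le T}$ for which there is a constant $A>0$ with $\int_0^Ta_s^2ds\le A$, $\mathbb{P}_0$-a.s. For $a\in\mathcal{A}$, $\mathbb{P}_a$ is the equivalent probability measure with density $\frac{d\mathbb{P}_a}{d\mathbb{P}_0}=\exp\big(\int_0^Ta_s\,dB_s-\frac12\int_0^Ta_s^2ds\big)$, and $\mathbb{E}^a$ is the expectation under $\mathbb{P}_a$. Preferences: $U_P(x)=-\exp(-\gamma_Px)$ (principal), $U_A(x)=-\exp(-\gamma_Ax)$ (agent). Effort cost $k(a)=\kappa a^2/2$. Agent's problem: for a contract (random payment) $\xi$, $V_0^A(\xi)=\sup_{a\in\mathcal{A}}\mathbb{E}^a\big[U_A\big(\xi-\int_0^Tk(a_s)ds\big)\big]$. The contract is incentive compatible if $V_0^A(\xi)$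 is finite and the supremum is attained by some $a^*(\xi)\in\mathcal{A}$; $a^*(\xi)$ denotes this maximizing effort policy (for the contracts in $\Xi$ below it exists and is unique up to $dt\otimes\mathbb{P}_0$-null sets). The participation constraint is $\mathbb{E}^{a^*(\xi)}\big[U_A\big(\xi-\int_0^Tk(a^*_s(\xi))ds\big)\big]\ge R_0$. Class of contracts: let $f^*(z)=\frac{\gamma_A}{2}z^2+\inf_{a\in\mathbb{R}}\{k(a)-az\}=\frac{\kappa\gamma_A-1}{2\kappa}z^2$. Then $\Xi$ is the set of $\mathcal{F}^X_T$-measurable random variables of the form $$\xi=Y_T^{(y,\beta)}=y+\int_0^Tf^*(\beta_s)\,ds+\int_0^T\beta_s\,dB_s,\qquad y\ge y_0,\ \beta\in\mathcal{A}.$$ *)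

theory Defs
  imports "HOL-Probability.Probability"
begin

section \<open>Filtered probability spaces and Brownian motion on \<open>[0,T]\<close>\<close>

text \<open>Only the indices in \<open>[0,T]\<close> matter; only the \<open>\<sigma>\<close>-algebra of each \<open>F t\<close> is used, never its measure.\<close>

definition filtered_prob_space :: "'a measure \<Rightarrow> (real \<Rightarrow> 'a measure) \<Rightarrow> real \<Rightarrow> bool" where
  "filtered_prob_space M F T \<longleftrightarrow>
     prob_space M \<and>
     (\<forall>t\<in>{0..T}. subalgebra M (F t)) \<and>
     (\<forall>s t. 0 \<le> s \<and> s \<le> t \<and> t \<le> T \<longrightarrow> subalgebra (F t) (F s))"

definition brownian_motion ::
    "'a measure \<Rightarrow> (real \<Rightarrow> 'a measure) \<Rightarrow> real \<Rightarrow> (real \<Rightarrow> 'a \<Rightarrow> real) \<Rightarrow> bool" where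
  "brownian_motion M F T B \<longleftrightarrow>
     (\<forall>t\<in>{0..T}. B t \<in> borel_measurable (F t)) \<and>
     (AE w in M. B 0 w = 0) \<and>
     (AE w in M. continuous_on {0..T} (\<lambda>t. B t w)) \<and>
     (\<forall>s t. 0 \<le> s \<and> s < t \<and> t \<le> T \<longrightarrow>
        distributed M lborel (\<lambda>w. B t w - B s w) (normal_density 0 (sqrt (t - s))) \<and>
        prob_space.indep_set M (sets (F s))
          (sets (vimage_algebra (space M) (\<lambda>w. B t w - B s w) borel)))"

text \<open>Progressive measurability: joint measurability on \<open>[0,t] \<times> \<Omega>\<close> for every \<open>t \<le> T\<close>.\<close>

definition progressively_measurable ::
    "(real \<Rightarrow> 'a measure) \<Rightarrow> real \<Rightarrow> (real \<Rightarrow> 'a \<Rightarrow> real) \<Rightarrow> bool" where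
  "progressively_measurable F T a \<longleftrightarrow>
     (\<forall>t\<in>{0..T}. (\<lambda>(s, w). a s w) \<in> borel_measurable (restrict_space borel {0..t} \<Otimes>\<^sub>M F t))"

text \<open>
  The \<open>\<sigma>\<close>-algebra at time \<open>t\<close> of the augmented filtration of \<open>X\<close>. The null sets are those of \<open>M\<close>
  itself, which are all the negligible sets when \<open>M\<close> is complete; when it is not, this choice keeps
  the augmented \<open>\<sigma>\<close>-algebra inside that of \<open>M\<close>.
\<close>

definition augmented_filtration ::
    "'a measure \<Rightarrow> (real \<Rightarrow> 'a \<Rightarrow> real) \<Rightarrow> real \<Rightarrow> 'a measure" where
  "augmented_filtration M X t =
     sigma (space M) ({X s -` A \<inter> space M | s A. s \<in> {0..t} \<and> A \<in> sets borel} \<union> null_sets M)"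

section \<open>The Ito integral\<close>

text \<open>
  A simple integrand on \<open>[0,t]\<close> is given by a grid \<open>0 \<le> \<tau> 0 \<le> \<dots> \<le> \<tau> n \<le> t\<close> and bounded
  \<open>F (\<tau> i)\<close>-measurable values \<open>h i\<close> on \<open>(\<tau> i, \<tau> (i+1)]\<close>.
\<close>

definition simple_integrand ::
    "'a measure \<Rightarrow> (real \<Rightarrow> 'a measure) \<Rightarrow> real \<Rightarrow> nat \<Rightarrow> (nat \<Rightarrow> real) \<Rightarrow> (nat \<Rightarrow> 'a \<Rightarrow> real) \<Rightarrow> bool" where
  "simple_integrand M F t n \<tau> h \<longleftrightarrow>
     (\<forall>i\<le>n. \<tau> i \<in> {0..t}) \<and> (\<forall>i<n. \<tau> i \<le> \<tau> (Suc i)) \<and>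
     (\<forall>i<n. h i \<in> borel_measurable (F (\<tau> i)) \<and> (\<exists>C. \<forall>w\<in>space M. \<bar>h i w\<bar> \<le> C))"

definition simple_path :: "nat \<Rightarrow> (nat \<Rightarrow> real) \<Rightarrow> (nat \<Rightarrow> 'a \<Rightarrow> real) \<Rightarrow> real \<Rightarrow> 'a \<Rightarrow> real" where
  "simple_path n \<tau> h s w = (\<Sum>i<n. h i w * indicator {\<tau> i<..\<tau> (Suc i)} s)"

definition simple_ito ::
    "(real \<Rightarrow> 'a \<Rightarrow> real) \<Rightarrow> nat \<Rightarrow> (nat \<Rightarrow> real) \<Rightarrow> (nat \<Rightarrow> 'a \<Rightarrow> real) \<Rightarrow> 'a \<Rightarrow> real" where
  "simple_ito B n \<tau> h w = (\<Sum>i<n. h i w * (B (\<tau> (Suc i)) w - B (\<tau> i) w))"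

text \<open>
  \<open>I\<close> is a version of \<open>\<integral>\<^sub>0\<^sup>t H\<^sub>s dB\<^sub>s\<close> if it is the \<open>L\<^sup>2(M)\<close>-limit of the integrals of simple
  integrands converging to \<open>H\<close> in \<open>L\<^sup>2(ds \<otimes> M)\<close>.
\<close>

definition has_ito_integral ::
    "'a measure \<Rightarrow> (real \<Rightarrow> 'a measure) \<Rightarrow> (real \<Rightarrow> 'a \<Rightarrow> real) \<Rightarrow> real \<Rightarrow> (real \<Rightarrow> 'a \<Rightarrow> real) \<Rightarrow> ('a \<Rightarrow> real) \<Rightarrow> bool" where
  "has_ito_integral M F B t H I \<longleftrightarrow>
     I \<in> borel_measurable M \<and>
     (\<exists>n \<tau> h.
        (\<forall>m. simple_integrand M F t (n m) (\<tau> m) (h m)) \<and>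
        (\<lambda>m. \<integral>\<^sup>+ w. (\<integral>\<^sup>+ s\<in>{0..t}. ennreal ((H s w - simple_path (n m) (\<tau> m) (h m) s w)\<^sup>2) \<partial>lborel) \<partial>M)
          \<longlonglongrightarrow> 0 \<and>
        (\<lambda>m. \<integral>\<^sup>+ w. ennreal ((I w - simple_ito B (n m) (\<tau> m) (h m) w)\<^sup>2) \<partial>M) \<longlonglongrightarrow> 0)"

text \<open>A version of \<open>\<integral>\<^sub>0\<^sup>t H\<^sub>s dB\<^sub>s\<close>; as usual it is determined up to null sets only.\<close>

definition ito_integral ::
    "'a measure \<Rightarrow> (real \<Rightarrow> 'a measure) \<Rightarrow> (real \<Rightarrow> 'a \<Rightarrow> real) \<Rightarrow> real \<Rightarrow> (real \<Rightarrow> 'a \<Rightarrow> real) \<Rightarrow> 'a \<Rightarrow> real" where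
  "ito_integral M F B t H = (SOME I. has_ito_integral M F B t H I)"

section \<open>The Gaussian Volterra output process\<close>

definition volterra_kernel :: "real \<Rightarrow> (real \<Rightarrow> real \<Rightarrow> real) \<Rightarrow> bool" where
  "volterra_kernel T K \<longleftrightarrow>
     (\<lambda>(t, s). K t s) \<in> borel_measurable (restrict_space borel {0..T} \<Otimes>\<^sub>M restrict_space borel {0..T}) \<and>
     (\<forall>t\<in>{0..T}. \<forall>s\<in>{0..T}. t \<le> s \<longrightarrow> K t s = 0) \<and>
     (SUP t\<in>{0..T}. \<integral>\<^sup>+ s\<in>{0..T}. ennreal ((K t s)\<^sup>2) \<partial>lborel) < \<infinity>"

definition volterra_output ::
    "'a measure \<Rightarrow> (real \<Rightarrow> 'a measure) \<Rightarrow> (real \<Rightarrow> 'a \<Rightarrow> real) \<Rightarrow> real \<Rightarrow>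
     (real \<Rightarrow> real) \<Rightarrow> (real \<Rightarrow> real \<Rightarrow> real) \<Rightarrow> (real \<Rightarrow> 'a \<Rightarrow> real) \<Rightarrow> bool" where
  "volterra_output M F B T g0 K X \<longleftrightarrow>
     (\<forall>t\<in>{0..T}. X t \<in> borel_measurable M \<and>
        (AE w in M. X t w = g0 t + ito_integral M F B t (\<lambda>s w. K t s) w))"

section \<open>Efforts and preferences\<close>

text \<open>
  The bound uses the nonnegative integral: the Bochner integral of a nonintegrable function is \<open>0\<close>
  and would admit efforts with \<open>\<integral>\<^sub>0\<^sup>T a\<^sub>s\<^sup>2 ds = \<infinity>\<close>.
\<close>

definition admissible :: "'a measure \<Rightarrow> (real \<Rightarrow> 'a measure) \<Rightarrow> real \<Rightarrow> (real \<Rightarrow> 'a \<Rightarrow> real) set" where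
  "admissible M F T =
     {a. progressively_measurable F T a \<and>
         (\<exists>A>0. AE w in M. (\<integral>\<^sup>+ s\<in>{0..T}. ennreal ((a s w)\<^sup>2) \<partial>lborel) \<le> ennreal A)}"

definition effort_measure ::
    "'a measure \<Rightarrow> (real \<Rightarrow> 'a measure) \<Rightarrow> (real \<Rightarrow> 'a \<Rightarrow> real) \<Rightarrow> real \<Rightarrow> (real \<Rightarrow> 'a \<Rightarrow> real) \<Rightarrow> 'a measure" where
  "effort_measure M F B T a =
     density M (\<lambda>w. ennreal (exp (ito_integral M F B T a w - 1 / 2 * (LINT s:{0..T}|lborel. (a s w)\<^sup>2))))"

text \<open>
  The expectation with values in \<open>[-\<infinity>, \<infinity>]\<close> (note that \<open>ennreal\<close> truncates negative reals to \<open>0\<close>).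
  The Bochner integral would assign the value \<open>0\<close> to an expected utility that is really \<open>-\<infinity>\<close>.
\<close>

definition ext_expectation :: "'a measure \<Rightarrow> ('a \<Rightarrow> real) \<Rightarrow> ereal" where
  "ext_expectation P Z =
     enn2ereal (\<integral>\<^sup>+ w. ennreal (Z w) \<partial>P) - enn2ereal (\<integral>\<^sup>+ w. ennreal (- Z w) \<partial>P)"

definition cara_utility :: "real \<Rightarrow> real \<Rightarrow> real" where
  "cara_utility \<gamma> x = - exp (- \<gamma> * x)"

definition effort_cost :: "real \<Rightarrow> real \<Rightarrow> real" where
  "effort_cost \<kappa> a = \<kappa> * a\<^sup>2 / 2"

section \<open>The agent's problem\<close>

definition agent_objective ::
    "'a measure \<Rightarrow> (real \<Rightarrow> 'a measure) \<Rightarrow> (real \<Rightarrow> 'a \<Rightarrow> real) \<Rightarrow> real \<Rightarrow> real \<Rightarrow> real \<Rightarrow>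
     ('a \<Rightarrow> real) \<Rightarrow> (real \<Rightarrow> 'a \<Rightarrow> real) \<Rightarrow> ereal" where
  "agent_objective M F B T \<gamma>A \<kappa> \<xi> a =
     ext_expectation (effort_measure M F B T a)
       (\<lambda>w. cara_utility \<gamma>A (\<xi> w - (LINT s:{0..T}|lborel. effort_cost \<kappa> (a s w))))"

definition agent_value ::
    "'a measure \<Rightarrow> (real \<Rightarrow> 'a measure) \<Rightarrow> (real \<Rightarrow> 'a \<Rightarrow> real) \<Rightarrow> real \<Rightarrow> real \<Rightarrow> real \<Rightarrow>
     ('a \<Rightarrow> real) \<Rightarrow> ereal" where
  "agent_value M F B T \<gamma>A \<kappa> \<xi> = (SUP a\<in>admissible M F T. agent_objective M F B T \<gamma>A \<kappa> \<xi> a)"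

definition optimal_effort ::
    "'a measure \<Rightarrow> (real \<Rightarrow> 'a measure) \<Rightarrow> (real \<Rightarrow> 'a \<Rightarrow> real) \<Rightarrow> real \<Rightarrow> real \<Rightarrow> real \<Rightarrow>
     ('a \<Rightarrow> real) \<Rightarrow> (real \<Rightarrow> 'a \<Rightarrow> real) \<Rightarrow> bool" where
  "optimal_effort M F B T \<gamma>A \<kappa> \<xi> a \<longleftrightarrow>
     a \<in> admissible M F T \<and> agent_objective M F B T \<gamma>A \<kappa> \<xi> a = agent_value M F B T \<gamma>A \<kappa> \<xi>"

definition incentive_compatible ::
    "'a measure \<Rightarrow> (real \<Rightarrow> 'a measure) \<Rightarrow> (real \<Rightarrow> 'a \<Rightarrow> real) \<Rightarrow> real \<Rightarrow> real \<Rightarrow> real \<Rightarrow>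
     ('a \<Rightarrow> real) \<Rightarrow> bool" where
  "incentive_compatible M F B T \<gamma>A \<kappa> \<xi> \<longleftrightarrow>
     \<bar>agent_value M F B T \<gamma>A \<kappa> \<xi>\<bar> \<noteq> \<infinity> \<and> (\<exists>a. optimal_effort M F B T \<gamma>A \<kappa> \<xi> a)"

text \<open>The maximizing policy \<open>a\<^sup>*(\<xi>)\<close>, which for the contracts below is unique up to \<open>dt \<otimes> M\<close>-null sets.\<close>

definition best_effort ::
    "'a measure \<Rightarrow> (real \<Rightarrow> 'a measure) \<Rightarrow> (real \<Rightarrow> 'a \<Rightarrow> real) \<Rightarrow> real \<Rightarrow> real \<Rightarrow> real \<Rightarrow>
     ('a \<Rightarrow> real) \<Rightarrow> real \<Rightarrow> 'a \<Rightarrow> real" where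
  "best_effort M F B T \<gamma>A \<kappa> \<xi> = (SOME a. optimal_effort M F B T \<gamma>A \<kappa> \<xi> a)"

definition participation ::
    "'a measure \<Rightarrow> (real \<Rightarrow> 'a measure) \<Rightarrow> (real \<Rightarrow> 'a \<Rightarrow> real) \<Rightarrow> real \<Rightarrow> real \<Rightarrow> real \<Rightarrow>
     real \<Rightarrow> ('a \<Rightarrow> real) \<Rightarrow> bool" where
  "participation M F B T \<gamma>A \<kappa> R0 \<xi> \<longleftrightarrow>
     agent_objective M F B T \<gamma>A \<kappa> \<xi> (best_effort M F B T \<gamma>A \<kappa> \<xi>) \<ge> ereal R0"

section \<open>Contracts and the principal's problem\<close>

definition fstar :: "real \<Rightarrow> real \<Rightarrow> real \<Rightarrow> real" where
  "fstar \<gamma>A \<kappa> z = \<gamma>A / 2 * z\<^sup>2 + (INF a. effort_cost \<kappa> a - a * z)"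

lemma fstar_eq:
  assumes "\<kappa> > 0"
  shows "fstar \<gamma>A \<kappa> z = (\<kappa> * \<gamma>A - 1) / (2 * \<kappa>) * z\<^sup>2"
proof -
  have sq: "effort_cost \<kappa> a - a * z = \<kappa> / 2 * (a - z / \<kappa>)\<^sup>2 - z\<^sup>2 / (2 * \<kappa>)" for a
    using assms by (simp add: effort_cost_def power2_diff power_divide power2_eq_square algebra_simps)
  have lower: "- (z\<^sup>2 / (2 * \<kappa>)) \<le> effort_cost \<kappa> a - a * z" for a
    unfolding sq using assms by simp
  have attained: "effort_cost \<kappa> (z / \<kappa>) - z / \<kappa> * z = - (z\<^sup>2 / (2 * \<kappa>))"
    unfolding sq by simp
  have "(INF a. effort_cost \<kappa> a - a * z) = - (z\<^sup>2 / (2 * \<kappa>))"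
    using rangeI[of "\<lambda>a. effort_cost \<kappa> a - a * z" "z / \<kappa>"] lower
    by (intro cInf_eq_minimum) (unfold attained, blast+)
  then have "fstar \<gamma>A \<kappa> z = (\<gamma>A / 2 - 1 / (2 * \<kappa>)) * z\<^sup>2"
    unfolding fstar_def by (simp only: left_diff_distrib) simp
  also have "\<gamma>A / 2 - 1 / (2 * \<kappa>) = (\<kappa> * \<gamma>A - 1) / (2 * \<kappa>)"
    using assms by (simp add: diff_divide_distrib)
  finally show ?thesis .
qed

text \<open>
  The contracts \<open>\<xi> = y + \<integral>\<^sub>0\<^sup>T f\<^sup>*(\<beta>\<^sub>s) ds + \<integral>\<^sub>0\<^sup>T \<beta>\<^sub>s dB\<^sub>s\<close>. The representation is almost sure, as
  the stochastic integral is.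
\<close>

definition contracts ::
    "'a measure \<Rightarrow> (real \<Rightarrow> 'a measure) \<Rightarrow> (real \<Rightarrow> 'a \<Rightarrow> real) \<Rightarrow> real \<Rightarrow> (real \<Rightarrow> 'a \<Rightarrow> real) \<Rightarrow>
     real \<Rightarrow> real \<Rightarrow> real \<Rightarrow> ('a \<Rightarrow> real) set" where
  "contracts M F B T X \<gamma>A \<kappa> y0 =
     {\<xi>. \<xi> \<in> borel_measurable (augmented_filtration M X T) \<and>
         (\<exists>y\<ge>y0. \<exists>\<beta>\<in>admissible M F T. AE w in M.
            \<xi> w = y + (LINT s:{0..T}|lborel. fstar \<gamma>A \<kappa> (\<beta> s w)) + ito_integral M F B T \<beta> w)}"

definition principal_objective ::
    "'a measure \<Rightarrow> (real \<Rightarrow> 'a measure) \<Rightarrow> (real \<Rightarrow> 'a \<Rightarrow> real) \<Rightarrow> real \<Rightarrow> (real \<Rightarrow> 'a \<Rightarrow> real) \<Rightarrow>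
     real \<Rightarrow> real \<Rightarrow> real \<Rightarrow> ('a \<Rightarrow> real) \<Rightarrow> ereal" where
  "principal_objective M F B T X \<gamma>P \<gamma>A \<kappa> \<xi> =
     ext_expectation (effort_measure M F B T (best_effort M F B T \<gamma>A \<kappa> \<xi>))
       (\<lambda>w. cara_utility \<gamma>P (X T w - \<xi> w))"

definition principal_value ::
    "'a measure \<Rightarrow> (real \<Rightarrow> 'a measure) \<Rightarrow> (real \<Rightarrow> 'a \<Rightarrow> real) \<Rightarrow> real \<Rightarrow> (real \<Rightarrow> 'a \<Rightarrow> real) \<Rightarrow>
     real \<Rightarrow> real \<Rightarrow> real \<Rightarrow> real \<Rightarrow> real \<Rightarrow> ereal" where
  "principal_value M F B T X \<gamma>P \<gamma>A \<kappa> y0 R0 =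
     (SUP \<xi>\<in>{\<xi> \<in> contracts M F B T X \<gamma>A \<kappa> y0. participation M F B T \<gamma>A \<kappa> R0 \<xi>}.
        principal_objective M F B T X \<gamma>P \<gamma>A \<kappa> \<xi>)"

end

theory Submission
  imports Defs
begin

text \<open>
  For a contract with data \<open>(y, \<beta>)\<close> the density of \<open>\<P>\<^sub>a\<close> times \<open>exp (- \<gamma>A (\<xi> - \<integral> k(a)))\<close> is the stochastic
  exponential of \<open>a - \<gamma>A \<beta>\<close> times \<open>exp (- \<gamma>A y + \<gamma>A \<kappa>/2 \<integral> (a - \<beta>/\<kappa>)\<^sup>2)\<close>. Stochastic exponentials
  of admissible processes have mean \<open>1\<close>, so the agent's optimum is exactly \<open>a = \<beta>/\<kappa>\<close>, with value
  \<open>U\<^sub>A(y)\<close>. Inserting this effort, the principal's exponent is that of the stochastic exponential of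
  \<open>(\<gamma>P + 1/\<kappa>) \<beta> - \<gamma>P K(T,\<cdot>)\<close> plus a deterministic term plus a positive multiple of
  \<open>\<integral> (\<beta> - c K(T,\<cdot>))\<^sup>2\<close>, so that \<open>\<beta> = c K(T,\<cdot>)\<close> and \<open>y = y\<^sub>0\<close> are optimal. No change of Brownian
  motion is needed.

  The Ito integral of an admissible process is approximated by replacing the process on each cell of
  a uniform grid by its mean over the previous cell: this keeps it adapted, does not increase
  \<open>\<integral> H\<^sup>2\<close>, and converges in \<open>L\<^sup>2\<close>.
\<close>

section \<open>Delayed averages on a uniform grid\<close>

text \<open>The admissibility bound, a deterministic constant above the integral of a^2, carries the
  analysis: it dominates the L2 approximation uniformly in the outcome and keeps mass from escaping
  when the discrete exponentials pass to the limit. Without such a bound a stochastic exponential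
  may have mean below 1. \<open>ito_integral\<close> and \<open>best_effort\<close> are
  \<open>SOME\<close>-choices, so existence, almost sure uniqueness and linearity must be proved
  before any exponent can be rearranged, and every identity between exponents is almost sure.
  Utilities are negative exponentials, so expectations are kept as nonnegative integrals that may be
  infinite; an effort or contract with expected utility minus infinity then needs no separate
  treatment. The constant c is a minimizer: once the stochastic exponential is removed, the
  principal's exponent depends on \<beta> through \<gamma>P times the integral of D/2 \<beta>^2 -
  (\<gamma>P + 1/\<kappa>) \<beta> K, with D = \<gamma>A + \<gamma>P + 1/\<kappa>, and this is least
  at \<beta> = c K.\<close>

lemma ennreal_sum_square_le:
  fixes x :: "'i \<Rightarrow> real"
  assumes "finite S"
  shows "ennreal ((\<Sum>i\<in>S. x i)\<^sup>2) \<le> of_nat (card S) * (\<Sum>i\<in>S. ennreal ((x i)\<^sup>2))"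
proof -
  have "(\<Sum>i\<in>S. x i)\<^sup>2 \<le> (\<Sum>i\<in>S. (x i)\<^sup>2) * real (card S)"
    using sum_squared_le_sum_of_squares[of x S] by (simp add: mult.commute)
  then have "ennreal ((\<Sum>i\<in>S. x i)\<^sup>2) \<le> ennreal (real (card S) * (\<Sum>i\<in>S. (x i)\<^sup>2))"
    by (intro ennreal_leI) (simp add: mult.commute)
  also have "\<dots> = of_nat (card S) * (\<Sum>i\<in>S. ennreal ((x i)\<^sup>2))"
    by (subst ennreal_mult) (auto simp: sum_nonneg sum_ennreal ennreal_of_nat_eq_real_of_nat)
  finally show ?thesis .
qed

lemma ennreal_square_add_le:
  fixes x y :: real
  shows "ennreal ((x + y)\<^sup>2) \<le> 2 * (ennreal (x\<^sup>2) + ennreal (y\<^sup>2))"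
  using ennreal_sum_square_le[of "{..<2::nat}" "\<lambda>i. if i = 0 then x else y"]
  by (simp add: numeral_2_eq_2 lessThan_Suc add.commute)

lemma ennreal_square_add3_le:
  fixes x y z :: real
  shows "ennreal ((x + y + z)\<^sup>2) \<le> 3 * (ennreal (x\<^sup>2) + ennreal (y\<^sup>2) + ennreal (z\<^sup>2))"
  using ennreal_sum_square_le[of "{..<3::nat}" "\<lambda>i. if i = 0 then x else if i = 1 then y else z"]
  by (simp add: numeral_3_eq_3 lessThan_Suc add_ac)

lemma tendsto_ennreal_zero_squeeze:
  fixes f g :: "nat \<Rightarrow> ennreal"
  assumes "g \<longlonglongrightarrow> 0" "\<And>n. f n \<le> g n"
  shows "f \<longlonglongrightarrow> 0"
  using tendsto_sandwich[of "\<lambda>_. 0" f sequentially g 0] assms by auto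

text \<open>Truncation is used twice: it supplies a dominating constant when L2 functions are
  approximated by continuous ones, and it makes the random values of a simple integrand bounded at
  every outcome rather than almost surely.\<close>

definition clip :: "real \<Rightarrow> real \<Rightarrow> real" where
  "clip C x = max (- C) (min C x)"

lemma clip_measurable [measurable]: "clip C \<in> borel_measurable borel"
  unfolding clip_def[abs_def] by measurable

lemma abs_clip_le: "0 \<le> C \<Longrightarrow> \<bar>clip C x\<bar> \<le> C"
  by (auto simp: clip_def)

lemma clip_eq: "\<bar>x\<bar> \<le> C \<Longrightarrow> clip C x = x"
  by (auto simp: clip_def)

lemma clip_diff_le: "0 \<le> C \<Longrightarrow> \<bar>x - clip C x\<bar> \<le> \<bar>x\<bar>"
  by (auto simp: clip_def)

lemma isCont_clip: "isCont (clip C) x"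
  unfolding clip_def[abs_def] by (intro continuous_intros)

lemma clip_tendsto: "(\<lambda>n. clip (real n) x) \<longlonglongrightarrow> x"
proof (rule tendsto_eventually)
  obtain n0 where "\<bar>x\<bar> \<le> real n0" using real_arch_simple by blast
  then show "\<forall>\<^sub>F n in sequentially. clip (real n) x = x"
    by (intro eventually_sequentiallyI[of n0] clip_eq) simp
qed

section \<open>Density of continuous functions in L2\<close>

abbreviation sq_integral :: "real \<Rightarrow> (real \<Rightarrow> real) \<Rightarrow> ennreal" where
  "sq_integral T f \<equiv> \<integral>\<^sup>+ s\<in>{0..T}. ennreal ((f s)\<^sup>2) \<partial>lborel"

text \<open>\<open>f\<close> is truncated first because almost everywhere convergence of continuous
  functions brings no dominating function of its own; after truncation a constant dominates.\<close>

lemma continuous_dense_L2: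
  fixes f :: "real \<Rightarrow> real"
  assumes [measurable]: "f \<in> borel_measurable borel"
    and fin: "sq_integral T f < \<infinity>" and "0 < e"
  obtains g where "continuous_on UNIV g" "sq_integral T (\<lambda>s. f s - g s) < e"
proof -
  have "(\<lambda>n. sq_integral T (\<lambda>s. f s - clip (real n) (f s)))
      \<longlonglongrightarrow> (\<integral>\<^sup>+ s\<in>{0..T}. ennreal (0\<^sup>2) \<partial>lborel)"
  proof (rule nn_integral_dominated_convergence[where w = "\<lambda>s. ennreal ((f s)\<^sup>2) * indicator {0..T} s"])
    show "AE s in lborel. (\<lambda>n. ennreal ((f s - clip (real n) (f s))\<^sup>2) * indicator {0..T} s)
        \<longlonglongrightarrow> ennreal (0\<^sup>2) * indicator {0..T} s"
    proof (intro AE_I2)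
      fix s
      have "(\<lambda>n. (f s - clip (real n) (f s))\<^sup>2) \<longlonglongrightarrow> (f s - f s)\<^sup>2"
        by (intro tendsto_intros clip_tendsto)
      then have "(\<lambda>n. ennreal ((f s - clip (real n) (f s))\<^sup>2)) \<longlonglongrightarrow> ennreal (0\<^sup>2)"
        by (intro tendsto_ennrealI) simp
      then show "(\<lambda>n. ennreal ((f s - clip (real n) (f s))\<^sup>2) * indicator {0..T} s)
          \<longlonglongrightarrow> ennreal (0\<^sup>2) * indicator {0..T} s"
        by (cases "s \<in> {0..T}") auto
    qed
    have "(x - clip (real n) x)\<^sup>2 \<le> x\<^sup>2" for x n
      by (intro abs_le_square_iff[THEN iffD1] clip_diff_le) simp
    then show "AE s in lborel. ennreal ((f s - clip (real n) (f s))\<^sup>2) * indicator {0..T} s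
        \<le> ennreal ((f s)\<^sup>2) * indicator {0..T} s" for n
      by (intro AE_I2 mult_right_mono ennreal_leI) auto
  qed (use fin in auto)
  then have "(\<lambda>n. sq_integral T (\<lambda>s. f s - clip (real n) (f s))) \<longlonglongrightarrow> 0"
    by simp
  \<comment> \<open>The square of a sum of two errors costs a factor 2, so two errors below e / 4
    give 2 (e / 4 + e / 4) = e.\<close>
  moreover have e4: "e / 4 > 0"
    using \<open>0 < e\<close> by (simp add: ennreal_zero_less_divide)
  ultimately have "\<forall>\<^sub>F n in sequentially.
      sq_integral T (\<lambda>s. f s - clip (real n) (f s)) < e / 4"
    by (rule order_tendstoD(2))
  from eventually_happens'[OF sequentially_bot this]
  obtain k where k: "sq_integral T (\<lambda>s. f s - clip (real k) (f s)) < e / 4"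
    by blast
  \<comment> \<open>This notion of measurability means, by definition, being an almost everywhere
    limit of continuous functions, which is where \<open>g\<close> comes from.\<close>
  have "f measurable_on UNIV"
    by (rule lebesgue_measurable_imp_measurable_on) (auto intro: measurable_completion)
  then obtain N g where N: "negligible N" and g: "\<And>n. continuous_on UNIV (g n)"
      "\<And>x. x \<notin> N \<Longrightarrow> (\<lambda>n. g n x) \<longlonglongrightarrow> f x"
    unfolding measurable_on_def by auto
  have AEN: "AE s in lborel. s \<notin> N"
    using N AE_not_in[of N lebesgue] by (simp add: negligible_iff_null_sets AE_completion_iff)
  \<comment> \<open>Clipping \<open>g n\<close> at the level k already fixed for \<open>f\<close>
    keeps it continuous and bounds the difference by 2 k, a constant of finite integral over
    [0,T].\<close>
  have gc: "continuous_on UNIV (\<lambda>s. clip (real k) (g n s))" for n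
    using g(1)[of n] unfolding clip_def by (intro continuous_intros)
  have [measurable]: "g n \<in> borel_measurable borel" for n
    using g(1) by (rule borel_measurable_continuous_onI)
  have "(\<lambda>n. sq_integral T (\<lambda>s. clip (real k) (f s) - clip (real k) (g n s)))
      \<longlonglongrightarrow> (\<integral>\<^sup>+ s\<in>{0..T}. ennreal (0\<^sup>2) \<partial>lborel)"
  proof (rule nn_integral_dominated_convergence[where w = "\<lambda>s. ennreal ((2 * real k)\<^sup>2) * indicator {0..T} s"])
    have "\<bar>clip (real k) x - clip (real k) y\<bar> \<le> \<bar>2 * real k\<bar>" for x y
      using abs_clip_le[of "real k" x] abs_clip_le[of "real k" y] by auto
    from abs_le_square_iff[THEN iffD1, OF this]
    show "AE s in lborel. ennreal ((clip (real k) (f s) - clip (real k) (g n s))\<^sup>2) * indicator {0..T} s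
        \<le> ennreal ((2 * real k)\<^sup>2) * indicator {0..T} s" for n
      by (intro AE_I2 mult_right_mono ennreal_leI) auto
    show "AE s in lborel. (\<lambda>n. ennreal ((clip (real k) (f s) - clip (real k) (g n s))\<^sup>2) * indicator {0..T} s)
        \<longlonglongrightarrow> ennreal (0\<^sup>2) * indicator {0..T} s"
      using AEN
    proof eventually_elim
      fix s assume "s \<notin> N"
      have "(\<lambda>n. (clip (real k) (f s) - clip (real k) (g n s))\<^sup>2) \<longlonglongrightarrow> (clip (real k) (f s) - clip (real k) (f s))\<^sup>2"
        by (intro tendsto_intros isCont_tendsto_compose[OF isCont_clip] g(2) \<open>s \<notin> N\<close>)
      then have "(\<lambda>n. ennreal ((clip (real k) (f s) - clip (real k) (g n s))\<^sup>2)) \<longlonglongrightarrow> ennreal (0\<^sup>2)"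
        by (intro tendsto_ennrealI) simp
      then show "(\<lambda>n. ennreal ((clip (real k) (f s) - clip (real k) (g n s))\<^sup>2) * indicator {0..T} s)
          \<longlonglongrightarrow> ennreal (0\<^sup>2) * indicator {0..T} s"
        by (cases "s \<in> {0..T}") auto
    qed
    show "(\<integral>\<^sup>+ s. ennreal ((2 * real k)\<^sup>2) * indicator {0..T} s \<partial>lborel) < \<infinity>"
      by (simp add: nn_integral_cmult_indicator ennreal_mult_less_top emeasure_lborel_Icc_eq)
  qed auto
  then have "(\<lambda>n. sq_integral T (\<lambda>s. clip (real k) (f s) - clip (real k) (g n s))) \<longlonglongrightarrow> 0"
    by simp
  from eventually_happens'[OF sequentially_bot order_tendstoD(2)[OF this e4]] obtain n where
    n: "sq_integral T (\<lambda>s. clip (real k) (f s) - clip (real k) (g n s)) < e / 4"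
    by blast
  let ?u = "\<lambda>s. f s - clip (real k) (f s)" and ?v = "\<lambda>s. clip (real k) (f s) - clip (real k) (g n s)"
  have "sq_integral T (\<lambda>s. f s - clip (real k) (g n s))
      \<le> (\<integral>\<^sup>+ s. 2 * (ennreal ((?u s)\<^sup>2) * indicator {0..T} s + ennreal ((?v s)\<^sup>2) * indicator {0..T} s) \<partial>lborel)"
    using ennreal_square_add_le[of "?u s" "?v s" for s]
    by (intro nn_integral_mono) (auto simp: indicator_def)
  also have "\<dots> = 2 * (sq_integral T ?u + sq_integral T ?v)"
    by (simp add: nn_integral_cmult nn_integral_add)
  also have "\<dots> < 2 * (e / 4 + e / 4)"
    using k n by (intro ennreal_mult_strict_left_mono add_strict_mono) auto
  also have "\<dots> \<le> e"
  proof (cases e)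
    case (real r)
    have "2 * (ennreal r / 4 + ennreal r / 4) = ennreal 2 * (ennreal (r / 4) + ennreal (r / 4))"
      using real by (simp add: divide_ennreal flip: ennreal_numeral)
    also have "\<dots> = ennreal r"
      using real ennreal_plus[of "r / 4" "r / 4"] ennreal_mult[of 2 "r / 2"] by simp
    finally have "2 * (ennreal r / 4 + ennreal r / 4) = ennreal r" .
    then show ?thesis using real by simp
  qed simp
  finally show ?thesis
    using gc[of n] by (intro that[of "\<lambda>s. clip (real k) (g n s)"]) auto
qed


text \<open>
  The value on \<open>(i\<delta>, (i+1)\<delta>]\<close>, \<open>\<delta> = T / N\<close>, of the approximation of \<open>f\<close> by its mean over the
  preceding cell; the shift by one cell makes the approximation of an adapted process adapted.
\<close>

definition cell_mean :: "real \<Rightarrow> nat \<Rightarrow> (real \<Rightarrow> real) \<Rightarrow> nat \<Rightarrow> real" where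
  "cell_mean T N f i = (real N / T) *
     (LINT s:{(real i - 1) * (T / N)<..real i * (T / N)} \<inter> {0..T}|lborel. f s)"

text \<open>The first cell gets the value 0, since the cell before it meets [0,T] only in the point
  0. The averages stop at T - T/N, one cell before the end.\<close>

definition delayed_mean :: "real \<Rightarrow> nat \<Rightarrow> (real \<Rightarrow> real) \<Rightarrow> real \<Rightarrow> real" where
  "delayed_mean T N f s =
     (\<Sum>i<N. cell_mean T N f i * indicator {real i * (T / N)<..real (Suc i) * (T / N)} s)"

lemma delayed_mean_measurable [measurable]: "delayed_mean T N f \<in> borel_measurable borel"
  unfolding delayed_mean_def[abs_def] by measurable

section \<open>Cells of the uniform grid and step functions on them\<close>

lemma grid_cells_disjoint:
  fixes \<delta> :: real
  assumes "0 < \<delta>" "real i * \<delta> < s" "s \<le> real (Suc i) * \<delta>" "real j * \<delta> < s" "s \<le> real (Suc j) * \<delta>"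
  shows "i = j"
proof -
  have "real i * \<delta> < real (Suc j) * \<delta>" "real j * \<delta> < real (Suc i) * \<delta>"
    using assms by linarith+
  then show ?thesis using \<open>0 < \<delta>\<close> by (simp add: mult_less_cancel_right)
qed

text \<open>Stated over a semiring because it is applied both to real step functions and to the
  \<open>ennreal\<close> step functions formed by their squares.\<close>

lemma grid_sum_eq:
  fixes v :: "nat \<Rightarrow> 'b::comm_semiring_1" and \<delta> :: real
  assumes "0 < \<delta>" "i < N" "s \<in> {real i * \<delta><..real (Suc i) * \<delta>}"
  shows "(\<Sum>j<N. v j * indicator {real j * \<delta><..real (Suc j) * \<delta>} s) = v i"
proof -
  have "(\<Sum>j<N. v j * indicator {real j * \<delta><..real (Suc j) * \<delta>} s) = (\<Sum>j<N. if j = i then v j else 0)"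
    using assms grid_cells_disjoint[OF \<open>0 < \<delta>\<close>, of i s]
    by (intro sum.cong refl) (auto simp: indicator_def)
  then show ?thesis using \<open>i < N\<close> by simp
qed

lemma grid_cell_exists:
  fixes \<delta> :: real
  assumes "0 < \<delta>" "0 < s" "s \<le> real N * \<delta>"
  obtains i where "i < N" "s \<in> {real i * \<delta><..real (Suc i) * \<delta>}"
proof -
  \<comment> \<open>The cells are open on the left, so the index comes from the ceiling of s /
    \<delta>, lowered by one because cells are numbered from 0.\<close>
  define k where "k = nat \<lceil>s / \<delta>\<rceil>"
  have "0 < s / \<delta>" "s / \<delta> \<le> real N"
    using assms by (auto simp: field_simps)
  then have "0 < k" "k \<le> N" "real k - 1 < s / \<delta>" "s / \<delta> \<le> real k"
    unfolding k_def by linarith+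
  then have "k - 1 < N" "real (k - 1) * \<delta> < s" "s \<le> real (Suc (k - 1)) * \<delta>"
    using \<open>0 < \<delta>\<close> by (auto simp: field_simps of_nat_diff)
  then show ?thesis by (intro that[of "k - 1"]) auto
qed

section \<open>Mean-square bounds for cell means\<close>

lemma set_integrable_of_square:
  fixes f :: "real \<Rightarrow> real"
  assumes [measurable]: "f \<in> borel_measurable borel" "A \<in> sets borel"
    and fin: "sq_integral T f < \<infinity>"
  shows "set_integrable lborel (A \<inter> {0..T}) f"
    and "set_integrable lborel (A \<inter> {0..T}) (\<lambda>s. (f s)\<^sup>2)"
proof -
  have sq: "integrable lborel (\<lambda>s. indicator {0..T} s * (f s)\<^sup>2)"
  proof (rule integrableI_bounded)
    have "(\<integral>\<^sup>+ s. ennreal (norm (indicator {0..T} s * (f s)\<^sup>2)) \<partial>lborel) = sq_integral T f"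
      by (intro nn_integral_cong) (auto simp: indicator_def)
    then show "(\<integral>\<^sup>+ s. ennreal (norm (indicator {0..T} s * (f s)\<^sup>2)) \<partial>lborel) < \<infinity>"
      using fin by simp
  qed simp
  show "set_integrable lborel (A \<inter> {0..T}) (\<lambda>s. (f s)\<^sup>2)"
    unfolding set_integrable_def
    by (rule Bochner_Integration.integrable_bound[OF sq]) (auto simp: indicator_def)
  have one: "integrable lborel (\<lambda>s. indicator {0..T} s * (1::real))"
    by (simp add: integrable_indicator_iff emeasure_lborel_Icc_eq)
  show "set_integrable lborel (A \<inter> {0..T}) f"
    unfolding set_integrable_def
  proof (rule Bochner_Integration.integrable_bound[OF Bochner_Integration.integrable_add[OF sq one]])
    \<comment> \<open>[0,T] has finite length, so square integrability gives integrability through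
      |x| <= x^2 + 1.\<close>
    have "\<bar>x\<bar> \<le> x\<^sup>2 + 1" for x :: real
    proof -
      have "2 * \<bar>x\<bar> \<le> x\<^sup>2 + 1"
        using zero_le_power2[of "\<bar>x\<bar> - 1"] by (simp add: power2_diff)
      then show ?thesis by linarith
    qed
    then show "AE s in lborel. norm (indicator (A \<inter> {0..T}) s *\<^sub>R f s)
        \<le> norm (indicator {0..T} s * (f s)\<^sup>2 + indicator {0..T} s * 1)"
      by (intro AE_I2) (auto simp: indicator_def)
  qed simp
qed

lemma nn_integral_square_eq:
  fixes f :: "real \<Rightarrow> real"
  assumes [measurable]: "f \<in> borel_measurable borel"
    and fin: "sq_integral T f < \<infinity>"
  shows "sq_integral T f = ennreal (LINT s:{0..T}|lborel. (f s)\<^sup>2)"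
proof -
  have "integrable lborel (\<lambda>s. indicator {0..T} s *\<^sub>R (f s)\<^sup>2)"
    using set_integrable_of_square(2)[OF assms(1) _ fin, of UNIV] by (simp add: set_integrable_def)
  then have "(\<integral>\<^sup>+ s. ennreal (indicator {0..T} s *\<^sub>R (f s)\<^sup>2) \<partial>lborel) = ennreal (LINT s:{0..T}|lborel. (f s)\<^sup>2)"
    unfolding set_lebesgue_integral_def by (intro nn_integral_eq_integral) auto
  moreover have "(\<integral>\<^sup>+ s. ennreal (indicator {0..T} s *\<^sub>R (f s)\<^sup>2) \<partial>lborel) = sq_integral T f"
    by (intro nn_integral_cong) (simp add: indicator_def)
  ultimately show ?thesis by simp
qed

lemma emeasure_cell_le:
  fixes \<delta> :: real
  assumes "\<delta> > 0"
  shows "emeasure lborel ({(real i - 1) * \<delta><..real i * \<delta>} \<inter> A) \<le> ennreal \<delta>"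
proof -
  have "emeasure lborel ({(real i - 1) * \<delta><..real i * \<delta>} \<inter> A) \<le> emeasure lborel {(real i - 1) * \<delta><..real i * \<delta>}"
    by (intro emeasure_mono) auto
  also have "\<dots> = ennreal \<delta>"
    using \<open>\<delta> > 0\<close> by (simp add: left_diff_distrib)
  finally show ?thesis .
qed

text \<open>Cauchy-Schwarz on the cell against the constant 1. Cutting the cell off at 0 can only
  shorten it, so its length enters merely as a bound by T / N.\<close>

lemma cell_mean_square_le:
  fixes f :: "real \<Rightarrow> real"
  assumes [measurable]: "f \<in> borel_measurable borel" and "0 < T" "0 < N"
    and fin: "sq_integral T f < \<infinity>"
  shows "ennreal (T / N * (cell_mean T N f i)\<^sup>2)
    \<le> (\<integral>\<^sup>+ s\<in>{(real i - 1) * (T / N)<..real i * (T / N)} \<inter> {0..T}. ennreal ((f s)\<^sup>2) \<partial>lborel)"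
proof -
  define \<delta> where "\<delta> = T / N"
  define J where "J = {(real i - 1) * \<delta><..real i * \<delta>} \<inter> {0..T}"
  have "\<delta> > 0" using assms by (simp add: \<delta>_def)
  have [measurable]: "J \<in> sets borel" by (simp add: J_def)
  have int: "set_integrable lborel J f" "set_integrable lborel J (\<lambda>s. (f s)\<^sup>2)"
    unfolding J_def using set_integrable_of_square[OF _ _ fin] by auto
  have mJ: "emeasure lborel J \<le> ennreal \<delta>"
    unfolding J_def using \<open>\<delta> > 0\<close> by (rule emeasure_cell_le)
  have cm: "cell_mean T N f i = (1 / \<delta>) * (LINT s:J|lborel. f s)"
    by (simp add: cell_mean_def J_def \<delta>_def)
  have "ennreal \<bar>LINT s:J|lborel. f s\<bar> \<le> (\<integral>\<^sup>+ s. ennreal (norm (indicator J s *\<^sub>R f s)) \<partial>lborel)"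
    using integral_norm_bound_ennreal[OF int(1)[unfolded set_integrable_def]]
    by (simp add: set_lebesgue_integral_def)
  also have "\<dots> = (\<integral>\<^sup>+ s. ennreal \<bar>f s\<bar> * indicator J s \<partial>lborel)"
    by (intro nn_integral_cong) (simp add: indicator_def)
  \<comment> \<open>The indicator is doubled so that Cauchy-Schwarz sees the product of |f| cut to J
    and the indicator of J.\<close>
  also have "\<dots> = (\<integral>\<^sup>+ s. (ennreal \<bar>f s\<bar> * indicator J s) * indicator J s \<partial>lborel)"
    by (intro nn_integral_cong) (simp add: indicator_def)
  finally have "ennreal \<bar>LINT s:J|lborel. f s\<bar> \<le> (\<integral>\<^sup>+ s. (ennreal \<bar>f s\<bar> * indicator J s) * indicator J s \<partial>lborel)" .
  then have "(ennreal \<bar>LINT s:J|lborel. f s\<bar>)\<^sup>2 \<le> (\<integral>\<^sup>+ s. (ennreal \<bar>f s\<bar> * indicator J s) * indicator J s \<partial>lborel)\<^sup>2"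
    by (intro power_mono) auto
  also have "\<dots> \<le> (\<integral>\<^sup>+ s. (ennreal \<bar>f s\<bar> * indicator J s)\<^sup>2 \<partial>lborel) * (\<integral>\<^sup>+ s. (indicator J s)\<^sup>2 \<partial>lborel)"
    by (rule Cauchy_Schwarz_nn_integral) auto
  also have "(\<integral>\<^sup>+ s. (ennreal \<bar>f s\<bar> * indicator J s)\<^sup>2 \<partial>lborel) = (\<integral>\<^sup>+ s\<in>J. ennreal ((f s)\<^sup>2) \<partial>lborel)"
    by (intro nn_integral_cong) (auto simp: indicator_def ennreal_power)
  also have "(\<integral>\<^sup>+ s. (indicator J s)\<^sup>2 \<partial>lborel) = (\<integral>\<^sup>+ s. indicator J s \<partial>lborel)"
    by (intro nn_integral_cong) (simp add: indicator_def)
  also have "\<dots> = emeasure lborel J"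
    by simp
  also have "(\<integral>\<^sup>+ s\<in>J. ennreal ((f s)\<^sup>2) \<partial>lborel) * emeasure lborel J
      \<le> (\<integral>\<^sup>+ s\<in>J. ennreal ((f s)\<^sup>2) \<partial>lborel) * ennreal \<delta>"
    by (rule mult_left_mono[OF mJ]) simp
  finally have le: "(ennreal \<bar>LINT s:J|lborel. f s\<bar>)\<^sup>2 \<le> (\<integral>\<^sup>+ s\<in>J. ennreal ((f s)\<^sup>2) \<partial>lborel) * ennreal \<delta>" .
  have "ennreal (\<delta> * (cell_mean T N f i)\<^sup>2) = ennreal (1 / \<delta>) * (ennreal \<bar>LINT s:J|lborel. f s\<bar>)\<^sup>2"
    using \<open>\<delta> > 0\<close> unfolding cm
    by (subst ennreal_power, simp, subst ennreal_mult[symmetric])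
       (auto simp: power2_eq_square field_simps)
  also have "\<dots> \<le> ennreal (1 / \<delta>) * ((\<integral>\<^sup>+ s\<in>J. ennreal ((f s)\<^sup>2) \<partial>lborel) * ennreal \<delta>)"
    by (intro mult_left_mono le) auto
  also have "\<dots> = (ennreal (1 / \<delta>) * ennreal \<delta>) * (\<integral>\<^sup>+ s\<in>J. ennreal ((f s)\<^sup>2) \<partial>lborel)"
    by (simp add: ac_simps)
  also have "ennreal (1 / \<delta>) * ennreal \<delta> = 1"
    using \<open>\<delta> > 0\<close> by (subst ennreal_mult[symmetric]) auto
  finally show ?thesis by (simp add: J_def \<delta>_def)
qed

text \<open>The averaging cells are disjoint and contained in [0,T], so the cellwise bounds add up
  to at most the whole integral; because of the delay the last grid cell does not take part.\<close>

lemma sum_cell_mean_square_le: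
  fixes f :: "real \<Rightarrow> real"
  assumes [measurable]: "f \<in> borel_measurable borel" and "0 < T" "0 < N"
    and fin: "sq_integral T f < \<infinity>"
  shows "ennreal (\<Sum>i<N. T / N * (cell_mean T N f i)\<^sup>2) \<le> sq_integral T f"
proof -
  define \<delta> where "\<delta> = T / N"
  define J where "J i = {(real i - 1) * \<delta><..real i * \<delta>} \<inter> {0..T}" for i :: nat
  have "\<delta> > 0" using assms by (simp add: \<delta>_def)
  have [measurable]: "J i \<in> sets borel" for i by (simp add: J_def)
  have J1: "i = j" if "s \<in> J i" "s \<in> J j" for s i j
  proof -
    have "(real i - 1) * \<delta> < real j * \<delta>" "(real j - 1) * \<delta> < real i * \<delta>"
      using that unfolding J_def by auto
    then show ?thesis using \<open>\<delta> > 0\<close> by (simp add: mult_less_cancel_right)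
  qed
  have disj: "(\<Sum>i<N. (indicator (J i) s :: ennreal)) \<le> indicator {0..T} s" for s
  proof (cases "\<exists>i<N. s \<in> J i")
    case True
    then obtain i where i: "i < N" "s \<in> J i" by blast
    have "(\<Sum>k<N. (indicator (J k) s :: ennreal)) = (\<Sum>k<N. if k = i then 1 else 0)"
      using i by (intro sum.cong refl) (auto simp: indicator_def dest: J1)
    then show ?thesis using i by (auto simp: J_def indicator_def)
  next
    case False
    then have "(\<Sum>i<N. (indicator (J i) s :: ennreal)) = 0" by (auto simp: indicator_def)
    then show ?thesis by simp
  qed
  have "ennreal (\<Sum>i<N. T / N * (cell_mean T N f i)\<^sup>2) = (\<Sum>i<N. ennreal (T / N * (cell_mean T N f i)\<^sup>2))"
    using assms by (intro sum_ennreal[symmetric]) auto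
  also have "\<dots> \<le> (\<Sum>i<N. \<integral>\<^sup>+ s\<in>J i. ennreal ((f s)\<^sup>2) \<partial>lborel)"
    unfolding J_def \<delta>_def by (intro sum_mono cell_mean_square_le assms)
  also have "\<dots> = (\<integral>\<^sup>+ s. (\<Sum>i<N. ennreal ((f s)\<^sup>2) * indicator (J i) s) \<partial>lborel)"
    by (rule nn_integral_sum[symmetric]) auto
  also have "\<dots> \<le> sq_integral T f"
    unfolding sum_distrib_left[symmetric] by (intro nn_integral_mono mult_left_mono disj) auto
  finally show ?thesis .
qed

lemma nn_integral_grid_square:
  fixes v :: "nat \<Rightarrow> real" and \<delta> :: real
  assumes "0 < \<delta>"
  shows "(\<integral>\<^sup>+ s\<in>{0..real N * \<delta>}. ennreal ((\<Sum>i<N. v i * indicator {real i * \<delta><..real (Suc i) * \<delta>} s)\<^sup>2) \<partial>lborel)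
    = ennreal (\<Sum>i<N. \<delta> * (v i)\<^sup>2)"
proof -
  have "ennreal ((\<Sum>i<N. v i * indicator {real i * \<delta><..real (Suc i) * \<delta>} s)\<^sup>2) * indicator {0..real N * \<delta>} s
      = (\<Sum>i<N. ennreal ((v i)\<^sup>2) * indicator {real i * \<delta><..real (Suc i) * \<delta>} s)" for s
  proof (cases "0 < s \<and> s \<le> real N * \<delta>")
    case True
    then obtain i where i: "i < N" "s \<in> {real i * \<delta><..real (Suc i) * \<delta>}"
      using grid_cell_exists[OF assms] by blast
    show ?thesis
      unfolding grid_sum_eq[OF assms i] using True by simp
  next
    \<comment> \<open>Besides points outside the range this covers s = 0, which lies in the range of
      integration but in no cell.\<close>
    case False
    have "s \<notin> {real i * \<delta><..real (Suc i) * \<delta>}" if "i < N" for i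
    proof
      assume s: "s \<in> {real i * \<delta><..real (Suc i) * \<delta>}"
      have "real (Suc i) * \<delta> \<le> real N * \<delta>" "0 \<le> real i * \<delta>"
        using assms that by (auto intro!: mult_right_mono simp del: of_nat_Suc)
      then show False using s False by (auto simp del: of_nat_Suc)
    qed
    then have "indicator {real i * \<delta><..real (Suc i) * \<delta>} s = (0::real)"
        "indicator {real i * \<delta><..real (Suc i) * \<delta>} s = (0::ennreal)" if "i < N" for i
      using that by (simp_all add: indicator_def)
    then show ?thesis by simp
  qed
  then have "(\<integral>\<^sup>+ s\<in>{0..real N * \<delta>}. ennreal ((\<Sum>i<N. v i * indicator {real i * \<delta><..real (Suc i) * \<delta>} s)\<^sup>2) \<partial>lborel)
      = (\<integral>\<^sup>+ s. (\<Sum>i<N. ennreal ((v i)\<^sup>2) * indicator {real i * \<delta><..real (Suc i) * \<delta>} s) \<partial>lborel)"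
    by (intro nn_integral_cong)
  also have "\<dots> = (\<Sum>i<N. \<integral>\<^sup>+ s. ennreal ((v i)\<^sup>2) * indicator {real i * \<delta><..real (Suc i) * \<delta>} s \<partial>lborel)"
    by (rule nn_integral_sum) auto
  also have "\<dots> = (\<Sum>i<N. ennreal (\<delta> * (v i)\<^sup>2))"
  proof (intro sum.cong refl)
    fix i
    have "real (Suc i) * \<delta> - real i * \<delta> = \<delta>" "real i * \<delta> \<le> real (Suc i) * \<delta>"
      using assms by (simp_all add: algebra_simps)
    then show "(\<integral>\<^sup>+ s. ennreal ((v i)\<^sup>2) * indicator {real i * \<delta><..real (Suc i) * \<delta>} s \<partial>lborel) = ennreal (\<delta> * (v i)\<^sup>2)"
      using assms by (simp add: nn_integral_cmult_indicator ennreal_mult mult.commute del: of_nat_Suc)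
  qed
  also have "\<dots> = ennreal (\<Sum>i<N. \<delta> * (v i)\<^sup>2)"
    using assms by (intro sum_ennreal) auto
  finally show ?thesis .
qed

text \<open>The constant is 1 for every N; this uniformity is what allows convergence to be checked
  on a dense class only.\<close>

lemma delayed_mean_contraction:
  fixes f :: "real \<Rightarrow> real"
  assumes [measurable]: "f \<in> borel_measurable borel" and "0 < T" "0 < N"
    and fin: "sq_integral T f < \<infinity>"
  shows "sq_integral T (delayed_mean T N f) \<le> sq_integral T f"
  using nn_integral_grid_square[where \<delta> = "T / N" and N = N and v = "cell_mean T N f"] sum_cell_mean_square_le[OF assms] assms(2,3)
  by (simp add: delayed_mean_def del: of_nat_Suc)

section \<open>Convergence of delayed means\<close>

lemma delayed_mean_diff:
  fixes f g :: "real \<Rightarrow> real"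
  assumes "f \<in> borel_measurable borel" "g \<in> borel_measurable borel"
    and "sq_integral T f < \<infinity>" "sq_integral T g < \<infinity>"
  shows "delayed_mean T N (\<lambda>s. f s - g s) s = delayed_mean T N f s - delayed_mean T N g s"
proof -
  have "cell_mean T N (\<lambda>s. f s - g s) i = cell_mean T N f i - cell_mean T N g i" for i
    unfolding cell_mean_def using assms
    by (subst set_integral_diff(2)) (auto intro!: set_integrable_of_square simp: right_diff_distrib)
  then show ?thesis
    by (simp add: delayed_mean_def sum_subtractf left_diff_distrib)
qed

text \<open>The averaging cell lies within two meshes to the left of s, so continuity at s controls
  the mean.\<close>

lemma delayed_mean_continuous_tendsto:
  fixes g :: "real \<Rightarrow> real"
  assumes g: "continuous_on UNIV g" and "0 < T" "0 < s" "s \<le> T"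
  shows "(\<lambda>m. delayed_mean T (Suc m) g s) \<longlonglongrightarrow> g s"
proof (rule LIMSEQ_I)
  fix e :: real assume "0 < e"
  have "isCont g s" using g by (simp add: continuous_on_eq_continuous_at)
  have "0 < e / 2" using \<open>0 < e\<close> by simp
  from \<open>isCont g s\<close>[unfolded continuous_at_real_range, rule_format, OF this]
  obtain d where "0 < d" and d: "\<And>u. \<bar>u - s\<bar> < d \<Longrightarrow> \<bar>g u - g s\<bar> < e / 2"
    unfolding real_norm_def by metis
  \<comment> \<open>Keeping two meshes below s as well forces the averaging cell to lie inside
    [0,T]; closer to 0 it would be cut off while its integral is still divided by the full
    mesh.\<close>
  define d' where "d' = min d s"
  have "0 < d'" using \<open>0 < d\<close> \<open>0 < s\<close> by (simp add: d'_def)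
  obtain m0 :: nat where m0: "2 * T / d' < real m0" using reals_Archimedean2 by blast
  show "\<exists>no. \<forall>m\<ge>no. norm (delayed_mean T (Suc m) g s - g s) < e"
  proof (intro exI[of _ m0] allI impI)
    fix m assume "m \<ge> m0"
    define \<delta> where "\<delta> = T / Suc m"
    have "\<delta> > 0" using \<open>0 < T\<close> by (simp add: \<delta>_def)
    have "2 * T < real m0 * d'"
      using m0 \<open>0 < d'\<close> by (simp add: field_simps)
    also have "\<dots> \<le> real (Suc m) * d'"
      using \<open>m \<ge> m0\<close> \<open>0 < d'\<close> by (intro mult_right_mono) auto
    finally have "2 * \<delta> < d'" by (simp add: \<delta>_def field_simps)
    have "s \<le> real (Suc m) * \<delta>" using assms by (simp add: \<delta>_def)
    then obtain i where i: "i < Suc m" "s \<in> {real i * \<delta><..real (Suc i) * \<delta>}"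
      using grid_cell_exists[OF \<open>\<delta> > 0\<close> \<open>0 < s\<close>] by blast
    have "2 * \<delta> < s" using \<open>2 * \<delta> < d'\<close> by (simp add: d'_def)
    then have "2 * \<delta> < real (Suc i) * \<delta>" using i by auto
    then have i1: "1 < real i"
      using \<open>\<delta> > 0\<close> by (simp add: mult_less_cancel_right)
    define J where "J = {(real i - 1) * \<delta><..real i * \<delta>}"
    have "real i * \<delta> \<le> T"
      using i \<open>s \<le> T\<close> by auto
    moreover have "0 \<le> (real i - 1) * \<delta>"
      using i1 \<open>\<delta> > 0\<close> by simp
    ultimately have J: "J \<inter> {0..T} = J"
      by (auto simp: J_def)
    have lenJ: "measure lborel J = \<delta>"
      using \<open>\<delta> > 0\<close> by (simp add: J_def left_diff_distrib)
    have near: "\<bar>g u - g s\<bar> < e / 2" if "u \<in> J" for u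
    proof (rule d)
      have "real i * \<delta> - \<delta> < u" "u \<le> real i * \<delta>" "real i * \<delta> < s" "s \<le> real i * \<delta> + \<delta>" "2 * \<delta> < d"
        using that i \<open>2 * \<delta> < d'\<close> by (auto simp: J_def d'_def algebra_simps)
      then show "\<bar>u - s\<bar> < d" by linarith
    qed
    have "continuous_on {(real i - 1) * \<delta>..real i * \<delta>} g"
      using g by (rule continuous_on_subset) simp
    then have intg: "set_integrable lborel J g"
      unfolding J_def
      by (intro set_integrable_subset[OF borel_integrable_atLeastAtMost'[unfolded set_integrable_def[symmetric]]]) auto
    have iJ: "integrable lborel (indicator J :: real \<Rightarrow> real)"
      using \<open>\<delta> > 0\<close> by (simp add: integrable_indicator_iff J_def)
    then have intc: "set_integrable lborel J (\<lambda>_. c)" for c :: real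
      by (simp add: set_integrable_def)
    have constJ: "(LINT u:J|lborel. c) = \<delta> * c" for c :: real
      using lenJ iJ by (simp add: set_lebesgue_integral_def)
    have "delayed_mean T (Suc m) g s = cell_mean T (Suc m) g i"
      unfolding delayed_mean_def using grid_sum_eq[OF \<open>\<delta> > 0\<close> i] by (simp add: \<delta>_def)
    also have "\<dots> = (1 / \<delta>) * (LINT u:J|lborel. g u)"
      using J by (simp add: cell_mean_def \<delta>_def J_def)
    finally have eq1: "delayed_mean T (Suc m) g s = (1 / \<delta>) * (LINT u:J|lborel. g u)" .
    have "delayed_mean T (Suc m) g s - g s = (1 / \<delta>) * ((LINT u:J|lborel. g u) - (LINT u:J|lborel. g s))"
      unfolding eq1 constJ using \<open>\<delta> > 0\<close> by (simp add: field_simps)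
    also have "\<dots> = (1 / \<delta>) * (LINT u:J|lborel. g u - g s)"
      using set_integral_diff(2)[OF intg intc] by simp
    finally have "\<bar>delayed_mean T (Suc m) g s - g s\<bar> = (1 / \<delta>) * \<bar>LINT u:J|lborel. g u - g s\<bar>"
      using \<open>\<delta> > 0\<close> by (simp add: abs_mult)
    also have "\<dots> \<le> (1 / \<delta>) * (LINT u:J|lborel. e / 2)"
    proof (rule mult_left_mono)
      have "\<bar>LINT u:J|lborel. g u - g s\<bar> \<le> (LINT u:J|lborel. \<bar>g u - g s\<bar>)"
        using set_integral_norm_bound[OF set_integral_diff(1)[OF intg intc]] by simp
      also have "\<dots> \<le> (LINT u:J|lborel. e / 2)"
        using set_integrable_abs[OF set_integral_diff(1)[OF intg intc]] intc near
        by (intro set_integral_mono) (auto intro: less_imp_le)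
      finally show "\<bar>LINT u:J|lborel. g u - g s\<bar> \<le> (LINT u:J|lborel. e / 2)" .
    qed (use \<open>\<delta> > 0\<close> in auto)
    also have "\<dots> = e / 2"
      unfolding constJ using \<open>\<delta> > 0\<close> by simp
    finally show "norm (delayed_mean T (Suc m) g s - g s) < e" using \<open>0 < e\<close> by simp
  qed
qed

text \<open>With D the delayed mean and g continuous and close to f, f - D f = (f - g) + (g - D g) -
  D (f - g). The outer terms are small by density and contraction, the middle one by pointwise
  convergence under a uniform bound.\<close>

lemma delayed_mean_tendsto_L2:
  fixes f :: "real \<Rightarrow> real"
  assumes [measurable]: "f \<in> borel_measurable borel" and "0 < T"
    and fin: "sq_integral T f < \<infinity>"
  shows "(\<lambda>m. sq_integral T (\<lambda>s. f s - delayed_mean T (Suc m) f s)) \<longlonglongrightarrow> 0"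
proof (rule order_tendstoI)
  fix a :: ennreal assume "0 < a"
  \<comment> \<open>Squaring a sum of three terms costs a factor 3, and 3 (a / 9 + a / 9 + a / 9) =
    a.\<close>
  then have "0 < a / 9" by (simp add: ennreal_zero_less_divide)
  from continuous_dense_L2[OF assms(1) fin this] obtain g where g: "continuous_on UNIV g"
    and fg: "sq_integral T (\<lambda>s. f s - g s) < a / 9" by blast
  have [measurable]: "g \<in> borel_measurable borel"
    using g by (rule borel_measurable_continuous_onI)
  have "compact (g ` {0..T})"
    using g by (intro compact_continuous_image continuous_on_subset[OF g]) auto
  from compact_imp_bounded[OF this] obtain C0 where "\<forall>x\<in>g ` {0..T}. norm x \<le> C0"
    unfolding bounded_iff by blast
  then have C0: "\<bar>g s\<bar> \<le> C0" if "s \<in> {0..T}" for s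
    using that by auto
  define C where "C = max C0 0"
  have C: "\<bar>g s\<bar> \<le> C" "0 \<le> C" if "s \<in> {0..T}" for s
    using C0[OF that] by (auto simp: C_def)
  have "0 \<le> C" by (simp add: C_def)
  have gsq: "(g s)\<^sup>2 \<le> C\<^sup>2" if "s \<in> {0..T}" for s
    using C[OF that] by (simp add: abs_le_square_iff[symmetric])
  have gfin: "sq_integral T g < \<infinity>"
  proof -
    have "sq_integral T g \<le> (\<integral>\<^sup>+ s. ennreal (C\<^sup>2) * indicator {0..T} s \<partial>lborel)"
      using gsq by (intro nn_integral_mono) (auto simp: indicator_def intro: ennreal_leI)
    also have "\<dots> < \<infinity>"
      by (simp add: nn_integral_cmult_indicator ennreal_mult_less_top emeasure_lborel_Icc_eq)
    finally show ?thesis .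
  qed
  \<comment> \<open>The mean inherits the bound C through its square: \<delta> times the squared
    mean is at most the integral of g^2 over the cell, hence at most C^2 \<delta>.\<close>
  have cm: "\<bar>cell_mean T (Suc m) g i\<bar> \<le> C" for m i
  proof -
    define \<delta> where "\<delta> = T / Suc m"
    define J where "J = {(real i - 1) * \<delta><..real i * \<delta>} \<inter> {0..T}"
    have "\<delta> > 0" using \<open>0 < T\<close> by (simp add: \<delta>_def)
    have "ennreal (\<delta> * (cell_mean T (Suc m) g i)\<^sup>2) \<le> (\<integral>\<^sup>+ s\<in>J. ennreal ((g s)\<^sup>2) \<partial>lborel)"
      unfolding \<delta>_def J_def using \<open>0 < T\<close> gfin by (intro cell_mean_square_le) auto
    also have "\<dots> \<le> (\<integral>\<^sup>+ s. ennreal (C\<^sup>2) * indicator J s \<partial>lborel)"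
      using gsq by (intro nn_integral_mono) (auto simp: indicator_def J_def intro: ennreal_leI)
    also have "\<dots> = ennreal (C\<^sup>2) * emeasure lborel J"
      by (simp add: nn_integral_cmult_indicator J_def)
    also have "\<dots> \<le> ennreal (C\<^sup>2) * ennreal \<delta>"
      unfolding J_def by (intro mult_left_mono emeasure_cell_le \<open>\<delta> > 0\<close>) simp
    also have "\<dots> = ennreal (\<delta> * C\<^sup>2)"
      using \<open>\<delta> > 0\<close> by (simp add: ennreal_mult mult.commute)
    finally have "(cell_mean T (Suc m) g i)\<^sup>2 \<le> C\<^sup>2"
      using \<open>\<delta> > 0\<close> by (simp add: ennreal_le_iff)
    then show ?thesis
      using \<open>0 \<le> C\<close> abs_le_square_iff[of "cell_mean T (Suc m) g i" C] by simp
  qed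
  have dm: "\<bar>delayed_mean T (Suc m) g s\<bar> \<le> C" if "s \<in> {0<..T}" for m s
  proof -
    have \<delta>: "T / real (Suc m) > 0" and s: "0 < s" "s \<le> real (Suc m) * (T / real (Suc m))"
      using \<open>0 < T\<close> that by auto
    obtain i where "i < Suc m" "s \<in> {real i * (T / real (Suc m))<..real (Suc i) * (T / real (Suc m))}"
      by (rule grid_cell_exists[OF \<delta> s])
    then have "delayed_mean T (Suc m) g s = cell_mean T (Suc m) g i"
      unfolding delayed_mean_def by (rule grid_sum_eq[OF \<delta>])
    then show ?thesis using cm by simp
  qed
  \<comment> \<open>At s = 0 the delayed mean is 0 whatever g(0) is, so pointwise convergence is
    available only off this null set.\<close>
  have AE0: "AE s in lborel. s \<noteq> (0::real)"
    by (rule AE_lborel_singleton)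
  have "(\<lambda>m. sq_integral T (\<lambda>s. g s - delayed_mean T (Suc m) g s))
      \<longlonglongrightarrow> (\<integral>\<^sup>+ s\<in>{0..T}. ennreal (0\<^sup>2) \<partial>lborel)"
  proof (rule nn_integral_dominated_convergence[where w = "\<lambda>s. ennreal ((2 * C)\<^sup>2) * indicator {0..T} s"])
    fix m
    show "AE s in lborel. ennreal ((g s - delayed_mean T (Suc m) g s)\<^sup>2) * indicator {0..T} s
        \<le> ennreal ((2 * C)\<^sup>2) * indicator {0..T} s"
      using AE0
    proof eventually_elim
      fix s :: real assume "s \<noteq> 0"
      show "ennreal ((g s - delayed_mean T (Suc m) g s)\<^sup>2) * indicator {0..T} s \<le> ennreal ((2 * C)\<^sup>2) * indicator {0..T} s"
      proof (cases "s \<in> {0..T}")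
        case True
        with \<open>s \<noteq> 0\<close> have "\<bar>g s\<bar> \<le> C" "\<bar>delayed_mean T (Suc m) g s\<bar> \<le> C"
          by (auto intro!: C(1) dm)
        then have "\<bar>g s - delayed_mean T (Suc m) g s\<bar> \<le> \<bar>2 * C\<bar>"
          by linarith
        from abs_le_square_iff[THEN iffD1, OF this] show ?thesis
          by (intro mult_right_mono ennreal_leI) auto
      qed simp
    qed
  next
    show "AE s in lborel. (\<lambda>m. ennreal ((g s - delayed_mean T (Suc m) g s)\<^sup>2) * indicator {0..T} s)
        \<longlonglongrightarrow> ennreal (0\<^sup>2) * indicator {0..T} s"
      using AE0
    proof eventually_elim
      fix s :: real assume "s \<noteq> 0"
      show "(\<lambda>m. ennreal ((g s - delayed_mean T (Suc m) g s)\<^sup>2) * indicator {0..T} s)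
        \<longlonglongrightarrow> ennreal (0\<^sup>2) * indicator {0..T} s"
      proof (cases "s \<in> {0..T}")
        case True
        then have "(\<lambda>m. (g s - delayed_mean T (Suc m) g s)\<^sup>2) \<longlonglongrightarrow> (g s - g s)\<^sup>2"
          using \<open>s \<noteq> 0\<close> \<open>0 < T\<close> by (intro tendsto_intros delayed_mean_continuous_tendsto[OF g]) auto
        then have "(\<lambda>m. ennreal ((g s - delayed_mean T (Suc m) g s)\<^sup>2)) \<longlonglongrightarrow> ennreal (0\<^sup>2)"
          by (intro tendsto_ennrealI) simp
        with True show ?thesis by simp
      qed simp
    qed
  next
    show "(\<integral>\<^sup>+ s. ennreal ((2 * C)\<^sup>2) * indicator {0..T} s \<partial>lborel) < \<infinity>"
      by (simp add: nn_integral_cmult_indicator ennreal_mult_less_top emeasure_lborel_Icc_eq)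
  qed auto
  then have "(\<lambda>m. sq_integral T (\<lambda>s. g s - delayed_mean T (Suc m) g s)) \<longlonglongrightarrow> 0"
    by simp
  from order_tendstoD(2)[OF this \<open>0 < a / 9\<close>]
  show "\<forall>\<^sub>F m in sequentially. sq_integral T (\<lambda>s. f s - delayed_mean T (Suc m) f s) < a"
  proof eventually_elim
    fix m
    assume gm: "sq_integral T (\<lambda>s. g s - delayed_mean T (Suc m) g s) < a / 9"
    let ?u = "\<lambda>s. f s - g s" and ?v = "\<lambda>s. g s - delayed_mean T (Suc m) g s"
      and ?w = "\<lambda>s. - delayed_mean T (Suc m) (\<lambda>s. f s - g s) s"
    have ufin: "sq_integral T ?u < \<infinity>"
      using fg by (rule less_le_trans) simp
    have eq: "f s - delayed_mean T (Suc m) f s = ?u s + ?v s + ?w s" for s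
      using delayed_mean_diff[OF _ _ fin gfin] by simp
    have wle: "sq_integral T ?w \<le> sq_integral T ?u"
      unfolding power2_minus using \<open>0 < T\<close> ufin by (intro delayed_mean_contraction) auto
    have "sq_integral T (\<lambda>s. f s - delayed_mean T (Suc m) f s)
      \<le> (\<integral>\<^sup>+ s. 3 * (ennreal ((?u s)\<^sup>2) * indicator {0..T} s + ennreal ((?v s)\<^sup>2) * indicator {0..T} s
           + ennreal ((?w s)\<^sup>2) * indicator {0..T} s) \<partial>lborel)"
      unfolding eq using ennreal_square_add3_le[of "?u s" "?v s" "?w s" for s]
      by (intro nn_integral_mono) (simp add: indicator_def del: power2_minus)
    also have "\<dots> = 3 * (sq_integral T ?u + sq_integral T ?v
        + sq_integral T ?w)"
      by (simp add: nn_integral_cmult nn_integral_add del: power2_minus)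
    also have "\<dots> < 3 * (a / 9 + a / 9 + a / 9)"
      using fg gm le_less_trans[OF wle fg] by (intro ennreal_mult_strict_left_mono add_strict_mono) auto
    also have "\<dots> \<le> a"
    proof (cases a)
      case (real r)
      have "3 * (ennreal r / 9 + ennreal r / 9 + ennreal r / 9)
          = ennreal 3 * (ennreal (r / 9) + ennreal (r / 9) + ennreal (r / 9))"
        using real by (simp add: divide_ennreal flip: ennreal_numeral)
      also have "\<dots> = ennreal r"
        using real ennreal_plus[of "r / 9" "r / 9"] ennreal_plus[of "r / 9 + r / 9" "r / 9"] ennreal_mult[of 3 "r / 3"]
        by simp
      finally have "3 * (ennreal r / 9 + ennreal r / 9 + ennreal r / 9) = ennreal r" .
      then show ?thesis using real by simp
    qed simp
    finally show "sq_integral T (\<lambda>s. f s - delayed_mean T (Suc m) f s) < a" .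
  qed
qed simp

text \<open>Mean-square convergence carries over to the norms: f^2 - d^2 = (f - d) (f + d), and in
  the Cauchy-Schwarz bound the first factor tends to 0 while contraction bounds the second. This
  gives the limit of the quadratic term in the discrete stochastic exponentials.\<close>

lemma sum_cell_mean_square_tendsto:
  fixes f :: "real \<Rightarrow> real"
  assumes [measurable]: "f \<in> borel_measurable borel" and "0 < T"
    and fin: "sq_integral T f < \<infinity>"
  shows "(\<lambda>m. \<Sum>i<Suc m. T / Suc m * (cell_mean T (Suc m) f i)\<^sup>2) \<longlonglongrightarrow> (LINT s:{0..T}|lborel. (f s)\<^sup>2)"
proof -
  define d where "d m = delayed_mean T (Suc m) f" for m
  define Q where "Q m = (\<Sum>i<Suc m. T / Suc m * (cell_mean T (Suc m) f i)\<^sup>2)" for m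
  let ?q = "LINT s:{0..T}|lborel. (f s)\<^sup>2"
  have [measurable]: "d m \<in> borel_measurable borel" for m
    by (simp add: d_def)
  have SdQ: "sq_integral T (d m) = ennreal (Q m)" for m
    using nn_integral_grid_square[where \<delta> = "T / Suc m" and N = "Suc m" and v = "cell_mean T (Suc m) f"] \<open>0 < T\<close>
    unfolding d_def Q_def delayed_mean_def by simp
  have Sd: "sq_integral T (d m) \<le> sq_integral T f" for m
    unfolding d_def using \<open>0 < T\<close> fin by (intro delayed_mean_contraction) auto
  then have dfin: "sq_integral T (d m) < \<infinity>" for m
    using fin by (rule le_less_trans)
  have fint: "set_integrable lborel {0..T} (\<lambda>s. (f s)\<^sup>2)"
    using set_integrable_of_square(2)[of f UNIV T] fin by simp
  have dint: "set_integrable lborel {0..T} (\<lambda>s. (d m s)\<^sup>2)" for m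
    using set_integrable_of_square(2)[of "d m" UNIV T] dfin by simp
  have Q0: "0 \<le> Q m" for m using \<open>0 < T\<close> by (simp add: Q_def sum_nonneg)
  have Qd: "Q m = (LINT s:{0..T}|lborel. (d m s)\<^sup>2)" for m
  proof -
    have "ennreal (Q m) = ennreal (LINT s:{0..T}|lborel. (d m s)\<^sup>2)"
      unfolding SdQ[symmetric] using dfin[of m] by (intro nn_integral_square_eq) auto
    moreover have "0 \<le> (LINT s:{0..T}|lborel. (d m s)\<^sup>2)"
      unfolding set_lebesgue_integral_def by (intro Bochner_Integration.integral_nonneg) simp
    ultimately show ?thesis using Q0 by simp
  qed
  have bound: "ennreal ((?q - Q m)\<^sup>2) \<le> sq_integral T (\<lambda>s. f s - d m s) * (4 * sq_integral T f)" for m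
  proof -
    have "?q - Q m = (LINT s:{0..T}|lborel. (f s)\<^sup>2 - (d m s)\<^sup>2)"
      unfolding Qd using set_integral_diff(2)[OF fint dint] by simp
    then have "ennreal \<bar>?q - Q m\<bar> \<le> (\<integral>\<^sup>+ s. ennreal (norm (indicator {0..T} s *\<^sub>R ((f s)\<^sup>2 - (d m s)\<^sup>2))) \<partial>lborel)"
      using integral_norm_bound_ennreal[OF set_integral_diff(1)[OF fint dint[of m], unfolded set_integrable_def]]
      by (simp add: set_lebesgue_integral_def)
    also have "\<dots> = (\<integral>\<^sup>+ s. (ennreal \<bar>f s - d m s\<bar> * indicator {0..T} s) * (ennreal \<bar>f s + d m s\<bar> * indicator {0..T} s) \<partial>lborel)"
    proof (intro nn_integral_cong)
      fix s
      have "(f s)\<^sup>2 - (d m s)\<^sup>2 = (f s - d m s) * (f s + d m s)"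
        by (simp add: power2_eq_square algebra_simps)
      then show "ennreal (norm (indicator {0..T} s *\<^sub>R ((f s)\<^sup>2 - (d m s)\<^sup>2)))
          = (ennreal \<bar>f s - d m s\<bar> * indicator {0..T} s) * (ennreal \<bar>f s + d m s\<bar> * indicator {0..T} s)"
        by (simp add: indicator_def abs_mult ennreal_mult)
    qed
    finally have "(ennreal \<bar>?q - Q m\<bar>)\<^sup>2
        \<le> (\<integral>\<^sup>+ s. (ennreal \<bar>f s - d m s\<bar> * indicator {0..T} s) * (ennreal \<bar>f s + d m s\<bar> * indicator {0..T} s) \<partial>lborel)\<^sup>2"
      by (rule power_mono) simp
    also have "\<dots> \<le> (\<integral>\<^sup>+ s. (ennreal \<bar>f s - d m s\<bar> * indicator {0..T} s)\<^sup>2 \<partial>lborel)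
        * (\<integral>\<^sup>+ s. (ennreal \<bar>f s + d m s\<bar> * indicator {0..T} s)\<^sup>2 \<partial>lborel)"
      by (rule Cauchy_Schwarz_nn_integral) auto
    also have "(\<integral>\<^sup>+ s. (ennreal \<bar>f s - d m s\<bar> * indicator {0..T} s)\<^sup>2 \<partial>lborel) = sq_integral T (\<lambda>s. f s - d m s)"
      by (intro nn_integral_cong) (simp add: indicator_def ennreal_power)
    also have "(\<integral>\<^sup>+ s. (ennreal \<bar>f s + d m s\<bar> * indicator {0..T} s)\<^sup>2 \<partial>lborel) = sq_integral T (\<lambda>s. f s + d m s)"
      by (intro nn_integral_cong) (simp add: indicator_def ennreal_power)
    also have "sq_integral T (\<lambda>s. f s + d m s) \<le> (\<integral>\<^sup>+ s. 2 * (ennreal ((f s)\<^sup>2) * indicator {0..T} s + ennreal ((d m s)\<^sup>2) * indicator {0..T} s) \<partial>lborel)"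
      using ennreal_square_add_le[of "f s" "d m s" for s] by (intro nn_integral_mono) (simp add: indicator_def)
    also have "\<dots> = 2 * (sq_integral T f + sq_integral T (d m))"
      by (simp add: nn_integral_cmult nn_integral_add)
    also have "\<dots> \<le> 2 * (sq_integral T f + sq_integral T f)"
      by (intro mult_left_mono add_mono Sd) auto
    also have "\<dots> = 4 * sq_integral T f"
      by (subst mult_2[symmetric], subst mult.assoc[symmetric]) simp
    finally show ?thesis
      by (simp add: ennreal_power mult_left_mono)
  qed
  have "(\<lambda>m. sq_integral T (\<lambda>s. f s - d m s) * (4 * sq_integral T f)) \<longlonglongrightarrow> 0 * (4 * sq_integral T f)"
    using fin delayed_mean_tendsto_L2[OF assms(1) \<open>0 < T\<close> fin] unfolding d_def
    by (intro tendsto_mult_ennreal) (auto simp: ennreal_mult_eq_top_iff)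
  from tendsto_ennreal_zero_squeeze[OF this[unfolded mult_zero_left] bound]
  have "(\<lambda>m. ennreal ((?q - Q m)\<^sup>2)) \<longlonglongrightarrow> 0" .
  then have "(\<lambda>m. (?q - Q m)\<^sup>2) \<longlonglongrightarrow> 0"
    by (subst (asm) ennreal_tendsto_0_iff) auto
  then have "(\<lambda>m. sqrt ((?q - Q m)\<^sup>2)) \<longlonglongrightarrow> sqrt 0"
    by (rule tendsto_real_sqrt)
  then have "(\<lambda>m. ?q - Q m) \<longlonglongrightarrow> 0"
    by (simp add: tendsto_rabs_zero_iff)
  from tendsto_diff[OF tendsto_const[of ?q] this] show ?thesis
    by (simp add: Q_def)
qed

section \<open>The Ito isometry\<close>

locale brownian_space =
  fixes M :: "'a measure" and F :: "real \<Rightarrow> 'a measure" and T :: real and B :: "real \<Rightarrow> 'a \<Rightarrow> real"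
  assumes T_pos: "0 < T" and filtered: "filtered_prob_space M F T" and brownian: "brownian_motion M F T B"
begin

sublocale prob_space M
  using filtered by (simp add: filtered_prob_space_def)

lemma measurable_F_mono:
  assumes "0 \<le> s" "s \<le> t" "t \<le> T" "f \<in> measurable (F s) N"
  shows "f \<in> measurable (F t) N"
  using filtered assms by (auto simp: filtered_prob_space_def intro: measurable_from_subalg)

lemma measurable_F_M:
  assumes "0 \<le> t" "t \<le> T" "f \<in> measurable (F t) N"
  shows "f \<in> measurable M N"
  using filtered assms by (auto simp: filtered_prob_space_def intro: measurable_from_subalg)

lemma B_measurable_F: "0 \<le> t \<Longrightarrow> t \<le> T \<Longrightarrow> B t \<in> borel_measurable (F t)"
  using brownian by (simp add: brownian_motion_def)

lemma B_measurable: "0 \<le> t \<Longrightarrow> t \<le> T \<Longrightarrow> B t \<in> borel_measurable M"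
  using B_measurable_F measurable_F_M by blast

lemma increment_distributed:
  assumes "0 \<le> s" "s < t" "t \<le> T"
  shows "distributed M lborel (\<lambda>w. B t w - B s w) (normal_density 0 (sqrt (t - s)))"
  using brownian assms by (simp add: brownian_motion_def)

text \<open>
  Independence of random variables is stated in the library for a common value type; the map \<open>g\<close>
  embeds the increment into the type of \<open>U\<close>.
\<close>

lemma increment_indep:
  assumes "0 \<le> s" "s < t" "t \<le> T" and U: "U \<in> measurable (F s) N" and g: "g \<in> measurable borel N'"
  shows "indep_var N U N' (\<lambda>w. g (B t w - B s w))"
proof -
  let ?D = "\<lambda>w. B t w - B s w"
  let ?V = "vimage_algebra (space M) ?D borel"
  have ind: "indep_set (sets (F s)) (sets ?V)"
    using brownian assms by (simp add: brownian_motion_def)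
  have [measurable]: "U \<in> measurable M N"
    using U assms by (intro measurable_F_M[of s]) auto
  have [measurable]: "B s \<in> borel_measurable M" "B t \<in> borel_measurable M"
    using assms by (auto intro: B_measurable)
  have sp: "space (F s) = space M"
    using filtered assms by (auto simp: filtered_prob_space_def subalgebra_def)
  have "sigma_sets (space M) {U -` A \<inter> space M |A. A \<in> sets N} \<subseteq> sets (F s)"
    using U unfolding sp[symmetric] by (intro sets.sigma_sets_subset) auto
  moreover have "sigma_sets (space M) {(\<lambda>w. g (?D w)) -` A \<inter> space M |A. A \<in> sets N'} \<subseteq> sets ?V"
  proof -
    have "?D \<in> measurable ?V borel"
      by (rule measurable_vimage_algebra1) simp
    then have "(\<lambda>w. g (?D w)) \<in> measurable ?V N'"
      by (rule measurable_compose[OF _ g])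
    from measurable_sets[OF this]
    have "{(\<lambda>w. g (?D w)) -` A \<inter> space M |A. A \<in> sets N'} \<subseteq> sets ?V"
      by auto
    from sets.sigma_sets_subset[OF this] show ?thesis
      by simp
  qed
  ultimately have "indep_set (sigma_sets (space M) {U -` A \<inter> space M |A. A \<in> sets N})
      (sigma_sets (space M) {(\<lambda>w. g (?D w)) -` A \<inter> space M |A. A \<in> sets N'})"
    unfolding indep_set_def
    by (intro indep_sets_mono_sets[OF ind[unfolded indep_set_def]]) (auto split: bool.split)
  then show ?thesis
    unfolding indep_var_eq using g by simp
qed

section \<open>Gaussian moments of the increments\<close>

lemma increment_moments:
  assumes "0 \<le> s" "s \<le> t" "t \<le> T"
  shows "integrable M (\<lambda>w. B t w - B s w)" "(\<integral>w. B t w - B s w \<partial>M) = 0"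
    and "integrable M (\<lambda>w. (B t w - B s w)\<^sup>2)" "(\<integral>w. (B t w - B s w)\<^sup>2 \<partial>M) = t - s"
proof -
  have "integrable M (\<lambda>w. B t w - B s w) \<and> (\<integral>w. B t w - B s w \<partial>M) = 0 \<and>
      integrable M (\<lambda>w. (B t w - B s w)\<^sup>2) \<and> (\<integral>w. (B t w - B s w)\<^sup>2 \<partial>M) = t - s"
  \<comment> \<open>At s = t the normal law degenerates and the hypothesis on increments is silent;
    the increment is then 0 and all four claims are trivial.\<close>
  proof (cases "s = t")
    case False
    then have "s < t" using assms by simp
    define \<sigma> where "\<sigma> = sqrt (t - s)"
    have "\<sigma> > 0" using \<open>s < t\<close> by (simp add: \<sigma>_def)
    have d: "distributed M lborel (\<lambda>w. B t w - B s w) (normal_density 0 \<sigma>)"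
      using increment_distributed assms \<open>s < t\<close> by (simp add: \<sigma>_def)
    have m1: "has_bochner_integral lborel (\<lambda>x. normal_density 0 \<sigma> x * x) 0"
      using normal_moment_odd[OF \<open>\<sigma> > 0\<close>, of 0 0] by simp
    have m2: "has_bochner_integral lborel (\<lambda>x. normal_density 0 \<sigma> x * x\<^sup>2) (t - s)"
      using normal_moment_even[OF \<open>\<sigma> > 0\<close>, of 0 1] \<open>s < t\<close> by (simp add: \<sigma>_def fact_numeral diff_divide_distrib)
    show ?thesis
      using distributed_integrable[OF d, of "\<lambda>x. x"] distributed_integral[OF d, of "\<lambda>x. x"]
        distributed_integrable[OF d, of "\<lambda>x. x\<^sup>2"] distributed_integral[OF d, of "\<lambda>x. x\<^sup>2"]
        m1 m2 by (simp add: has_bochner_integral_iff)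
  qed simp
  then show "integrable M (\<lambda>w. B t w - B s w)" "(\<integral>w. B t w - B s w \<partial>M) = 0"
    "integrable M (\<lambda>w. (B t w - B s w)\<^sup>2)" "(\<integral>w. (B t w - B s w)\<^sup>2 \<partial>M) = t - s"
    by auto
qed

text \<open>Independence of the increment from \<open>F s\<close> takes the place of conditional
  expectations: the mean of the product factorizes.\<close>

lemma increment_mean_zero:
  assumes "0 \<le> s" "s \<le> t" "t \<le> T" and V: "V \<in> borel_measurable (F s)" and intV: "integrable M V"
  shows "integrable M (\<lambda>w. V w * (B t w - B s w))" "(\<integral>w. V w * (B t w - B s w) \<partial>M) = 0"
proof -
  note mom = increment_moments[OF assms(1-3)]
  have "integrable M (\<lambda>w. V w * (B t w - B s w)) \<and> (\<integral>w. V w * (B t w - B s w) \<partial>M) = 0"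
  proof (cases "s = t")
    case False
    then have ind: "indep_var borel V borel (\<lambda>w. B t w - B s w)"
      using assms increment_indep[of s t V borel "\<lambda>x. x" borel] by auto
    show ?thesis
      using indep_var_lebesgue_integral[OF ind intV mom(1)] indep_var_integrable[OF ind intV mom(1)] mom(2) by simp
  qed simp
  then show "integrable M (\<lambda>w. V w * (B t w - B s w))" "(\<integral>w. V w * (B t w - B s w) \<partial>M) = 0"
    by auto
qed

lemma increment_variance:
  assumes "0 \<le> s" "s \<le> t" "t \<le> T" and V: "V \<in> borel_measurable (F s)" and intV: "integrable M V"
  shows "integrable M (\<lambda>w. V w * (B t w - B s w)\<^sup>2)" "(\<integral>w. V w * (B t w - B s w)\<^sup>2 \<partial>M) = (\<integral>w. V w \<partial>M) * (t - s)"
proof -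
  note mom = increment_moments[OF assms(1-3)]
  have "integrable M (\<lambda>w. V w * (B t w - B s w)\<^sup>2) \<and> (\<integral>w. V w * (B t w - B s w)\<^sup>2 \<partial>M) = (\<integral>w. V w \<partial>M) * (t - s)"
  proof (cases "s = t")
    case False
    then have ind: "indep_var borel V borel (\<lambda>w. (B t w - B s w)\<^sup>2)"
      using assms by (intro increment_indep[where g = "\<lambda>x. x\<^sup>2"]) auto
    show ?thesis
      using indep_var_lebesgue_integral[OF ind] indep_var_integrable[OF ind] intV mom(3,4)
      by (simp add: comp_def)
  qed simp
  then show "integrable M (\<lambda>w. V w * (B t w - B s w)\<^sup>2)"
    "(\<integral>w. V w * (B t w - B s w)\<^sup>2 \<partial>M) = (\<integral>w. V w \<partial>M) * (t - s)"
    by auto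
qed

text \<open>The intervals may overlap and come in no order, over an arbitrary index type. A linear
  combination of simple integrands on different grids is therefore again such a family, and common
  refinements of grids never arise.\<close>

definition elementary :: "'i set \<Rightarrow> ('i \<Rightarrow> real) \<Rightarrow> ('i \<Rightarrow> real) \<Rightarrow> ('i \<Rightarrow> 'a \<Rightarrow> real) \<Rightarrow> bool" where
  "elementary J a b h \<longleftrightarrow> finite J \<and>
     (\<forall>j\<in>J. 0 \<le> a j \<and> a j \<le> b j \<and> b j \<le> T \<and> h j \<in> borel_measurable (F (a j)) \<and>
        (\<exists>C. \<forall>w\<in>space M. \<bar>h j w\<bar> \<le> C))"

section \<open>Covariances of elementary integrals\<close>

lemma bounded_mult_integrable:
  assumes "f \<in> borel_measurable M" "\<exists>C. \<forall>w\<in>space M. \<bar>f w\<bar> \<le> C" "integrable M g"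
  shows "integrable M (\<lambda>w. f w * (g w :: real))"
proof -
  obtain C where C: "\<And>w. w \<in> space M \<Longrightarrow> \<bar>f w\<bar> \<le> C" using assms(2) by blast
  have [measurable]: "f \<in> borel_measurable M" "g \<in> borel_measurable M" using assms by auto
  show ?thesis
  proof (rule Bochner_Integration.integrable_bound)
    show "integrable M (\<lambda>w. C * \<bar>g w\<bar>)" using assms(3) by auto
    show "AE w in M. norm (f w * g w) \<le> norm (C * \<bar>g w\<bar>)"
    proof (rule AE_I2)
      fix w assume "w \<in> space M"
      have "\<bar>f w * g w\<bar> \<le> C * \<bar>g w\<bar>"
        unfolding abs_mult using C[OF \<open>w \<in> space M\<close>] by (rule mult_right_mono) simp
      then show "norm (f w * g w) \<le> norm (C * \<bar>g w\<bar>)" by simp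
    qed
  qed simp
qed

lemma bounded_mult:
  fixes f g :: "'a \<Rightarrow> real"
  assumes "\<exists>C. \<forall>w\<in>space M. \<bar>f w\<bar> \<le> C" "\<exists>C. \<forall>w\<in>space M. \<bar>g w\<bar> \<le> C"
  shows "\<exists>C. \<forall>w\<in>space M. \<bar>f w * g w\<bar> \<le> C"
proof -
  obtain C D where "\<And>w. w \<in> space M \<Longrightarrow> \<bar>f w\<bar> \<le> C" "\<And>w. w \<in> space M \<Longrightarrow> \<bar>g w\<bar> \<le> D"
    using assms by blast
  then show ?thesis
    by (intro exI[of _ "C * D"]) (auto simp: abs_mult intro!: mult_mono intro: order_trans[OF abs_ge_zero])
qed

text \<open>Products of increments over disjoint intervals have mean 0 because the later one is
  independent of everything else in the product; only the squared increment over the overlap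
  contributes. The order a \<le> c makes the coefficient f g known at time c, before the overlap
  begins.\<close>

lemma increment_product:
  assumes a: "0 \<le> a" "a \<le> b" "b \<le> T" and c: "0 \<le> c" "c \<le> d" "d \<le> T" and "a \<le> c"
    and f: "f \<in> borel_measurable (F a)" "\<exists>C. \<forall>w\<in>space M. \<bar>f w\<bar> \<le> C"
    and g: "g \<in> borel_measurable (F c)" "\<exists>C. \<forall>w\<in>space M. \<bar>g w\<bar> \<le> C"
  shows "integrable M (\<lambda>w. (f w * (B b w - B a w)) * (g w * (B d w - B c w)))"
    and "(\<integral>w. (f w * (B b w - B a w)) * (g w * (B d w - B c w)) \<partial>M)
      = (\<integral>w. f w * g w \<partial>M) * measure lborel ({a<..b} \<inter> {c<..d})"
proof -
  have fc: "f \<in> borel_measurable (F c)"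
    using f a c \<open>a \<le> c\<close> by (intro measurable_F_mono[of a c]) auto
  have BF: "B u \<in> borel_measurable (F v)" if "0 \<le> u" "u \<le> v" "v \<le> T" for u v
    using that B_measurable_F[of u] by (intro measurable_F_mono[of u v]) auto
  have [measurable]: "f \<in> borel_measurable M" "g \<in> borel_measurable M"
    using fc g c by (auto intro: measurable_F_M[of c])
  have fg: "\<exists>C. \<forall>w\<in>space M. \<bar>f w * g w\<bar> \<le> C" using f g by (intro bounded_mult)
  have fgint: "integrable M (\<lambda>w. f w * g w)"
    using bounded_mult_integrable[of "\<lambda>w. f w * g w" "\<lambda>_. 1"] fg by simp
  have "integrable M (\<lambda>w. (f w * (B b w - B a w)) * (g w * (B d w - B c w))) \<and>
    (\<integral>w. (f w * (B b w - B a w)) * (g w * (B d w - B c w)) \<partial>M)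
      = (\<integral>w. f w * g w \<partial>M) * measure lborel ({a<..b} \<inter> {c<..d})"
  proof (cases "b \<le> c")
    case True
    let ?V = "\<lambda>w. (f w * g w) * (B b w - B a w)"
    have [measurable]: "f \<in> borel_measurable (F c)" "g \<in> borel_measurable (F c)" "B a \<in> borel_measurable (F c)"
        "B b \<in> borel_measurable (F c)"
      using fc g BF True a c \<open>a \<le> c\<close> by auto
    have V: "?V \<in> borel_measurable (F c)" by measurable
    have intV: "integrable M ?V"
      using fg increment_moments[OF a] by (intro bounded_mult_integrable) auto
    have eq: "(f w * (B b w - B a w)) * (g w * (B d w - B c w)) = ?V w * (B d w - B c w)" for w
      by (simp add: ac_simps)
    have empty: "{a<..b} \<inter> {c<..d} = {}" using True by auto
    show ?thesis
      unfolding eq empty using increment_mean_zero[OF c V intV] by simp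
  next
    case False
    \<comment> \<open>The overlap is (c, m], and (m, m'] is what the interval ending later has
      beyond it; this treats b \<le> d and d < b alike.\<close>
    define m where "m = min b d"
    define m' where "m' = max b d"
    have m: "c \<le> m" "m \<le> m'" "m' \<le> T" "0 \<le> m" "m \<le> T" using False a c by (auto simp: m_def m'_def)
    let ?V1 = "\<lambda>w. (f w * g w) * (B c w - B a w)"
    let ?V2 = "\<lambda>w. f w * g w"
    let ?V3 = "\<lambda>w. (f w * g w) * (B m w - B c w)"
    have mc: "f \<in> borel_measurable (F c)" "g \<in> borel_measurable (F c)" "B a \<in> borel_measurable (F c)"
        "B c \<in> borel_measurable (F c)"
      using fc g BF False a c \<open>a \<le> c\<close> by auto
    have V12: "?V1 \<in> borel_measurable (F c)" "?V2 \<in> borel_measurable (F c)"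
      using mc by auto
    have mm: "f \<in> borel_measurable (F m)" "g \<in> borel_measurable (F m)" "B m \<in> borel_measurable (F m)"
        "B c \<in> borel_measurable (F m)"
      using mc BF m c by (auto intro: measurable_F_mono[of c m])
    then have V3: "?V3 \<in> borel_measurable (F m)" by measurable
    have i1: "integrable M ?V1"
      using fg increment_moments[of a c] a c \<open>a \<le> c\<close> by (intro bounded_mult_integrable) auto
    have i3: "integrable M ?V3"
      using fg increment_moments[of c m] m c by (intro bounded_mult_integrable) auto
    \<comment> \<open>The three summands pair the part before c with the second increment, the
      overlap with itself, and the overlap with the remainder after it.\<close>
    have eq: "(f w * (B b w - B a w)) * (g w * (B d w - B c w))
        = ?V1 w * (B d w - B c w) + (?V2 w * (B m w - B c w)\<^sup>2 + ?V3 w * (B m' w - B m w))" for w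
    proof (cases "b \<le> d")
      case True
      then have "m = b" "m' = d" by (auto simp: m_def m'_def)
      then show ?thesis by (simp only:) (simp add: algebra_simps power2_eq_square)
    next
      case False
      then have "m = d" "m' = b" by (auto simp: m_def m'_def)
      then show ?thesis by (simp only:) (simp add: algebra_simps power2_eq_square)
    qed
    have "{a<..b} \<inter> {c<..d} = {c<..m}"
      using \<open>a \<le> c\<close> by (auto simp: m_def)
    then have ms: "measure lborel ({a<..b} \<inter> {c<..d}) = m - c"
      using m by simp
    note z1 = increment_mean_zero[OF c V12(1) i1]
    note z2 = increment_variance[OF c(1) m(1) m(5) V12(2) fgint]
    note z3 = increment_mean_zero[OF m(4) m(2) m(3) V3 i3]
    show ?thesis
      unfolding eq ms using z1 z2 z3 by simp
  qed
  then show "integrable M (\<lambda>w. (f w * (B b w - B a w)) * (g w * (B d w - B c w)))"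
    "(\<integral>w. (f w * (B b w - B a w)) * (g w * (B d w - B c w)) \<partial>M)
      = (\<integral>w. f w * g w \<partial>M) * measure lborel ({a<..b} \<inter> {c<..d})"
    by auto
qed

text \<open>Symmetry in j and k removes the assumption on the order of the left end points.\<close>

lemma elementary_pair:
  assumes el: "elementary J a b h" and "j \<in> J" "k \<in> J"
  shows "integrable M (\<lambda>w. (h j w * (B (b j) w - B (a j) w)) * (h k w * (B (b k) w - B (a k) w)))"
    and "(\<integral>w. (h j w * (B (b j) w - B (a j) w)) * (h k w * (B (b k) w - B (a k) w)) \<partial>M)
      = (\<integral>w. h j w * h k w \<partial>M) * measure lborel ({a j<..b j} \<inter> {a k<..b k})"
proof -
  have "integrable M (\<lambda>w. (h j w * (B (b j) w - B (a j) w)) * (h k w * (B (b k) w - B (a k) w))) \<and>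
    (\<integral>w. (h j w * (B (b j) w - B (a j) w)) * (h k w * (B (b k) w - B (a k) w)) \<partial>M)
      = (\<integral>w. h j w * h k w \<partial>M) * measure lborel ({a j<..b j} \<inter> {a k<..b k})"
    if "j \<in> J" "k \<in> J" "a j \<le> a k" for j k
    using el that unfolding elementary_def
    by (intro conjI increment_product) blast+
  from this[of j k] this[of k j] \<open>j \<in> J\<close> \<open>k \<in> J\<close>
  show "integrable M (\<lambda>w. (h j w * (B (b j) w - B (a j) w)) * (h k w * (B (b k) w - B (a k) w)))"
    and "(\<integral>w. (h j w * (B (b j) w - B (a j) w)) * (h k w * (B (b k) w - B (a k) w)) \<partial>M)
      = (\<integral>w. h j w * h k w \<partial>M) * measure lborel ({a j<..b j} \<inter> {a k<..b k})"
    by (cases "a j \<le> a k"; simp add: ac_simps Int_commute)+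
qed

lemma elementary_square_integrable:
  assumes "elementary J a b h"
  shows "integrable M (\<lambda>w. (\<Sum>j\<in>J. h j w * (B (b j) w - B (a j) w))\<^sup>2)"
  unfolding power2_eq_square sum_product
  by (intro Bochner_Integration.integrable_sum elementary_pair[OF assms])

text \<open>Both sides expand into the double sum of the means of h_j h_k times the length of the
  overlap of intervals j and k: the left side through the covariances, the right side by integrating
  products of indicators over s.\<close>

lemma elementary_isometry:
  assumes el: "elementary J a b h"
  shows "(\<integral>\<^sup>+ w. ennreal ((\<Sum>j\<in>J. h j w * (B (b j) w - B (a j) w))\<^sup>2) \<partial>M)
    = (\<integral>\<^sup>+ w. (\<integral>\<^sup>+ s\<in>{0..T}. ennreal ((\<Sum>j\<in>J. h j w * indicator {a j<..b j} s)\<^sup>2) \<partial>lborel) \<partial>M)"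
proof -
  define L where "L j k = measure lborel ({a j<..b j} \<inter> {a k<..b k})" for j k
  let ?Q = "\<lambda>w. \<Sum>j\<in>J. \<Sum>k\<in>J. (h j w * h k w) * L j k"
  have ab: "0 \<le> a j" "a j \<le> b j" "b j \<le> T" and hF: "h j \<in> borel_measurable (F (a j))"
    and bdd: "\<exists>C. \<forall>w\<in>space M. \<bar>h j w\<bar> \<le> C" if "j \<in> J" for j
    using el that by (auto simp: elementary_def)
  have hM: "h j \<in> borel_measurable M" if "j \<in> J" for j
    using ab[OF that] hF[OF that] by (intro measurable_F_M[of "a j"]) auto
  have hh: "integrable M (\<lambda>w. h j w * h k w)" if "j \<in> J" "k \<in> J" for j k
    using that hM bdd bounded_mult_integrable[of "\<lambda>w. h j w * h k w" "\<lambda>_. 1"] bounded_mult[of "h j" "h k"] by simp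
  have sq: "(\<Sum>j\<in>J. x j)\<^sup>2 = (\<Sum>j\<in>J. \<Sum>k\<in>J. x j * x k)" for x :: "'b \<Rightarrow> real"
    by (simp add: power2_eq_square sum_product)
  have "(\<integral>\<^sup>+ w. ennreal ((\<Sum>j\<in>J. h j w * (B (b j) w - B (a j) w))\<^sup>2) \<partial>M)
      = ennreal (\<integral>w. (\<Sum>j\<in>J. h j w * (B (b j) w - B (a j) w))\<^sup>2 \<partial>M)"
    by (intro nn_integral_eq_integral elementary_square_integrable el) auto
  also have "(\<integral>w. (\<Sum>j\<in>J. h j w * (B (b j) w - B (a j) w))\<^sup>2 \<partial>M)
      = (\<Sum>j\<in>J. \<Sum>k\<in>J. (\<integral>w. (h j w * (B (b j) w - B (a j) w)) * (h k w * (B (b k) w - B (a k) w)) \<partial>M))"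
    unfolding sq
    by (subst Bochner_Integration.integral_sum, intro Bochner_Integration.integrable_sum elementary_pair[OF el], assumption+,
        intro sum.cong refl, subst Bochner_Integration.integral_sum, intro elementary_pair[OF el], assumption+, rule refl)
  also have "\<dots> = (\<Sum>j\<in>J. \<Sum>k\<in>J. (\<integral>w. h j w * h k w \<partial>M) * L j k)"
    unfolding L_def by (intro sum.cong refl elementary_pair[OF el])
  also have "\<dots> = (\<Sum>j\<in>J. \<Sum>k\<in>J. (\<integral>w. (h j w * h k w) * L j k \<partial>M))"
    by simp
  also have "\<dots> = (\<integral>w. ?Q w \<partial>M)"
  proof -
    have "(\<integral>w. ?Q w \<partial>M) = (\<Sum>j\<in>J. \<integral>w. (\<Sum>k\<in>J. (h j w * h k w) * L j k) \<partial>M)"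
      using hh by (intro Bochner_Integration.integral_sum Bochner_Integration.integrable_sum integrable_mult_left)
    also have "\<dots> = (\<Sum>j\<in>J. \<Sum>k\<in>J. (\<integral>w. (h j w * h k w) * L j k \<partial>M))"
      using hh by (intro sum.cong refl Bochner_Integration.integral_sum integrable_mult_left)
    finally show ?thesis by simp
  qed
  finally have lhs: "(\<integral>\<^sup>+ w. ennreal ((\<Sum>j\<in>J. h j w * (B (b j) w - B (a j) w))\<^sup>2) \<partial>M) = ennreal (\<integral>w. ?Q w \<partial>M)" .
  have Lint: "integrable lborel (\<lambda>s. indicator ({a j<..b j} \<inter> {a k<..b k}) s :: real)"
    and Lval: "(\<integral>s. indicator ({a j<..b j} \<inter> {a k<..b k}) s \<partial>lborel) = L j k" if "j \<in> J" for j k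
  proof -
    have "emeasure lborel ({a j<..b j} \<inter> {a k<..b k}) \<le> emeasure lborel {a j<..b j}"
      by (intro emeasure_mono) auto
    also have "\<dots> < \<infinity>" using ab[OF that] by simp
    finally show "integrable lborel (\<lambda>s. indicator ({a j<..b j} \<inter> {a k<..b k}) s :: real)"
      by (simp add: integrable_indicator_iff)
    show "(\<integral>s. indicator ({a j<..b j} \<inter> {a k<..b k}) s \<partial>lborel) = L j k"
      by (simp add: L_def)
  qed
  have inner: "(\<integral>\<^sup>+ s\<in>{0..T}. ennreal ((\<Sum>j\<in>J. h j w * indicator {a j<..b j} s)\<^sup>2) \<partial>lborel) = ennreal (?Q w) \<and> 0 \<le> ?Q w" for w
  proof -
    have ex: "(\<Sum>j\<in>J. h j w * indicator {a j<..b j} s)\<^sup>2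
        = (\<Sum>j\<in>J. \<Sum>k\<in>J. (h j w * h k w) * indicator ({a j<..b j} \<inter> {a k<..b k}) s)" for s
      unfolding sq by (intro sum.cong refl) (auto simp: indicator_def)
    have int: "integrable lborel (\<lambda>s. (\<Sum>j\<in>J. h j w * indicator {a j<..b j} s)\<^sup>2)"
      unfolding ex by (intro Bochner_Integration.integrable_sum integrable_mult_right Lint)
    have val: "(\<integral>s. (\<Sum>j\<in>J. h j w * indicator {a j<..b j} s)\<^sup>2 \<partial>lborel) = ?Q w"
    proof -
      have "(\<integral>s. (\<Sum>j\<in>J. h j w * indicator {a j<..b j} s)\<^sup>2 \<partial>lborel)
          = (\<Sum>j\<in>J. \<integral>s. (\<Sum>k\<in>J. (h j w * h k w) * indicator ({a j<..b j} \<inter> {a k<..b k}) s) \<partial>lborel)"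
        unfolding ex
        by (intro Bochner_Integration.integral_sum Bochner_Integration.integrable_sum integrable_mult_right Lint)
      also have "\<dots> = (\<Sum>j\<in>J. \<Sum>k\<in>J. \<integral>s. (h j w * h k w) * indicator ({a j<..b j} \<inter> {a k<..b k}) s \<partial>lborel)"
        by (intro sum.cong refl Bochner_Integration.integral_sum integrable_mult_right Lint)
      also have "\<dots> = ?Q w"
      proof (intro sum.cong refl)
        fix j k assume "j \<in> J"
        show "(\<integral>s. (h j w * h k w) * indicator ({a j<..b j} \<inter> {a k<..b k}) s \<partial>lborel) = (h j w * h k w) * L j k"
          unfolding integral_mult_right_zero Lval[OF \<open>j \<in> J\<close>] ..
      qed
      finally show ?thesis .
    qed
    have "(\<integral>\<^sup>+ s\<in>{0..T}. ennreal ((\<Sum>j\<in>J. h j w * indicator {a j<..b j} s)\<^sup>2) \<partial>lborel)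
        = (\<integral>\<^sup>+ s. ennreal ((\<Sum>j\<in>J. h j w * indicator {a j<..b j} s)\<^sup>2) \<partial>lborel)"
    proof (intro nn_integral_cong)
      fix s
      show "ennreal ((\<Sum>j\<in>J. h j w * indicator {a j<..b j} s)\<^sup>2) * indicator {0..T} s
          = ennreal ((\<Sum>j\<in>J. h j w * indicator {a j<..b j} s)\<^sup>2)"
      proof (cases "s \<in> {0..T}")
        case False
        then have "h j w * indicator {a j<..b j} s = 0" if "j \<in> J" for j
          using ab[OF that] by (auto simp: indicator_def)
        then have "(\<Sum>j\<in>J. h j w * indicator {a j<..b j} s) = 0"
          by (intro sum.neutral) blast
        then show ?thesis by simp
      qed simp
    qed
    also have "\<dots> = ennreal (?Q w)"
      using nn_integral_eq_integral[OF int] unfolding val by simp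
    finally show ?thesis
      using integral_nonneg_AE[of "\<lambda>s. (\<Sum>j\<in>J. h j w * indicator {a j<..b j} s)\<^sup>2" lborel] unfolding val by simp
  qed
  have Qint: "integrable M ?Q"
    using hh by (intro Bochner_Integration.integrable_sum integrable_mult_left) blast
  show ?thesis
    unfolding lhs using inner nn_integral_eq_integral[OF Qint] by simp
qed

end

section \<open>Convergence and linearity of the Ito integral\<close>

text \<open>The pair is ordered (w, s), s ranges over the whole line and the cut-off is part of the
  function, because in this form integration over s with respect to \<open>lborel\<close> directly
  yields an N-measurable function of w. Nothing is asked of H outside [0,t].\<close>

definition jointly_measurable :: "real \<Rightarrow> 'a measure \<Rightarrow> (real \<Rightarrow> 'a \<Rightarrow> real) \<Rightarrow> bool" where
  "jointly_measurable t N H \<longleftrightarrow> (\<lambda>(w, s). H s w * indicator {0..t} s) \<in> borel_measurable (N \<Otimes>\<^sub>M lborel)"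

lemma jointly_measurable_progressive:
  assumes "progressively_measurable F T H" "0 \<le> t" "t \<le> T"
  shows "jointly_measurable t (F t) H"
proof -
  have [measurable]: "(\<lambda>(s, w). H s w) \<in> borel_measurable (restrict_space borel {0..t} \<Otimes>\<^sub>M F t)"
    using assms by (simp add: progressively_measurable_def)
  \<comment> \<open>Progressive measurability lives on [0,t] as a space of its own; clamping s into
    [0,t] extends the process to the whole line, and the indicator then removes the points that were
    moved.\<close>
  have [measurable]: "(\<lambda>s. max 0 (min s t)) \<in> measurable lborel (restrict_space borel {0..t})"
    using \<open>0 \<le> t\<close> by (intro measurable_restrict_space2) auto
  have "(\<lambda>p. (max 0 (min (snd p) t), fst p)) \<in> measurable (F t \<Otimes>\<^sub>M lborel) (restrict_space borel {0..t} \<Otimes>\<^sub>M F t)"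
    by measurable
  then have "(\<lambda>p. (\<lambda>(s, w). H s w) (max 0 (min (snd p) t), fst p) * indicator {0..t} (snd p))
      \<in> borel_measurable (F t \<Otimes>\<^sub>M lborel)"
    by measurable
  also have "(\<lambda>p. (\<lambda>(s, w). H s w) (max 0 (min (snd p) t), fst p) * indicator {0..t} (snd p))
      = (\<lambda>(w, s). H s w * indicator {0..t} s)"
    by (auto simp: fun_eq_iff indicator_def min_def max_def)
  finally show ?thesis by (simp add: jointly_measurable_def)
qed

lemma jointly_measurable_lincomb:
  assumes "finite S" "\<And>i. i \<in> S \<Longrightarrow> jointly_measurable t N (H i)"
  shows "jointly_measurable t N (\<lambda>s w. \<Sum>i\<in>S. c i * H i s w)"
proof -
  have "(\<lambda>p. \<Sum>i\<in>S. c i * (\<lambda>(w, s). H i s w * indicator {0..t} s) p) \<in> borel_measurable (N \<Otimes>\<^sub>M lborel)"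
    using assms unfolding jointly_measurable_def
    by (intro borel_measurable_sum borel_measurable_times borel_measurable_const) auto
  also have "(\<lambda>p. \<Sum>i\<in>S. c i * (\<lambda>(w, s). H i s w * indicator {0..t} s) p)
      = (\<lambda>(w, s). (\<Sum>i\<in>S. c i * H i s w) * indicator {0..t} s)"
    by (auto simp: fun_eq_iff sum_distrib_right mult.assoc)
  finally show ?thesis by (simp add: jointly_measurable_def)
qed

lemma jointly_measurable_diff:
  assumes "jointly_measurable t N G" "jointly_measurable t N H"
  shows "jointly_measurable t N (\<lambda>s w. G s w - H s w)"
  \<comment> \<open>Two-term statements are finite combinations indexed by \<open>bool\<close>; the
    same device recurs below for differences of paths and of integrals.\<close>
  using jointly_measurable_lincomb[of "UNIV :: bool set" t N "\<lambda>b. if b then G else H" "\<lambda>b. if b then 1 else -1"] assms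
  by (simp add: UNIV_bool)

lemma jointly_measurable_square:
  assumes "jointly_measurable t N H"
  shows "(\<lambda>(w, s). ennreal ((H s w)\<^sup>2) * indicator {0..t} s) \<in> borel_measurable (N \<Otimes>\<^sub>M lborel)"
proof -
  have [measurable]: "(\<lambda>(w, s). H s w * indicator {0..t} s) \<in> borel_measurable (N \<Otimes>\<^sub>M lborel)"
    using assms by (simp add: jointly_measurable_def)
  have "(\<lambda>p. ennreal (((\<lambda>(w, s). H s w * indicator {0..t} s) p)\<^sup>2)) \<in> borel_measurable (N \<Otimes>\<^sub>M lborel)"
    by measurable
  also have "(\<lambda>p. ennreal (((\<lambda>(w, s). H s w * indicator {0..t} s) p)\<^sup>2))
      = (\<lambda>(w, s). ennreal ((H s w)\<^sup>2) * indicator {0..t} s)"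
    by (auto simp: fun_eq_iff indicator_def)
  finally show ?thesis .
qed

lemma sq_integral_measurable:
  "jointly_measurable t N H \<Longrightarrow> (\<lambda>w. sq_integral t (\<lambda>s. H s w)) \<in> borel_measurable N"
  by (rule lborel.borel_measurable_nn_integral[OF jointly_measurable_square])

lemma jointly_measurable_section:
  assumes "jointly_measurable t N H" "w \<in> space N"
  shows "(\<lambda>s. H s w * indicator {0..t} s) \<in> borel_measurable borel"
  using measurable_compose[OF measurable_Pair1'[OF assms(2), of lborel] assms(1)[unfolded jointly_measurable_def]]
  by simp

lemma sq_integral_indicator:
  "sq_integral T (\<lambda>s. f s * indicator {0..T} s) = sq_integral T f"
  by (intro nn_integral_cong) (auto simp: indicator_def)

text \<open>Measurability is asked of the cut-off paths only, as admissible processes promise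
  nothing beyond [0,T].\<close>

lemma sq_integral_lincomb_le:
  assumes "finite S" "\<And>i. i \<in> S \<Longrightarrow> (\<lambda>s. f i s * indicator {0..T} s) \<in> borel_measurable borel"
  shows "sq_integral T (\<lambda>s. \<Sum>i\<in>S. c i * f i s)
    \<le> of_nat (card S) * (\<Sum>i\<in>S. ennreal ((c i)\<^sup>2) * sq_integral T (f i))"
proof -
  have eq: "ennreal ((f i s)\<^sup>2) * indicator {0..T} s = ennreal ((f i s * indicator {0..T} s)\<^sup>2)" for i s
    by (auto simp: indicator_def)
  have [measurable]: "(\<lambda>s. ennreal ((f i s)\<^sup>2) * indicator {0..T} s) \<in> borel_measurable lborel" if "i \<in> S" for i
    unfolding eq using assms(2)[OF that] by measurable
  have "sq_integral T (\<lambda>s. \<Sum>i\<in>S. c i * f i s)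
      \<le> (\<integral>\<^sup>+ s. of_nat (card S) * (\<Sum>i\<in>S. ennreal ((c i)\<^sup>2) * (ennreal ((f i s)\<^sup>2) * indicator {0..T} s)) \<partial>lborel)"
  proof (intro nn_integral_mono)
    fix s
    have "ennreal ((\<Sum>i\<in>S. c i * f i s)\<^sup>2) \<le> of_nat (card S) * (\<Sum>i\<in>S. ennreal ((c i * f i s)\<^sup>2))"
      by (rule ennreal_sum_square_le[OF assms(1)])
    then show "ennreal ((\<Sum>i\<in>S. c i * f i s)\<^sup>2) * indicator {0..T} s
      \<le> of_nat (card S) * (\<Sum>i\<in>S. ennreal ((c i)\<^sup>2) * (ennreal ((f i s)\<^sup>2) * indicator {0..T} s))"
      by (cases "s \<in> {0..T}") (simp_all add: power_mult_distrib ennreal_mult)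
  qed
  also have "\<dots> = of_nat (card S) * (\<Sum>i\<in>S. ennreal ((c i)\<^sup>2) * sq_integral T (f i))"
    by (simp add: nn_integral_cmult nn_integral_sum)
  finally show ?thesis .
qed

lemma sq_integral_diff_le:
  assumes "(\<lambda>s. f s * indicator {0..T} s) \<in> borel_measurable borel" "(\<lambda>s. g s * indicator {0..T} s) \<in> borel_measurable borel"
  shows "sq_integral T (\<lambda>s. f s - g s) \<le> 2 * (sq_integral T f + sq_integral T g)"
  using sq_integral_lincomb_le[of "UNIV :: bool set" "\<lambda>b. if b then f else g" T "\<lambda>b. if b then 1 else -1"] assms
  by (simp add: UNIV_bool add.commute)

context brownian_space
begin

section \<open>The isometry for combinations of simple integrands\<close>

lemma simple_path_jointly_measurable:
  assumes "simple_integrand M F T n \<tau> h"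
  shows "jointly_measurable t M (simple_path n \<tau> h)"
proof -
  have [measurable]: "h i \<in> borel_measurable M" if "i < n" for i
    using assms that by (intro measurable_F_M[of "\<tau> i"]) (auto simp: simple_integrand_def)
  have "(\<lambda>p. (\<Sum>i<n. h i (fst p) * indicator {\<tau> i<..\<tau> (Suc i)} (snd p)) * indicator {0..t} (snd p))
      \<in> borel_measurable (M \<Otimes>\<^sub>M lborel)"
    by measurable
  then show ?thesis
    by (simp add: jointly_measurable_def simple_path_def case_prod_beta')
qed

lemma simple_ito_measurable:
  assumes "simple_integrand M F T n \<tau> h"
  shows "simple_ito B n \<tau> h \<in> borel_measurable M"
proof -
  have [measurable]: "h i \<in> borel_measurable M" "B (\<tau> i) \<in> borel_measurable M" "B (\<tau> (Suc i)) \<in> borel_measurable M"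
    if "i < n" for i
    using assms that by (auto simp: simple_integrand_def intro: measurable_F_M[of "\<tau> i"] B_measurable)
  show ?thesis
    unfolding simple_ito_def[abs_def] by measurable
qed

text \<open>All cells of all grids are pooled into one elementary family indexed by pairs of a grid
  and a cell, so the grids need not be aligned.\<close>

lemma simple_combination_isometry:
  assumes "finite S" and simple: "\<And>i. i \<in> S \<Longrightarrow> simple_integrand M F T (n i) (\<tau> i) (h i)"
  shows "(\<integral>\<^sup>+ w. ennreal ((\<Sum>i\<in>S. c i * simple_ito B (n i) (\<tau> i) (h i) w)\<^sup>2) \<partial>M)
    = (\<integral>\<^sup>+ w. sq_integral T (\<lambda>s. \<Sum>i\<in>S. c i * simple_path (n i) (\<tau> i) (h i) s w) \<partial>M)"
proof -
  define J where "J = (SIGMA i:S. {..<n i})"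
  define a where "a p = \<tau> (fst p) (snd p)" for p
  define b where "b p = \<tau> (fst p) (Suc (snd p))" for p
  define g where "g p w = c (fst p) * h (fst p) (snd p) w" for p w
  have "elementary J a b g"
    unfolding elementary_def
  proof (intro conjI ballI)
    show "finite J" using assms(1) by (simp add: J_def)
    fix p assume "p \<in> J"
    then obtain i k where p: "p = (i, k)" and ik: "i \<in> S" "k < n i" by (auto simp: J_def)
    have si: "simple_integrand M F T (n i) (\<tau> i) (h i)" using simple ik by blast
    have "\<tau> i k \<in> {0..T}" "\<tau> i (Suc k) \<in> {0..T}" "\<tau> i k \<le> \<tau> i (Suc k)" "h i k \<in> borel_measurable (F (\<tau> i k))"
      using si ik by (auto simp: simple_integrand_def)
    then show "0 \<le> a p" "a p \<le> b p" "b p \<le> T" "g p \<in> borel_measurable (F (a p))"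
      by (auto simp: a_def b_def g_def[abs_def] p)
    have "\<exists>C. \<forall>w\<in>space M. \<bar>h i k w\<bar> \<le> C"
      using si ik by (auto simp: simple_integrand_def)
    then obtain C where C: "\<And>w. w \<in> space M \<Longrightarrow> \<bar>h i k w\<bar> \<le> C" by blast
    show "\<exists>C. \<forall>w\<in>space M. \<bar>g p w\<bar> \<le> C"
      by (intro exI[of _ "\<bar>c i\<bar> * C"]) (auto simp: g_def p abs_mult intro!: mult_left_mono C)
  qed
  note iso = elementary_isometry[OF this]
  have "(\<Sum>i\<in>S. c i * simple_ito B (n i) (\<tau> i) (h i) w) = (\<Sum>p\<in>J. g p w * (B (b p) w - B (a p) w))" for w
    unfolding simple_ito_def sum_distrib_left J_def a_def b_def g_def mult.assoc
    by (subst sum.Sigma) (use assms(1) in \<open>simp_all only: case_prod_beta' finite_lessThan ball_triv simp_thms\<close>)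
  moreover have "(\<Sum>i\<in>S. c i * simple_path (n i) (\<tau> i) (h i) s w) = (\<Sum>p\<in>J. g p w * indicator {a p<..b p} s)" for s w
    unfolding simple_path_def sum_distrib_left J_def a_def b_def g_def mult.assoc
    by (subst sum.Sigma) (use assms(1) in \<open>simp_all only: case_prod_beta' finite_lessThan ball_triv simp_thms\<close>)
  ultimately show ?thesis
    using iso by (simp only:)
qed

lemma simple_diff_isometry:
  assumes "simple_integrand M F T n \<tau> h" "simple_integrand M F T n' \<tau>' h'"
  shows "(\<integral>\<^sup>+ w. ennreal ((simple_ito B n \<tau> h w - simple_ito B n' \<tau>' h' w)\<^sup>2) \<partial>M)
    = (\<integral>\<^sup>+ w. sq_integral T (\<lambda>s. simple_path n \<tau> h s w - simple_path n' \<tau>' h' s w) \<partial>M)"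
  using simple_combination_isometry[of "UNIV :: bool set" "\<lambda>b. if b then n else n'" "\<lambda>b. if b then \<tau> else \<tau>'"
      "\<lambda>b. if b then h else h'" "\<lambda>b. if b then 1 else -1"] assms
  by (simp add: UNIV_bool)

text \<open>By the isometry, the combined simple integrals have the mean square of the combined
  simple paths, which tends to 0 because these paths approach a combination that vanishes. One
  statement covers uniqueness of the integral, its linearity, and its insensitivity to changes of
  the integrand on null sets.\<close>

lemma ito_lincomb_zero:
  assumes S: "finite S" and ito: "\<And>i. i \<in> S \<Longrightarrow> has_ito_integral M F B T (H i) (I i)"
    and jm: "\<And>i. i \<in> S \<Longrightarrow> jointly_measurable T M (H i)"
    and zero: "AE w in M. AE s in lborel. s \<in> {0..T} \<longrightarrow> (\<Sum>i\<in>S. c i * H i s w) = 0"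
  shows "AE w in M. (\<Sum>i\<in>S. c i * I i w) = 0"
proof -
  \<comment> \<open>Each index i has its own approximating sequence; three successive choices make
    n, \<tau> and h functions of i.\<close>
  have "\<forall>i. \<exists>n \<tau> h. i \<in> S \<longrightarrow> (\<forall>m. simple_integrand M F T (n m) (\<tau> m) (h m)) \<and>
      (\<lambda>m. \<integral>\<^sup>+ w. sq_integral T (\<lambda>s. H i s w - simple_path (n m) (\<tau> m) (h m) s w) \<partial>M) \<longlonglongrightarrow> 0 \<and>
      (\<lambda>m. \<integral>\<^sup>+ w. ennreal ((I i w - simple_ito B (n m) (\<tau> m) (h m) w)\<^sup>2) \<partial>M) \<longlonglongrightarrow> 0"
    using ito unfolding has_ito_integral_def by meson
  from choice[OF this] obtain n where "\<forall>i. \<exists>\<tau> h. i \<in> S \<longrightarrow> (\<forall>m. simple_integrand M F T (n i m) (\<tau> m) (h m)) \<and>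
      (\<lambda>m. \<integral>\<^sup>+ w. sq_integral T (\<lambda>s. H i s w - simple_path (n i m) (\<tau> m) (h m) s w) \<partial>M) \<longlonglongrightarrow> 0 \<and>
      (\<lambda>m. \<integral>\<^sup>+ w. ennreal ((I i w - simple_ito B (n i m) (\<tau> m) (h m) w)\<^sup>2) \<partial>M) \<longlonglongrightarrow> 0" ..
  from choice[OF this] obtain \<tau> where "\<forall>i. \<exists>h. i \<in> S \<longrightarrow> (\<forall>m. simple_integrand M F T (n i m) (\<tau> i m) (h m)) \<and>
      (\<lambda>m. \<integral>\<^sup>+ w. sq_integral T (\<lambda>s. H i s w - simple_path (n i m) (\<tau> i m) (h m) s w) \<partial>M) \<longlonglongrightarrow> 0 \<and>
      (\<lambda>m. \<integral>\<^sup>+ w. ennreal ((I i w - simple_ito B (n i m) (\<tau> i m) (h m) w)\<^sup>2) \<partial>M) \<longlonglongrightarrow> 0" ..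
  from choice[OF this] obtain h where
      simple: "\<And>i m. i \<in> S \<Longrightarrow> simple_integrand M F T (n i m) (\<tau> i m) (h i m)"
      and path: "\<And>i. i \<in> S \<Longrightarrow> (\<lambda>m. \<integral>\<^sup>+ w. sq_integral T (\<lambda>s. H i s w - simple_path (n i m) (\<tau> i m) (h i m) s w) \<partial>M) \<longlonglongrightarrow> 0"
      and int: "\<And>i. i \<in> S \<Longrightarrow> (\<lambda>m. \<integral>\<^sup>+ w. ennreal ((I i w - simple_ito B (n i m) (\<tau> i m) (h i m) w)\<^sup>2) \<partial>M) \<longlonglongrightarrow> 0"
    by blast
  define P where "P i m = simple_path (n i m) (\<tau> i m) (h i m)" for i m
  define Y where "Y i m = simple_ito B (n i m) (\<tau> i m) (h i m)" for i m
  have [measurable]: "I i \<in> borel_measurable M" if "i \<in> S" for i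
    using ito[OF that] by (simp add: has_ito_integral_def)
  have [measurable]: "Y i m \<in> borel_measurable M" if "i \<in> S" for i m
    unfolding Y_def by (rule simple_ito_measurable[OF simple[OF that]])
  have jmP: "jointly_measurable T M (P i m)" if "i \<in> S" for i m
    unfolding P_def by (rule simple_path_jointly_measurable[OF simple[OF that]])
  note jmD = jointly_measurable_diff[OF jm jmP]
  let ?d = "\<lambda>i m. \<integral>\<^sup>+ w. sq_integral T (\<lambda>s. H i s w - P i m s w) \<partial>M"
  let ?e = "\<lambda>i m. \<integral>\<^sup>+ w. ennreal ((I i w - Y i m w)\<^sup>2) \<partial>M"
  let ?N = "of_nat (card S) :: ennreal"
  have Yle: "(\<integral>\<^sup>+ w. ennreal ((\<Sum>i\<in>S. c i * Y i m w)\<^sup>2) \<partial>M) \<le> ?N * (\<Sum>i\<in>S. ennreal ((c i)\<^sup>2) * ?d i m)" for m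
  proof -
    have "(\<integral>\<^sup>+ w. ennreal ((\<Sum>i\<in>S. c i * Y i m w)\<^sup>2) \<partial>M) = (\<integral>\<^sup>+ w. sq_integral T (\<lambda>s. \<Sum>i\<in>S. c i * P i m s w) \<partial>M)"
      unfolding Y_def P_def by (rule simple_combination_isometry[OF S simple])
    \<comment> \<open>As the combination of the \<open>H i\<close> vanishes, the combined simple
      path is minus the combined error, and the sign disappears in the square.\<close>
    also have "\<dots> = (\<integral>\<^sup>+ w. sq_integral T (\<lambda>s. \<Sum>i\<in>S. c i * (H i s w - P i m s w)) \<partial>M)"
    proof (rule nn_integral_cong_AE, use zero in eventually_elim)
      fix w assume "AE s in lborel. s \<in> {0..T} \<longrightarrow> (\<Sum>i\<in>S. c i * H i s w) = 0"
      then have "AE s in lborel. ennreal ((\<Sum>i\<in>S. c i * P i m s w)\<^sup>2) * indicator {0..T} s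
          = ennreal ((\<Sum>i\<in>S. c i * (H i s w - P i m s w))\<^sup>2) * indicator {0..T} s"
        by eventually_elim (simp add: indicator_def right_diff_distrib sum_subtractf)
      then show "sq_integral T (\<lambda>s. \<Sum>i\<in>S. c i * P i m s w) = sq_integral T (\<lambda>s. \<Sum>i\<in>S. c i * (H i s w - P i m s w))"
        by (rule nn_integral_cong_AE)
    qed
    also have "\<dots> \<le> (\<integral>\<^sup>+ w. ?N * (\<Sum>i\<in>S. ennreal ((c i)\<^sup>2) * sq_integral T (\<lambda>s. H i s w - P i m s w)) \<partial>M)"
      by (intro nn_integral_mono sq_integral_lincomb_le S jointly_measurable_section[OF jmD])
    also have "\<dots> = ?N * (\<Sum>i\<in>S. ennreal ((c i)\<^sup>2) * ?d i m)"
      using sq_integral_measurable[OF jmD]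
      by (subst nn_integral_cmult, measurable, subst nn_integral_sum, measurable) (simp add: nn_integral_cmult)
    finally show ?thesis .
  qed
  have IYle: "(\<integral>\<^sup>+ w. ennreal ((\<Sum>i\<in>S. c i * (I i w - Y i m w))\<^sup>2) \<partial>M) \<le> ?N * (\<Sum>i\<in>S. ennreal ((c i)\<^sup>2) * ?e i m)" for m
  proof -
    have "(\<integral>\<^sup>+ w. ennreal ((\<Sum>i\<in>S. c i * (I i w - Y i m w))\<^sup>2) \<partial>M)
        \<le> (\<integral>\<^sup>+ w. ?N * (\<Sum>i\<in>S. ennreal ((c i)\<^sup>2) * ennreal ((I i w - Y i m w)\<^sup>2)) \<partial>M)"
    proof (rule nn_integral_mono)
      fix w
      show "ennreal ((\<Sum>i\<in>S. c i * (I i w - Y i m w))\<^sup>2)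
          \<le> ?N * (\<Sum>i\<in>S. ennreal ((c i)\<^sup>2) * ennreal ((I i w - Y i m w)\<^sup>2))"
        using ennreal_sum_square_le[OF S, of "\<lambda>i. c i * (I i w - Y i m w)"]
        by (simp add: power_mult_distrib ennreal_mult)
    qed
    also have "\<dots> = ?N * (\<Sum>i\<in>S. ennreal ((c i)\<^sup>2) * ?e i m)"
      by (simp add: nn_integral_cmult nn_integral_sum)
    finally show ?thesis .
  qed
  have bound: "(\<integral>\<^sup>+ w. ennreal ((\<Sum>i\<in>S. c i * I i w)\<^sup>2) \<partial>M)
      \<le> 2 * (?N * (\<Sum>i\<in>S. ennreal ((c i)\<^sup>2) * ?e i m) + ?N * (\<Sum>i\<in>S. ennreal ((c i)\<^sup>2) * ?d i m))" for m
  proof -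
    have eq: "(\<Sum>i\<in>S. c i * I i w) = (\<Sum>i\<in>S. c i * (I i w - Y i m w)) + (\<Sum>i\<in>S. c i * Y i m w)" for w
      by (simp add: right_diff_distrib sum_subtractf)
    have "(\<integral>\<^sup>+ w. ennreal ((\<Sum>i\<in>S. c i * I i w)\<^sup>2) \<partial>M)
        \<le> (\<integral>\<^sup>+ w. 2 * (ennreal ((\<Sum>i\<in>S. c i * (I i w - Y i m w))\<^sup>2) + ennreal ((\<Sum>i\<in>S. c i * Y i m w)\<^sup>2)) \<partial>M)"
      unfolding eq by (intro nn_integral_mono ennreal_square_add_le)
    also have "\<dots> = 2 * ((\<integral>\<^sup>+ w. ennreal ((\<Sum>i\<in>S. c i * (I i w - Y i m w))\<^sup>2) \<partial>M)
        + (\<integral>\<^sup>+ w. ennreal ((\<Sum>i\<in>S. c i * Y i m w)\<^sup>2) \<partial>M))"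
      by (simp add: nn_integral_cmult nn_integral_add)
    also have "\<dots> \<le> 2 * (?N * (\<Sum>i\<in>S. ennreal ((c i)\<^sup>2) * ?e i m) + ?N * (\<Sum>i\<in>S. ennreal ((c i)\<^sup>2) * ?d i m))"
      by (intro mult_left_mono add_mono Yle IYle) auto
    finally show ?thesis .
  qed
  have "(\<lambda>m. 2 * (?N * (\<Sum>i\<in>S. ennreal ((c i)\<^sup>2) * ?e i m) + ?N * (\<Sum>i\<in>S. ennreal ((c i)\<^sup>2) * ?d i m)))
      \<longlonglongrightarrow> 2 * (?N * (\<Sum>i\<in>S. ennreal ((c i)\<^sup>2) * 0) + ?N * (\<Sum>i\<in>S. ennreal ((c i)\<^sup>2) * 0))"
    using path int unfolding P_def Y_def
    by (intro ennreal_tendsto_cmult tendsto_add tendsto_sum) (auto simp: of_nat_less_top)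
  then have "(\<lambda>m. \<integral>\<^sup>+ w. ennreal ((\<Sum>i\<in>S. c i * I i w)\<^sup>2) \<partial>M) \<longlonglongrightarrow> 0"
    by (intro tendsto_ennreal_zero_squeeze[OF _ bound]) simp
  then have "(\<integral>\<^sup>+ w. ennreal ((\<Sum>i\<in>S. c i * I i w)\<^sup>2) \<partial>M) = 0"
    by (simp add: LIMSEQ_const_iff)
  then show ?thesis
    by (subst (asm) nn_integral_0_iff_AE) auto
qed

text \<open>The isometry makes the simple integrals Cauchy in mean square. Their limit is built as
  an almost sure limit along a subsequence, and Fatou's lemma brings the mean-square estimate back
  for the full sequence.\<close>

lemma simple_ito_converges:
  assumes jm: "jointly_measurable T M H"
    and simple: "\<And>m. simple_integrand M F T (n m) (\<tau> m) (h m)"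
    and path: "(\<lambda>m. \<integral>\<^sup>+ w. sq_integral T (\<lambda>s. H s w - simple_path (n m) (\<tau> m) (h m) s w) \<partial>M) \<longlonglongrightarrow> 0"
  obtains I where "I \<in> borel_measurable M"
    "(\<lambda>m. \<integral>\<^sup>+ w. ennreal ((I w - simple_ito B (n m) (\<tau> m) (h m) w)\<^sup>2) \<partial>M) \<longlonglongrightarrow> 0"
proof -
  define P where "P m = simple_path (n m) (\<tau> m) (h m)" for m
  define Y where "Y m = simple_ito B (n m) (\<tau> m) (h m)" for m
  define d where "d m = (\<integral>\<^sup>+ w. sq_integral T (\<lambda>s. H s w - P m s w) \<partial>M)" for m
  have d0: "d \<longlonglongrightarrow> 0" using path by (simp add: d_def[abs_def] P_def)
  have [measurable]: "Y m \<in> borel_measurable M" for m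
    unfolding Y_def by (rule simple_ito_measurable[OF simple])
  have jmP: "jointly_measurable T M (P m)" for m
    unfolding P_def by (rule simple_path_jointly_measurable[OF simple])
  note jmD = jointly_measurable_diff[OF jm jmP]
  have YY: "(\<integral>\<^sup>+ w. ennreal ((Y i w - Y j w)\<^sup>2) \<partial>M) \<le> 2 * (d i + d j)" for i j
  proof -
    have "(\<integral>\<^sup>+ w. ennreal ((Y i w - Y j w)\<^sup>2) \<partial>M) = (\<integral>\<^sup>+ w. sq_integral T (\<lambda>s. P i s w - P j s w) \<partial>M)"
      unfolding Y_def P_def by (rule simple_diff_isometry[OF simple simple])
    also have "\<dots> = (\<integral>\<^sup>+ w. sq_integral T (\<lambda>s. (H s w - P j s w) - (H s w - P i s w)) \<partial>M)"
      by (simp add: algebra_simps)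
    also have "\<dots> \<le> (\<integral>\<^sup>+ w. 2 * (sq_integral T (\<lambda>s. H s w - P j s w) + sq_integral T (\<lambda>s. H s w - P i s w)) \<partial>M)"
      by (intro nn_integral_mono sq_integral_diff_le jointly_measurable_section[OF jmD])
    also have "\<dots> = 2 * (d j + d i)"
      using sq_integral_measurable[OF jmD] by (simp add: nn_integral_cmult nn_integral_add d_def)
    finally show ?thesis by (simp add: add.commute)
  qed
  have sqint: "integrable M (\<lambda>w. (Y m w)\<^sup>2)" for m
  proof -
    have "elementary {..<n m} (\<tau> m) (\<lambda>i. \<tau> m (Suc i)) (h m)"
      using simple[of m] by (auto simp: elementary_def simple_integrand_def)
    from elementary_square_integrable[OF this] show ?thesis
      by (simp add: Y_def simple_ito_def)
  qed
  have int: "integrable M (Y m)" for m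
    by (rule square_integrable_imp_integrable[OF _ sqint]) simp
  have Y2int: "integrable M (\<lambda>w. (Y i w - Y j w)\<^sup>2)" for i j
  proof (rule Bochner_Integration.integrable_bound)
    show "integrable M (\<lambda>w. 2 * ((Y i w)\<^sup>2 + (Y j w)\<^sup>2))" using sqint by simp
    have "(x - y)\<^sup>2 \<le> 2 * (x\<^sup>2 + y\<^sup>2)" for x y :: real
      using zero_le_power2[of "x + y"] by (simp add: power2_sum power2_diff)
    then show "AE w in M. norm ((Y i w - Y j w)\<^sup>2) \<le> norm (2 * ((Y i w)\<^sup>2 + (Y j w)\<^sup>2))"
      by simp
  qed simp
  \<comment> \<open>The subsequence result works with L1 norms; |x| <= x^2 / (2 e) + e / 2 turns a
    mean square below e^2 into a mean below e.\<close>
  have "\<exists>N. \<forall>i\<ge>N. \<forall>j\<ge>N. (LINT w|M. norm (Y i w - Y j w)) < e" if "e > 0" for e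
  proof -
    have "0 < ennreal (e\<^sup>2 / 4)" using \<open>e > 0\<close> by simp
    from order_tendstoD(2)[OF d0 this] obtain N where N: "\<And>m. m \<ge> N \<Longrightarrow> d m < ennreal (e\<^sup>2 / 4)"
      by (auto simp: eventually_sequentially)
    show ?thesis
    proof (intro exI[of _ N] allI impI)
      fix i j assume "N \<le> i" "N \<le> j"
      have "ennreal (LINT w|M. (Y i w - Y j w)\<^sup>2) = (\<integral>\<^sup>+ w. ennreal ((Y i w - Y j w)\<^sup>2) \<partial>M)"
        by (intro nn_integral_eq_integral[symmetric] Y2int) auto
      also have "\<dots> \<le> 2 * (d i + d j)" by (rule YY)
      also have "\<dots> < 2 * (ennreal (e\<^sup>2 / 4) + ennreal (e\<^sup>2 / 4))"
        using N \<open>N \<le> i\<close> \<open>N \<le> j\<close> by (intro ennreal_mult_strict_left_mono add_strict_mono) auto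
      also have "\<dots> = ennreal (e\<^sup>2)"
        using ennreal_plus[of "e\<^sup>2 / 4" "e\<^sup>2 / 4"] ennreal_mult[of 2 "e\<^sup>2 / 2"] by simp
      finally have lt: "(LINT w|M. (Y i w - Y j w)\<^sup>2) < e\<^sup>2"
        by (simp add: ennreal_less_iff)
      have amgm: "\<bar>x\<bar> \<le> x\<^sup>2 / (2 * e) + e / 2" for x :: real
      proof -
        have "0 \<le> (\<bar>x\<bar> - e)\<^sup>2" by simp
        then have "2 * e * \<bar>x\<bar> \<le> x\<^sup>2 + e\<^sup>2" by (simp add: power2_diff ac_simps)
        then have "2 * e * \<bar>x\<bar> / (2 * e) \<le> (x\<^sup>2 + e\<^sup>2) / (2 * e)"
          using \<open>e > 0\<close> by (intro divide_right_mono) auto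
        then show ?thesis using \<open>e > 0\<close> by (simp add: add_divide_distrib power2_eq_square)
      qed
      have "(LINT w|M. norm (Y i w - Y j w)) \<le> (LINT w|M. (Y i w - Y j w)\<^sup>2 / (2 * e) + e / 2)"
        using int Y2int amgm by (intro integral_mono) auto
      also have "\<dots> = (LINT w|M. (Y i w - Y j w)\<^sup>2) / (2 * e) + e / 2"
        using Y2int by (simp add: prob_space)
      also have "\<dots> < e\<^sup>2 / (2 * e) + e / 2"
        using lt \<open>e > 0\<close> by (simp add: divide_strict_right_mono)
      also have "\<dots> = e" using \<open>e > 0\<close> by (simp add: power2_eq_square)
      finally show "(LINT w|M. norm (Y i w - Y j w)) < e" .
    qed
  qed
  from cauchy_L1_AE_cauchy_subseq[OF int this] obtain r where r: "strict_mono r"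
    and cau: "AE w in M. Cauchy (\<lambda>i. Y (r i) w)" by blast
  \<comment> \<open>\<open>lim\<close> is total and measurable, so \<open>I\<close> is measurable
    although the subsequence converges almost surely only.\<close>
  define I where "I w = lim (\<lambda>k. Y (r k) w)" for w
  have [measurable]: "I \<in> borel_measurable M"
    unfolding I_def[abs_def] by measurable
  have conv: "AE w in M. (\<lambda>k. Y (r k) w) \<longlonglongrightarrow> I w"
    using cau by eventually_elim (simp add: I_def Cauchy_convergent_iff convergent_LIMSEQ_iff)
  \<comment> \<open>m stays fixed while k runs: Fatou turns the bound on
    \<open>Y (r k) - Y m\<close> into one on \<open>I - Y m\<close>, and the share
    \<open>d (r k)\<close> vanishes in the limit.\<close>
  have IY: "(\<integral>\<^sup>+ w. ennreal ((I w - Y m w)\<^sup>2) \<partial>M) \<le> 2 * d m" for m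
  proof -
    have "(\<integral>\<^sup>+ w. ennreal ((I w - Y m w)\<^sup>2) \<partial>M) = (\<integral>\<^sup>+ w. liminf (\<lambda>k. ennreal ((Y (r k) w - Y m w)\<^sup>2)) \<partial>M)"
    proof (rule nn_integral_cong_AE, use conv in eventually_elim)
      fix w assume "(\<lambda>k. Y (r k) w) \<longlonglongrightarrow> I w"
      then have "(\<lambda>k. ennreal ((Y (r k) w - Y m w)\<^sup>2)) \<longlonglongrightarrow> ennreal ((I w - Y m w)\<^sup>2)"
        by (intro tendsto_ennrealI tendsto_intros)
      from lim_imp_Liminf[OF _ this] show "ennreal ((I w - Y m w)\<^sup>2) = liminf (\<lambda>k. ennreal ((Y (r k) w - Y m w)\<^sup>2))"
        by simp
    qed
    also have "\<dots> \<le> liminf (\<lambda>k. \<integral>\<^sup>+ w. ennreal ((Y (r k) w - Y m w)\<^sup>2) \<partial>M)"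
      by (rule nn_integral_liminf) auto
    also have "\<dots> \<le> liminf (\<lambda>k. 2 * (d (r k) + d m))"
      by (intro Liminf_mono always_eventually allI YY)
    also have "\<dots> = 2 * (0 + d m)"
      using LIMSEQ_subseq_LIMSEQ[OF d0 r]
      by (intro lim_imp_Liminf ennreal_tendsto_cmult tendsto_intros) (auto simp: comp_def)
    finally show ?thesis by simp
  qed
  have "(\<lambda>m. 2 * d m) \<longlonglongrightarrow> 2 * 0"
    using d0 by (intro ennreal_tendsto_cmult) auto
  then have "(\<lambda>m. \<integral>\<^sup>+ w. ennreal ((I w - Y m w)\<^sup>2) \<partial>M) \<longlonglongrightarrow> 0"
    by (intro tendsto_ennreal_zero_squeeze[OF _ IY]) simp
  then show ?thesis
    by (intro that[of I]) (simp_all add: Y_def)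
qed


section \<open>Adapted approximation of admissible processes\<close>

definition grid :: "nat \<Rightarrow> nat \<Rightarrow> real" where
  "grid m i = real i * (T / real (Suc m))"

text \<open>
  If \<open>\<integral> H\<^sup>2 \<le> A\<close> then the cell means of \<open>H\<close> are bounded by the clipping level, so clipping only
  changes them on a null set; it makes them bounded everywhere.
\<close>

definition approx_value :: "real \<Rightarrow> (real \<Rightarrow> 'a \<Rightarrow> real) \<Rightarrow> nat \<Rightarrow> nat \<Rightarrow> 'a \<Rightarrow> real" where
  "approx_value A H m i w = clip (sqrt (A / (T / real (Suc m))))
     (cell_mean T (Suc m) (\<lambda>s. H s w * indicator {0..T} s) i)"

lemma grid_step_pos: "0 < T / real (Suc m)"
  using T_pos by simp

lemma grid_step: "grid m (Suc i) - grid m i = T / real (Suc m)"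
  by (simp only: grid_def left_diff_distrib[symmetric]) simp

lemma grid_mono: "i \<le> j \<Longrightarrow> grid m i \<le> grid m j"
  unfolding grid_def using T_pos by (intro mult_right_mono) auto

lemma grid_bounds: "0 \<le> grid m i" "i \<le> Suc m \<Longrightarrow> grid m i \<le> T"
  using grid_mono[of 0 i m] grid_mono[of i "Suc m" m] by (simp_all add: grid_def)

text \<open>The averaging cell ends at \<open>grid m i\<close>, so the cut-off at T may be lowered
  to that time, where progressive measurability supplies joint measurability with respect to
  \<open>F (grid m i)\<close>.\<close>

lemma approx_value_measurable:
  assumes "progressively_measurable F T H" "i < Suc m"
  shows "approx_value A H m i \<in> borel_measurable (F (grid m i))"
proof -
  define t where "t = grid m i"
  have t: "0 \<le> t" "t \<le> T" using grid_bounds[where i = i and m = m] assms by (auto simp: t_def)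
  define J where "J = {(real i - 1) * (T / Suc m)<..t} \<inter> {0..T}"
  have [measurable]: "(\<lambda>(w, s). H s w * indicator {0..t} s) \<in> borel_measurable (F t \<Otimes>\<^sub>M lborel)"
    using jointly_measurable_progressive[OF assms(1) t] by (simp add: jointly_measurable_def)
  have "(\<lambda>p. indicator J (snd p) * (\<lambda>(w, s). H s w * indicator {0..t} s) p) \<in> borel_measurable (F t \<Otimes>\<^sub>M lborel)"
    unfolding J_def by measurable
  then have "(\<lambda>(w, s). indicator J s * (H s w * indicator {0..t} s)) \<in> borel_measurable (F t \<Otimes>\<^sub>M lborel)"
    by (simp add: case_prod_beta')
  then have [measurable]: "(\<lambda>w. \<integral>s. indicator J s * (H s w * indicator {0..t} s) \<partial>lborel) \<in> borel_measurable (F t)"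
    by (rule lborel.borel_measurable_lebesgue_integral)
  have "cell_mean T (Suc m) (\<lambda>s. H s w * indicator {0..T} s) i
      = (real (Suc m) / T) * (\<integral>s. indicator J s * (H s w * indicator {0..t} s) \<partial>lborel)" for w
  proof -
    have "(LINT s:J|lborel. H s w * indicator {0..T} s) = (\<integral>s. indicator J s * (H s w * indicator {0..t} s) \<partial>lborel)"
      unfolding set_lebesgue_integral_def
      by (intro Bochner_Integration.integral_cong) (auto simp: J_def indicator_def)
    then show ?thesis by (simp add: cell_mean_def J_def t_def grid_def)
  qed
  then show ?thesis
    unfolding approx_value_def[abs_def] t_def[symmetric] by simp
qed

lemma approx_value_simple:
  assumes "progressively_measurable F T H" "0 \<le> A"
  shows "simple_integrand M F T (Suc m) (grid m) (approx_value A H m)"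
  unfolding simple_integrand_def
proof (intro conjI allI impI)
  show "grid m i \<in> {0..T}" if "i \<le> Suc m" for i
    using that grid_bounds by simp
  show "grid m i \<le> grid m (Suc i)" for i
    by (simp add: grid_mono)
  show "approx_value A H m i \<in> borel_measurable (F (grid m i))" if "i < Suc m" for i
    using that assms by (intro approx_value_measurable)
  show "\<exists>C. \<forall>w\<in>space M. \<bar>approx_value A H m i w\<bar> \<le> C" for i
    unfolding approx_value_def using T_pos assms
    by (intro exI[of _ "sqrt (A / (T / real (Suc m)))"] ballI abs_clip_le) simp
qed

text \<open>At an outcome where the energy bound holds, clipping is inactive, so the path of the
  simple integrand is the delayed mean of the path of H and the pathwise results apply.\<close>

lemma
  assumes jm: "jointly_measurable T M H" and w: "w \<in> space M" and le: "sq_integral T (\<lambda>s. H s w) \<le> ennreal A" and "0 \<le> A"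
  shows approx_value_sum_le: "(\<Sum>i<Suc m. T / real (Suc m) * (approx_value A H m i w)\<^sup>2) \<le> A"
    and approx_path_diff_le: "sq_integral T (\<lambda>s. H s w - simple_path (Suc m) (grid m) (approx_value A H m) s w) \<le> ennreal (4 * A)"
    and approx_path_tendsto: "(\<lambda>m. sq_integral T (\<lambda>s. H s w - simple_path (Suc m) (grid m) (approx_value A H m) s w)) \<longlonglongrightarrow> 0"
    and approx_value_sum_tendsto:
      "(\<lambda>m. \<Sum>i<Suc m. T / real (Suc m) * (approx_value A H m i w)\<^sup>2) \<longlonglongrightarrow> (LINT s:{0..T}|lborel. (H s w)\<^sup>2)"
proof -
  define f where "f s = H s w * indicator {0..T} s" for s
  have [measurable]: "f \<in> borel_measurable borel"
    unfolding f_def[abs_def] by (rule jointly_measurable_section[OF jm w])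
  have Sf: "sq_integral T f \<le> ennreal A"
    using le unfolding f_def[abs_def] sq_integral_indicator .
  then have fin: "sq_integral T f < \<infinity>"
    by (rule le_less_trans) simp
  have sumle: "(\<Sum>i<Suc m. T / real (Suc m) * (cell_mean T (Suc m) f i)\<^sup>2) \<le> A" for m
  proof -
    have "ennreal (\<Sum>i<Suc m. T / real (Suc m) * (cell_mean T (Suc m) f i)\<^sup>2) \<le> ennreal A"
      using T_pos fin by (intro order_trans[OF sum_cell_mean_square_le Sf]) auto
    then show ?thesis using \<open>0 \<le> A\<close> by (simp only: ennreal_le_iff)
  qed
  \<comment> \<open>A single summand of the bounded sum is at most A, so the cell mean is at most
    sqrt (A / \<delta>) in size with \<delta> the mesh; this is where the clipping level comes
    from.\<close>
  have eq: "approx_value A H m i w = cell_mean T (Suc m) f i" if "i < Suc m" for i m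
  proof -
    have "T / real (Suc m) * (cell_mean T (Suc m) f i)\<^sup>2 \<le> (\<Sum>i<Suc m. T / real (Suc m) * (cell_mean T (Suc m) f i)\<^sup>2)"
      using that T_pos by (intro member_le_sum) auto
    then have "T / real (Suc m) * (cell_mean T (Suc m) f i)\<^sup>2 \<le> A"
      using sumle by (rule order_trans)
    then have "(cell_mean T (Suc m) f i)\<^sup>2 \<le> A / (T / real (Suc m))"
      using T_pos by (simp add: field_simps)
    then have "\<bar>cell_mean T (Suc m) f i\<bar> \<le> sqrt (A / (T / real (Suc m)))"
      by (rule real_le_rsqrt[of "\<bar>_\<bar>", simplified])
    then show ?thesis
      unfolding approx_value_def f_def[symmetric] by (rule clip_eq)
  qed
  have sums: "(\<Sum>i<Suc m. T / real (Suc m) * (approx_value A H m i w)\<^sup>2)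
      = (\<Sum>i<Suc m. T / real (Suc m) * (cell_mean T (Suc m) f i)\<^sup>2)" for m
    by (intro sum.cong refl) (simp add: eq del: of_nat_Suc)
  show "(\<Sum>i<Suc m. T / real (Suc m) * (approx_value A H m i w)\<^sup>2) \<le> A"
    unfolding sums by (rule sumle)
  have path: "simple_path (Suc m) (grid m) (approx_value A H m) s w = delayed_mean T (Suc m) f s" for m s
    unfolding simple_path_def delayed_mean_def grid_def
    by (intro sum.cong refl) (simp add: eq del: of_nat_Suc)
  have diff: "sq_integral T (\<lambda>s. H s w - simple_path (Suc m) (grid m) (approx_value A H m) s w)
      = sq_integral T (\<lambda>s. f s - delayed_mean T (Suc m) f s)" for m
    unfolding path by (intro nn_integral_cong) (simp add: f_def indicator_def)
  \<comment> \<open>The path and its approximation each have energy at most A, whence 2 (A + A) = 4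
    A.\<close>
  have "sq_integral T (\<lambda>s. f s - delayed_mean T (Suc m) f s) \<le> 2 * (sq_integral T f + sq_integral T (delayed_mean T (Suc m) f))"
    by (intro sq_integral_diff_le) auto
  also have "\<dots> \<le> 2 * (ennreal A + ennreal A)"
    using T_pos fin by (intro mult_left_mono add_mono Sf order_trans[OF delayed_mean_contraction Sf]) auto
  also have "\<dots> = ennreal (4 * A)"
    using \<open>0 \<le> A\<close> ennreal_plus[of A A] ennreal_mult[of 2 "2 * A"] by simp
  finally show "sq_integral T (\<lambda>s. H s w - simple_path (Suc m) (grid m) (approx_value A H m) s w) \<le> ennreal (4 * A)"
    unfolding diff .
  show "(\<lambda>m. sq_integral T (\<lambda>s. H s w - simple_path (Suc m) (grid m) (approx_value A H m) s w)) \<longlonglongrightarrow> 0"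
    unfolding diff by (rule delayed_mean_tendsto_L2[OF _ T_pos fin]) simp
  have "(LINT s:{0..T}|lborel. (f s)\<^sup>2) = (LINT s:{0..T}|lborel. (H s w)\<^sup>2)"
    unfolding set_lebesgue_integral_def
    by (intro Bochner_Integration.integral_cong) (auto simp: f_def indicator_def)
  with sum_cell_mean_square_tendsto[OF _ T_pos fin]
  show "(\<lambda>m. \<Sum>i<Suc m. T / real (Suc m) * (approx_value A H m i w)\<^sup>2) \<longlonglongrightarrow> (LINT s:{0..T}|lborel. (H s w)\<^sup>2)"
    unfolding sums by simp
qed

lemma admissible_bound:
  assumes "H \<in> admissible M F T"
  obtains A where "0 < A" "AE w in M. sq_integral T (\<lambda>s. H s w) \<le> ennreal A"
  using assms unfolding admissible_def by blast

lemma admissible_progressive: "H \<in> admissible M F T \<Longrightarrow> progressively_measurable F T H"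
  by (simp add: admissible_def)

lemma jointly_measurable_mono:
  assumes "jointly_measurable T (F T) H"
  shows "jointly_measurable T M H"
proof -
  have "(\<lambda>p. fst p) \<in> measurable (M \<Otimes>\<^sub>M lborel) (F T)"
    using measurable_F_M[of T "\<lambda>w. w" "F T"] T_pos by simp
  then have "(\<lambda>p. (fst p, snd p)) \<in> measurable (M \<Otimes>\<^sub>M lborel) (F T \<Otimes>\<^sub>M lborel)"
    by measurable
  from measurable_compose[OF this assms[unfolded jointly_measurable_def]] show ?thesis
    by (simp add: jointly_measurable_def case_prod_beta')
qed

lemma progressive_jointly_measurable:
  "progressively_measurable F T H \<Longrightarrow> jointly_measurable T M H"
  using T_pos by (intro jointly_measurable_mono jointly_measurable_progressive[of F T H T]) auto

text \<open>Dominated convergence over the outcomes with the constant 4 A as dominating function;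
  the deterministic bound in admissibility makes it available.\<close>

lemma approx_path_L2:
  assumes H: "progressively_measurable F T H" and "0 \<le> A" and le: "AE w in M. sq_integral T (\<lambda>s. H s w) \<le> ennreal A"
  shows "(\<lambda>m. \<integral>\<^sup>+ w. sq_integral T (\<lambda>s. H s w - simple_path (Suc m) (grid m) (approx_value A H m) s w) \<partial>M) \<longlonglongrightarrow> 0"
proof -
  note jm = progressive_jointly_measurable[OF H]
  have "(\<lambda>m. \<integral>\<^sup>+ w. sq_integral T (\<lambda>s. H s w - simple_path (Suc m) (grid m) (approx_value A H m) s w) \<partial>M)
      \<longlonglongrightarrow> (\<integral>\<^sup>+ w. 0 \<partial>M)"
  proof (rule nn_integral_dominated_convergence[where w = "\<lambda>_. ennreal (4 * A)"])
    show "(\<lambda>w. sq_integral T (\<lambda>s. H s w - simple_path (Suc m) (grid m) (approx_value A H m) s w)) \<in> borel_measurable M" for m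
      by (intro sq_integral_measurable jointly_measurable_diff jm simple_path_jointly_measurable approx_value_simple H \<open>0 \<le> A\<close>)
    show "AE w in M. sq_integral T (\<lambda>s. H s w - simple_path (Suc m) (grid m) (approx_value A H m) s w) \<le> ennreal (4 * A)" for m
      using le AE_space by eventually_elim (intro approx_path_diff_le jm \<open>0 \<le> A\<close>)
    show "AE w in M. (\<lambda>m. sq_integral T (\<lambda>s. H s w - simple_path (Suc m) (grid m) (approx_value A H m) s w)) \<longlonglongrightarrow> 0"
      using le AE_space by eventually_elim (intro approx_path_tendsto jm \<open>0 \<le> A\<close>)
  qed (auto simp: emeasure_space_1 ennreal_mult_less_top)
  then show ?thesis by simp
qed

text \<open>The integral is a \<open>SOME\<close>-choice, so its properties become accessible only
  once some version is exhibited.\<close>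

lemma admissible_has_ito:
  assumes H: "H \<in> admissible M F T"
  shows "has_ito_integral M F B T H (ito_integral M F B T H)"
proof -
  obtain A where A: "0 < A" "AE w in M. sq_integral T (\<lambda>s. H s w) \<le> ennreal A"
    using H by (rule admissible_bound)
  note prog = admissible_progressive[OF H]
  have simple: "simple_integrand M F T (Suc m) (grid m) (approx_value A H m)" for m
    using prog A by (intro approx_value_simple) auto
  have path: "(\<lambda>m. \<integral>\<^sup>+ w. sq_integral T (\<lambda>s. H s w - simple_path (Suc m) (grid m) (approx_value A H m) s w) \<partial>M) \<longlonglongrightarrow> 0"
    using prog A by (intro approx_path_L2) auto
  obtain I where I: "I \<in> borel_measurable M"
    "(\<lambda>m. \<integral>\<^sup>+ w. ennreal ((I w - simple_ito B (Suc m) (grid m) (approx_value A H m) w)\<^sup>2) \<partial>M) \<longlonglongrightarrow> 0"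
    by (rule simple_ito_converges[OF progressive_jointly_measurable[OF prog] simple path])
  have "has_ito_integral M F B T H I"
    unfolding has_ito_integral_def using simple path I by blast
  then show ?thesis
    unfolding ito_integral_def by (rule someI[of "has_ito_integral M F B T H"])
qed

lemma ito_integral_measurable: "H \<in> admissible M F T \<Longrightarrow> ito_integral M F B T H \<in> borel_measurable M"
  using admissible_has_ito by (simp add: has_ito_integral_def)

text \<open>The chosen version may stem from another approximating sequence. The limit of the
  present one is a second version, and two versions agree almost surely.\<close>

lemma approx_ito_L2:
  assumes H: "H \<in> admissible M F T" and "0 \<le> A" and le: "AE w in M. sq_integral T (\<lambda>s. H s w) \<le> ennreal A"
  shows "(\<lambda>m. \<integral>\<^sup>+ w. ennreal ((ito_integral M F B T H w - simple_ito B (Suc m) (grid m) (approx_value A H m) w)\<^sup>2) \<partial>M) \<longlonglongrightarrow> 0"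
proof -
  note prog = admissible_progressive[OF H]
  have simple: "simple_integrand M F T (Suc m) (grid m) (approx_value A H m)" for m
    using prog \<open>0 \<le> A\<close> by (intro approx_value_simple) auto
  have path: "(\<lambda>m. \<integral>\<^sup>+ w. sq_integral T (\<lambda>s. H s w - simple_path (Suc m) (grid m) (approx_value A H m) s w) \<partial>M) \<longlonglongrightarrow> 0"
    using prog assms by (intro approx_path_L2) auto
  obtain I where I: "I \<in> borel_measurable M"
    "(\<lambda>m. \<integral>\<^sup>+ w. ennreal ((I w - simple_ito B (Suc m) (grid m) (approx_value A H m) w)\<^sup>2) \<partial>M) \<longlonglongrightarrow> 0"
    by (rule simple_ito_converges[OF progressive_jointly_measurable[OF prog] simple path])
  have "has_ito_integral M F B T H I"
    unfolding has_ito_integral_def using simple path I by blast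
  \<comment> \<open>Uniqueness as a vanishing combination: the same integrand H is taken with
    coefficients 1 and -1, once for each version.\<close>
  then have "AE w in M. (\<Sum>b\<in>(UNIV :: bool set). (if b then 1 else -1) * (if b then I else ito_integral M F B T H) w) = 0"
    using admissible_has_ito[OF H] progressive_jointly_measurable[OF prog]
    by (intro ito_lincomb_zero[where H = "\<lambda>_. H"]) (auto simp: UNIV_bool)
  then have AE: "AE w in M. ito_integral M F B T H w = I w"
    by eventually_elim (simp add: UNIV_bool)
  have "(\<integral>\<^sup>+ w. ennreal ((ito_integral M F B T H w - simple_ito B (Suc m) (grid m) (approx_value A H m) w)\<^sup>2) \<partial>M)
      = (\<integral>\<^sup>+ w. ennreal ((I w - simple_ito B (Suc m) (grid m) (approx_value A H m) w)\<^sup>2) \<partial>M)" for m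
    by (rule nn_integral_cong_AE, use AE in eventually_elim) simp
  then show ?thesis using I(2) by simp
qed

text \<open>G joins the family with coefficient -1, which turns the relation into a vanishing
  combination; \<open>option\<close> provides the extra index.\<close>

lemma ito_integral_lincomb:
  assumes "finite S" and H: "\<And>i. i \<in> S \<Longrightarrow> H i \<in> admissible M F T" and G: "G \<in> admissible M F T"
    and eq: "AE w in M. AE s in lborel. s \<in> {0..T} \<longrightarrow> G s w = (\<Sum>i\<in>S. c i * H i s w)"
  shows "AE w in M. ito_integral M F B T G w = (\<Sum>i\<in>S. c i * ito_integral M F B T (H i) w)"
proof -
  define H' where "H' j = (case j of None \<Rightarrow> G | Some i \<Rightarrow> H i)" for j
  define c' where "c' j = (case j of None \<Rightarrow> -1 | Some i \<Rightarrow> c i)" for j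
  have sum: "(\<Sum>j\<in>insert None (Some ` S). x j) = x None + (\<Sum>i\<in>S. x (Some i))" for x :: "'b option \<Rightarrow> real"
    using assms(1) by (subst sum.insert) (auto simp: sum.reindex)
  have adm: "H' j \<in> admissible M F T" if "j \<in> insert None (Some ` S)" for j
    using that G H by (auto simp: H'_def)
  have "AE w in M. (\<Sum>j\<in>insert None (Some ` S). c' j * ito_integral M F B T (H' j) w) = 0"
  proof (rule ito_lincomb_zero[where H = H'])
    show "AE w in M. AE s in lborel. s \<in> {0..T} \<longrightarrow> (\<Sum>j\<in>insert None (Some ` S). c' j * H' j s w) = 0"
      using eq
    proof eventually_elim
      fix w assume "AE s in lborel. s \<in> {0..T} \<longrightarrow> G s w = (\<Sum>i\<in>S. c i * H i s w)"
      then show "AE s in lborel. s \<in> {0..T} \<longrightarrow> (\<Sum>j\<in>insert None (Some ` S). c' j * H' j s w) = 0"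
        unfolding sum by eventually_elim (simp add: c'_def H'_def)
    qed
  qed (use assms(1) adm in \<open>auto intro: admissible_has_ito progressive_jointly_measurable admissible_progressive\<close>)
  then show ?thesis
    unfolding sum by eventually_elim (simp add: c'_def H'_def)
qed

end

section \<open>Stochastic exponentials\<close>

text \<open>Completing the square shows that the exponential factor moves the mean of the normal
  density from 0 to x \<sigma>^2 and leaves its mass at 1.\<close>

lemma nn_integral_exp_normal:
  assumes "0 < \<sigma>"
  shows "(\<integral>\<^sup>+ y. ennreal (normal_density 0 \<sigma> y) * ennreal (exp (x * y - x\<^sup>2 / 2 * \<sigma>\<^sup>2)) \<partial>lborel) = 1"
proof -
  have "normal_density 0 \<sigma> y * exp (x * y - x\<^sup>2 / 2 * \<sigma>\<^sup>2) = normal_density (x * \<sigma>\<^sup>2) \<sigma> y" for y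
  proof -
    have "- (y - 0)\<^sup>2 / (2 * \<sigma>\<^sup>2) + (x * y - x\<^sup>2 / 2 * \<sigma>\<^sup>2) = - (y - x * \<sigma>\<^sup>2)\<^sup>2 / (2 * \<sigma>\<^sup>2)"
      using assms by (simp add: field_simps power2_eq_square)
    then show ?thesis
      by (simp add: normal_density_def mult_exp_exp)
  qed
  then have "(\<integral>\<^sup>+ y. ennreal (normal_density 0 \<sigma> y) * ennreal (exp (x * y - x\<^sup>2 / 2 * \<sigma>\<^sup>2)) \<partial>lborel)
      = (\<integral>\<^sup>+ y. ennreal (normal_density (x * \<sigma>\<^sup>2) \<sigma> y) \<partial>lborel)"
    by (simp add: ennreal_mult[symmetric])
  also have "\<dots> = emeasure (density lborel (normal_density (x * \<sigma>\<^sup>2) \<sigma>)) (space lborel)"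
    by (simp add: emeasure_density)
  also have "\<dots> = 1"
    using prob_space.emeasure_space_1[OF prob_space_normal_density[OF assms, of "x * \<sigma>\<^sup>2"]] by simp
  finally show ?thesis .
qed

context brownian_space
begin

text \<open>Given the past, h is a constant and the increment an independent normal variable.
  Product measures take the place of conditional expectations, and U is
  \<open>ennreal\<close>-valued so that no integrability has to be checked.\<close>

lemma exp_increment_mean:
  assumes st: "0 \<le> s" "s < t" "t \<le> T" and U: "U \<in> borel_measurable (F s)" and h: "h \<in> borel_measurable (F s)"
  shows "(\<integral>\<^sup>+ w. U w * ennreal (exp (h w * (B t w - B s w) - (h w)\<^sup>2 / 2 * (t - s))) \<partial>M) = (\<integral>\<^sup>+ w. U w \<partial>M)"
proof -
  let ?D = "\<lambda>w. B t w - B s w"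
  let ?N = "borel \<Otimes>\<^sub>M borel :: (ennreal \<times> real) measure"
  let ?X = "\<lambda>w. (U w, h w)"
  define f :: "ennreal \<times> real \<Rightarrow> real \<Rightarrow> ennreal"
    where "f p y = fst p * ennreal (exp (snd p * y - (snd p)\<^sup>2 / 2 * (t - s)))" for p y
  define \<sigma> where "\<sigma> = sqrt (t - s)"
  have \<sigma>: "0 < \<sigma>" "\<sigma>\<^sup>2 = t - s" using st by (simp_all add: \<sigma>_def)
  have [measurable]: "(\<lambda>(p, y). f p y) \<in> borel_measurable (?N \<Otimes>\<^sub>M borel)"
    unfolding f_def by measurable
  have [measurable]: "?D \<in> borel_measurable M"
    using st by (intro borel_measurable_diff B_measurable) auto
  \<comment> \<open>Independence requires both variables to take values in one type, so the
    increment is padded with a constant to match the pair (U, h).\<close>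
  let ?D' = "\<lambda>w. (0 :: ennreal, ?D w)"
  have "?X \<in> measurable (F s) ?N"
    using U h by measurable
  then have ind: "indep_var ?N ?X ?N ?D'" and [measurable]: "?X \<in> measurable M ?N"
    using st by (auto intro!: increment_indep[where g = "\<lambda>y. (0, y)"] intro: measurable_F_M[of s])
  have D: "distr M borel ?D = density lborel (\<lambda>y. ennreal (normal_density 0 \<sigma> y))"
    using distributed_distr_eq_density[OF increment_distributed[OF st]] by (simp add: \<sigma>_def cong: distr_cong)
  interpret PD: prob_space "distr M ?N ?D'"
    by (rule prob_space_distr) simp
  have "(\<integral>\<^sup>+ w. U w * ennreal (exp (h w * ?D w - (h w)\<^sup>2 / 2 * (t - s))) \<partial>M)
      = (\<integral>\<^sup>+ w. (\<lambda>(p, y). f p (snd y)) (?X w, ?D' w) \<partial>M)"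
    by (simp add: f_def)
  also have "\<dots> = (\<integral>\<^sup>+ z. (\<lambda>(p, y). f p (snd y)) z \<partial>distr M (?N \<Otimes>\<^sub>M ?N) (\<lambda>w. (?X w, ?D' w)))"
    by (rule nn_integral_distr[symmetric]) measurable
  also have "distr M (?N \<Otimes>\<^sub>M ?N) (\<lambda>w. (?X w, ?D' w)) = distr M ?N ?X \<Otimes>\<^sub>M distr M ?N ?D'"
    using ind by (simp add: indep_var_distribution_eq)
  also have "(\<integral>\<^sup>+ z. (\<lambda>(p, y). f p (snd y)) z \<partial>(distr M ?N ?X \<Otimes>\<^sub>M distr M ?N ?D'))
      = (\<integral>\<^sup>+ p. (\<integral>\<^sup>+ y. f p (snd y) \<partial>distr M ?N ?D') \<partial>distr M ?N ?X)"
    by (subst PD.nn_integral_fst[symmetric]) simp_all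
  also have "\<dots> = (\<integral>\<^sup>+ p. fst p \<partial>distr M ?N ?X)"
  proof (intro nn_integral_cong)
    fix p :: "ennreal \<times> real"
    have [measurable]: "f p \<in> borel_measurable borel"
      unfolding f_def[abs_def] by measurable
    have "(\<integral>\<^sup>+ y. f p (snd y) \<partial>distr M ?N ?D') = (\<integral>\<^sup>+ y. f p y \<partial>distr M borel ?D)"
      by (subst (1 2) nn_integral_distr) simp_all
    also have "\<dots>
        = (\<integral>\<^sup>+ y. fst p * (ennreal (normal_density 0 \<sigma> y) * ennreal (exp (snd p * y - (snd p)\<^sup>2 / 2 * \<sigma>\<^sup>2))) \<partial>lborel)"
      unfolding D f_def by (subst nn_integral_density) (auto simp: \<sigma> ac_simps)
    also have "\<dots> = fst p"
      by (subst nn_integral_cmult, simp) (simp only: nn_integral_exp_normal[OF \<sigma>(1)] mult_1_right)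
    finally show "(\<integral>\<^sup>+ y. f p (snd y) \<partial>distr M ?N ?D') = fst p" .
  qed
  also have "\<dots> = (\<integral>\<^sup>+ w. U w \<partial>M)"
    by (subst nn_integral_distr) simp_all
  finally show ?thesis .
qed

text \<open>Induction over the cells: the factors of earlier cells are known at the start of the
  last one and act as the weight U of the one-step result.\<close>

lemma exp_grid_mean:
  assumes h: "\<And>i. i < Suc m \<Longrightarrow> h i \<in> borel_measurable (F (grid m i))" and "k \<le> Suc m"
  shows "(\<integral>\<^sup>+ w. ennreal (exp (\<Sum>i<k. h i w * (B (grid m (Suc i)) w - B (grid m i) w)
      - (h i w)\<^sup>2 / 2 * (T / real (Suc m)))) \<partial>M) = 1"
  using \<open>k \<le> Suc m\<close>
proof (induction k)
  case 0
  then show ?case by (simp add: emeasure_space_1)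
next
  case (Suc k)
  define E where "E i w = h i w * (B (grid m (Suc i)) w - B (grid m i) w) - (h i w)\<^sup>2 / 2 * (T / real (Suc m))" for i w
  have meas: "E i \<in> borel_measurable (F (grid m k))" if "i < k" for i
  proof -
    have b: "0 \<le> grid m i" "grid m i \<le> grid m (Suc i)" "grid m (Suc i) \<le> grid m k" "grid m i \<le> grid m k" "grid m k \<le> T"
      using that Suc.prems grid_bounds[of m i] grid_bounds(2)[of k m] by (auto intro: grid_mono)
    have "h i \<in> borel_measurable (F (grid m k))"
      using that Suc.prems b by (intro measurable_F_mono[OF _ _ _ h]) auto
    moreover have "B (grid m i) \<in> borel_measurable (F (grid m k))" "B (grid m (Suc i)) \<in> borel_measurable (F (grid m k))"
      using b by (auto intro!: measurable_F_mono[OF _ _ _ B_measurable_F])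
    ultimately show ?thesis unfolding E_def[abs_def] by measurable
  qed
  then have U: "(\<lambda>w. ennreal (exp (\<Sum>i<k. E i w))) \<in> borel_measurable (F (grid m k))"
    by measurable
  have "grid m k < grid m (Suc k)" "grid m (Suc k) \<le> T"
    using grid_step[of m k] grid_step_pos[of m] grid_bounds(2) Suc.prems by auto
  from exp_increment_mean[OF grid_bounds(1) this U h, unfolded grid_step]
  have "(\<integral>\<^sup>+ w. ennreal (exp (\<Sum>i<k. E i w)) * ennreal (exp (E k w)) \<partial>M) = (\<integral>\<^sup>+ w. ennreal (exp (\<Sum>i<k. E i w)) \<partial>M)"
    using Suc.prems by (simp add: E_def)
  also have "\<dots> = 1"
    using Suc by (simp add: E_def)
  finally show ?case
    by (simp add: E_def exp_add ennreal_mult)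
qed

text \<open>
  The exponentials of the approximations have mean \<open>1\<close> and, as \<open>\<integral> H\<^sup>2\<close> is bounded, second moments
  bounded by \<open>e\<^sup>A\<close>; the latter prevents any loss of mass in the limit.
\<close>

lemma stochastic_exponential_mean:
  assumes H: "H \<in> admissible M F T"
  shows "(\<integral>\<^sup>+ w. ennreal (exp (ito_integral M F B T H w - 1 / 2 * (LINT s:{0..T}|lborel. (H s w)\<^sup>2))) \<partial>M) = 1"
proof -
  obtain A where "0 < A" and le: "AE w in M. sq_integral T (\<lambda>s. H s w) \<le> ennreal A"
    using H by (rule admissible_bound)
  then have "0 \<le> A" by simp
  note prog = admissible_progressive[OF H]
  note jm = progressive_jointly_measurable[OF prog]
  define h where "h = approx_value A H"
  define I where "I = ito_integral M F B T H"
  define q where "q w = (LINT s:{0..T}|lborel. (H s w)\<^sup>2)" for w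
  define Y where "Y m = simple_ito B (Suc m) (grid m) (h m)" for m
  define Q where "Q m w = (\<Sum>i<Suc m. T / real (Suc m) * (h m i w)\<^sup>2)" for m w
  define Z where "Z m w = exp (Y m w - Q m w / 2)" for m w
  define Z' where "Z' w = exp (I w - 1 / 2 * q w)" for w
  have simple: "simple_integrand M F T (Suc m) (grid m) (h m)" for m
    unfolding h_def using prog \<open>0 \<le> A\<close> by (rule approx_value_simple)
  have hF: "h m i \<in> borel_measurable (F (grid m i))" if "i < Suc m" for m i
    unfolding h_def using prog that by (rule approx_value_measurable)
  have [measurable]: "h m i \<in> borel_measurable M" if "i < Suc m" for m i
    using hF[OF that] that grid_bounds by (intro measurable_F_M[of "grid m i"]) auto
  have [measurable]: "I \<in> borel_measurable M"
    unfolding I_def using H by (rule ito_integral_measurable)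
  have [measurable]: "Y m \<in> borel_measurable M" for m
    unfolding Y_def using simple by (rule simple_ito_measurable)
  have [measurable]: "Q m \<in> borel_measurable M" for m
    unfolding Q_def[abs_def] by measurable
  have [measurable]: "Z m \<in> borel_measurable M" for m
    unfolding Z_def[abs_def] by measurable
  have Z1: "(\<integral>\<^sup>+ w. ennreal (Z m w) \<partial>M) = 1" for m
  proof -
    have "Z m w = exp (\<Sum>i<Suc m. h m i w * (B (grid m (Suc i)) w - B (grid m i) w) - (h m i w)\<^sup>2 / 2 * (T / real (Suc m)))" for w
      unfolding Z_def Y_def Q_def simple_ito_def sum_divide_distrib sum_subtractf[symmetric]
      by (intro arg_cong[where f = exp] sum.cong refl) (simp add: mult.commute)
    then show ?thesis
      using exp_grid_mean[of m "h m" "Suc m"] hF by (simp only: order_refl)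
  qed
  \<comment> \<open>Doubling the coefficients: Z^2 is the discrete exponential of 2 h, again of mean
    1, times exp Q, and Q is almost surely at most A.\<close>
  have Z2: "(\<integral>\<^sup>+ w. ennreal ((Z m w)\<^sup>2) \<partial>M) \<le> ennreal (exp A)" for m
  proof -
    let ?W = "\<lambda>w. exp (\<Sum>i<Suc m. (2 * h m i w) * (B (grid m (Suc i)) w - B (grid m i) w) - (2 * h m i w)\<^sup>2 / 2 * (T / real (Suc m)))"
    have eq: "(Z m w)\<^sup>2 = ?W w * exp (Q m w)" for w
    proof -
      have "(\<Sum>i<Suc m. (2 * h m i w) * (B (grid m (Suc i)) w - B (grid m i) w) - (2 * h m i w)\<^sup>2 / 2 * (T / real (Suc m)))
          = 2 * Y m w - 2 * Q m w"
        unfolding Y_def Q_def simple_ito_def sum_distrib_left sum_subtractf[symmetric]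
        by (intro sum.cong refl) (simp add: power2_eq_square)
      then have "?W w * exp (Q m w) = exp (2 * (Y m w - Q m w / 2))"
        by (simp add: mult_exp_exp algebra_simps)
      then show ?thesis unfolding Z_def exp_double[symmetric] by (simp only:)
    qed
    have W1: "(\<integral>\<^sup>+ w. ennreal (?W w) \<partial>M) = 1"
      using hF by (intro exp_grid_mean) auto
    have "(\<integral>\<^sup>+ w. ennreal ((Z m w)\<^sup>2) \<partial>M) \<le> (\<integral>\<^sup>+ w. ennreal (?W w) * ennreal (exp A) \<partial>M)"
    proof (rule nn_integral_mono_AE, use le AE_space in eventually_elim)
      fix w assume "sq_integral T (\<lambda>s. H s w) \<le> ennreal A" "w \<in> space M"
      then have "Q m w \<le> A"
        unfolding Q_def h_def using jm \<open>0 \<le> A\<close> by (intro approx_value_sum_le)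
      then show "ennreal ((Z m w)\<^sup>2) \<le> ennreal (?W w) * ennreal (exp A)"
        unfolding eq by (subst ennreal_mult[symmetric]) (auto intro!: ennreal_leI mult_left_mono)
    qed
    also have "\<dots> = (\<integral>\<^sup>+ w. ennreal (?W w) \<partial>M) * ennreal (exp A)"
    proof (rule nn_integral_multc)
      have "(\<lambda>w. (Z m w)\<^sup>2 / exp (Q m w)) \<in> borel_measurable M" by measurable
      then show "(\<lambda>w. ennreal (?W w)) \<in> borel_measurable M" unfolding eq by simp
    qed
    finally show ?thesis using W1 by simp
  qed
  have IY: "(\<lambda>m. \<integral>\<^sup>+ w. ennreal ((I w - Y m w)\<^sup>2) \<partial>M) \<longlonglongrightarrow> 0"
    unfolding I_def Y_def h_def using H \<open>0 \<le> A\<close> le by (rule approx_ito_L2)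
  \<comment> \<open>From n0 on the errors are below 1, which gives the integrability required for
    extracting an almost surely convergent subsequence.\<close>
  from order_tendstoD(2)[OF this, of 1] obtain n0 where
    n0: "\<And>m. m \<ge> n0 \<Longrightarrow> (\<integral>\<^sup>+ w. ennreal ((I w - Y m w)\<^sup>2) \<partial>M) < 1"
    by (auto simp: eventually_sequentially)
  define u where "u m w = (I w - Y (m + n0) w)\<^sup>2" for m w
  have u: "integrable M (u m)" for m
    using n0[of "m + n0"] by (intro integrableI_bounded) (auto simp: u_def[abs_def] intro: less_trans[OF _ ennreal_one_less_top])
  have "(\<lambda>m. ennreal (\<integral>w. norm (u m w) \<partial>M)) = (\<lambda>m. \<integral>\<^sup>+ w. ennreal ((I w - Y (m + n0) w)\<^sup>2) \<partial>M)"
    using nn_integral_eq_integral[OF u] by (simp add: u_def[abs_def])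
  with LIMSEQ_ignore_initial_segment[OF IY, of n0]
  have "(\<lambda>m. ennreal (\<integral>w. norm (u m w) \<partial>M)) \<longlonglongrightarrow> 0" by simp
  then have "(\<lambda>m. \<integral>w. norm (u m w) \<partial>M) \<longlonglongrightarrow> 0"
    by (subst (asm) ennreal_tendsto_0_iff) auto
  from tendsto_L1_AE_subseq[OF u this] obtain r where r: "strict_mono r" and ur: "AE w in M. (\<lambda>k. u (r k) w) \<longlonglongrightarrow> 0"
    by blast
  define r' where "r' k = r k + n0" for k
  have r': "strict_mono r'" using r by (auto simp: r'_def strict_mono_def)
  have conv: "AE w in M. (\<lambda>k. Z (r' k) w) \<longlonglongrightarrow> Z' w"
    using ur le AE_space
  proof eventually_elim
    fix w assume "(\<lambda>k. u (r k) w) \<longlonglongrightarrow> 0" and lew: "sq_integral T (\<lambda>s. H s w) \<le> ennreal A" "w \<in> space M"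
    then have "(\<lambda>k. sqrt ((I w - Y (r' k) w)\<^sup>2)) \<longlonglongrightarrow> sqrt 0"
      unfolding u_def r'_def by (intro tendsto_real_sqrt)
    then have "(\<lambda>k. I w - Y (r' k) w) \<longlonglongrightarrow> 0"
      by (simp add: tendsto_rabs_zero_iff)
    from tendsto_diff[OF tendsto_const[of "I w"] this] have Yc: "(\<lambda>k. Y (r' k) w) \<longlonglongrightarrow> I w"
      by simp
    have "(\<lambda>m. Q m w) \<longlonglongrightarrow> q w"
      unfolding Q_def q_def h_def using jm lew \<open>0 \<le> A\<close> by (intro approx_value_sum_tendsto)
    from LIMSEQ_subseq_LIMSEQ[OF this r'] have Qc: "(\<lambda>k. Q (r' k) w) \<longlonglongrightarrow> q w"
      by (simp add: comp_def)
    have "(\<lambda>k. exp (Y (r' k) w - Q (r' k) w / 2)) \<longlonglongrightarrow> exp (I w - q w / 2)"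
      by (intro tendsto_intros Yc Qc) simp
    then show "(\<lambda>k. Z (r' k) w) \<longlonglongrightarrow> Z' w"
      by (simp add: Z_def Z'_def)
  qed
  \<comment> \<open>Fatou's lemma gives this half; mass could still be lost.\<close>
  have le1: "(\<integral>\<^sup>+ w. ennreal (Z' w) \<partial>M) \<le> 1"
  proof -
    have "(\<integral>\<^sup>+ w. ennreal (Z' w) \<partial>M) = (\<integral>\<^sup>+ w. liminf (\<lambda>k. ennreal (Z (r' k) w)) \<partial>M)"
    proof (rule nn_integral_cong_AE, use conv in eventually_elim)
      fix w assume "(\<lambda>k. Z (r' k) w) \<longlonglongrightarrow> Z' w"
      from lim_imp_Liminf[OF _ tendsto_ennrealI[OF this]]
      show "ennreal (Z' w) = liminf (\<lambda>k. ennreal (Z (r' k) w))" by simp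
    qed
    also have "\<dots> \<le> liminf (\<lambda>k. \<integral>\<^sup>+ w. ennreal (Z (r' k) w) \<partial>M)"
      by (rule nn_integral_liminf) auto
    finally show ?thesis by (simp add: Z1 Liminf_const)
  qed
  \<comment> \<open>For the other half z <= min z N + z^2 / N: the truncated part passes to the
    limit by dominated convergence, and the second moments leave an error of at most exp A / N,
    which vanishes as N grows.\<close>
  have ge1: "1 \<le> (\<integral>\<^sup>+ w. ennreal (Z' w) \<partial>M) + ennreal (exp A / real (Suc n))" for n
  proof -
    let ?N = "real (Suc n)"
    \<comment> \<open>The limit is written with \<open>lim\<close>, whose measurability is
      immediate; it agrees with \<open>Z'\<close> almost surely.\<close>
    have [measurable]: "(\<lambda>w. lim (\<lambda>k. Z (r' k) w)) \<in> borel_measurable M"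
      by measurable
    have bound: "1 \<le> (\<integral>\<^sup>+ w. ennreal (min (Z m w) ?N) \<partial>M) + ennreal (exp A / ?N)" for m
    proof -
      have "ennreal (Z m w) \<le> ennreal (min (Z m w) ?N) + ennreal (1 / ?N) * ennreal ((Z m w)\<^sup>2)" for w
      proof -
        have "0 < Z m w" by (simp add: Z_def)
        have "Z m w \<le> min (Z m w) ?N + 1 / ?N * (Z m w)\<^sup>2"
        proof (cases "Z m w \<le> ?N")
          case False
          then have "Z m w * ?N \<le> (Z m w)\<^sup>2"
            using \<open>0 < Z m w\<close> unfolding power2_eq_square by (intro mult_left_mono) auto
          then have "Z m w \<le> (Z m w)\<^sup>2 / ?N"
            by (subst pos_le_divide_eq) auto
          then show ?thesis using False by (simp add: min_def)
        qed (simp add: min_def)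
        then have "ennreal (Z m w) \<le> ennreal (min (Z m w) ?N + 1 / ?N * (Z m w)\<^sup>2)"
          by (rule ennreal_leI)
        also have "\<dots> = ennreal (min (Z m w) ?N) + ennreal (1 / ?N) * ennreal ((Z m w)\<^sup>2)"
          using \<open>0 < Z m w\<close> by (subst ennreal_plus, simp, simp, subst ennreal_mult) simp_all
        finally show ?thesis .
      qed
      then have "(\<integral>\<^sup>+ w. ennreal (Z m w) \<partial>M)
          \<le> (\<integral>\<^sup>+ w. ennreal (min (Z m w) ?N) + ennreal (1 / ?N) * ennreal ((Z m w)\<^sup>2) \<partial>M)"
        by (intro nn_integral_mono)
      also have "\<dots> = (\<integral>\<^sup>+ w. ennreal (min (Z m w) ?N) \<partial>M) + ennreal (1 / ?N) * (\<integral>\<^sup>+ w. ennreal ((Z m w)\<^sup>2) \<partial>M)"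
        by (subst nn_integral_add) (auto simp: nn_integral_cmult)
      also have "\<dots> \<le> (\<integral>\<^sup>+ w. ennreal (min (Z m w) ?N) \<partial>M) + ennreal (1 / ?N) * ennreal (exp A)"
        by (intro add_left_mono mult_left_mono Z2) auto
      also have "ennreal (1 / ?N) * ennreal (exp A) = ennreal (exp A / ?N)"
        by (subst ennreal_mult[symmetric]) auto
      finally show ?thesis unfolding Z1 .
    qed
    have "(\<lambda>k. \<integral>\<^sup>+ w. ennreal (min (Z (r' k) w) ?N) \<partial>M) \<longlonglongrightarrow> (\<integral>\<^sup>+ w. ennreal (min (lim (\<lambda>k. Z (r' k) w)) ?N) \<partial>M)"
    proof (rule nn_integral_dominated_convergence[where w = "\<lambda>_. ennreal ?N"])
      show "AE w in M. (\<lambda>k. ennreal (min (Z (r' k) w) ?N)) \<longlonglongrightarrow> ennreal (min (lim (\<lambda>k. Z (r' k) w)) ?N)"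
        using conv
      proof eventually_elim
        fix w assume c: "(\<lambda>k. Z (r' k) w) \<longlonglongrightarrow> Z' w"
        show "(\<lambda>k. ennreal (min (Z (r' k) w) ?N)) \<longlonglongrightarrow> ennreal (min (lim (\<lambda>k. Z (r' k) w)) ?N)"
          unfolding limI[OF c] by (intro tendsto_ennrealI tendsto_min c tendsto_const)
      qed
    qed (auto intro!: AE_I2 ennreal_leI simp: emeasure_space_1 ennreal_mult_less_top simp del: of_nat_Suc)
    from tendsto_add[OF this tendsto_const[of "ennreal (exp A / ?N)"]]
    have "1 \<le> (\<integral>\<^sup>+ w. ennreal (min (lim (\<lambda>k. Z (r' k) w)) ?N) \<partial>M) + ennreal (exp A / ?N)"
      by (rule tendsto_lowerbound) (auto intro!: always_eventually bound simp del: of_nat_Suc)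
    also have "(\<integral>\<^sup>+ w. ennreal (min (lim (\<lambda>k. Z (r' k) w)) ?N) \<partial>M) \<le> (\<integral>\<^sup>+ w. ennreal (Z' w) \<partial>M)"
    proof (rule nn_integral_mono_AE, use conv in eventually_elim)
      fix w assume c: "(\<lambda>k. Z (r' k) w) \<longlonglongrightarrow> Z' w"
      show "ennreal (min (lim (\<lambda>k. Z (r' k) w)) ?N) \<le> ennreal (Z' w)"
        unfolding limI[OF c] by (intro ennreal_leI) simp
    qed
    finally show ?thesis by simp
  qed
  have "(\<lambda>n. exp A / real (Suc n)) \<longlonglongrightarrow> 0"
    by (rule LIMSEQ_Suc[OF lim_const_over_n])
  then have "(\<lambda>n. ennreal (exp A / real (Suc n))) \<longlonglongrightarrow> ennreal 0"
    by (rule tendsto_ennrealI)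
  from tendsto_add[OF tendsto_const[of "\<integral>\<^sup>+ w. ennreal (Z' w) \<partial>M"] this]
  have "1 \<le> (\<integral>\<^sup>+ w. ennreal (Z' w) \<partial>M) + ennreal 0"
    by (rule tendsto_lowerbound) (auto intro!: always_eventually ge1 simp del: of_nat_Suc)
  with le1 have "(\<integral>\<^sup>+ w. ennreal (Z' w) \<partial>M) = 1"
    by (intro antisym) simp_all
  then show ?thesis
    by (simp add: Z'_def I_def q_def)
qed

end

section \<open>The agent and the principal\<close>

text \<open>Finiteness of both energies makes the cross term integrable. Otherwise a Bochner
  integral could take its default value 0 and the expansion could fail.\<close>

lemma set_integral_square_lincomb:
  fixes f g :: "real \<Rightarrow> real"
  assumes f: "(\<lambda>s. f s * indicator {0..T} s) \<in> borel_measurable borel"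
    and g: "(\<lambda>s. g s * indicator {0..T} s) \<in> borel_measurable borel"
    and fin: "sq_integral T f < \<infinity>" "sq_integral T g < \<infinity>"
  shows "(LINT s:{0..T}|lborel. (c * f s + d * g s)\<^sup>2) = c\<^sup>2 * (LINT s:{0..T}|lborel. (f s)\<^sup>2)
    + 2 * c * d * (LINT s:{0..T}|lborel. f s * g s) + d\<^sup>2 * (LINT s:{0..T}|lborel. (g s)\<^sup>2)"
proof -
  let ?f = "\<lambda>s. f s * indicator {0..T} s" and ?g = "\<lambda>s. g s * indicator {0..T} s"
  have fin': "sq_integral T ?f < \<infinity>" "sq_integral T ?g < \<infinity>"
    using fin by (simp_all only: sq_integral_indicator)
  have ind_sq: "(\<lambda>s. indicator {0..T} s *\<^sub>R (k s * indicator {0..T} s)\<^sup>2) = (\<lambda>s. indicator {0..T} s * (k s)\<^sup>2)" for k :: "real \<Rightarrow> real"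
    by (auto simp: fun_eq_iff indicator_def)
  have f2: "integrable lborel (\<lambda>s. indicator {0..T} s * (f s)\<^sup>2)"
    using set_integrable_of_square(2)[OF f _ fin'(1), of UNIV] unfolding set_integrable_def Int_UNIV_left ind_sq by simp
  have g2: "integrable lborel (\<lambda>s. indicator {0..T} s * (g s)\<^sup>2)"
    using set_integrable_of_square(2)[OF g _ fin'(2), of UNIV] unfolding set_integrable_def Int_UNIV_left ind_sq by simp
  have fg: "integrable lborel (\<lambda>s. indicator {0..T} s * (f s * g s))"
  proof (rule Bochner_Integration.integrable_bound[OF Bochner_Integration.integrable_add[OF f2 g2]])
    have "(\<lambda>s. ?f s * ?g s) \<in> borel_measurable lborel" using f g by simp
    also have "(\<lambda>s. ?f s * ?g s) = (\<lambda>s. indicator {0..T} s * (f s * g s))"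
      by (auto simp: fun_eq_iff indicator_def)
    finally show "(\<lambda>s. indicator {0..T} s * (f s * g s)) \<in> borel_measurable lborel" .
    have "\<bar>x * y\<bar> \<le> x\<^sup>2 + y\<^sup>2" for x y :: real
    proof -
      have "2 * (\<bar>x\<bar> * \<bar>y\<bar>) \<le> x\<^sup>2 + y\<^sup>2"
        using zero_le_power2[of "\<bar>x\<bar> - \<bar>y\<bar>"] by (simp add: power2_diff)
      moreover have "0 \<le> \<bar>x\<bar> * \<bar>y\<bar>" by simp
      ultimately show ?thesis unfolding abs_mult by linarith
    qed
    then show "AE s in lborel. norm (indicator {0..T} s * (f s * g s))
        \<le> norm (indicator {0..T} s * (f s)\<^sup>2 + indicator {0..T} s * (g s)\<^sup>2)"
      by (intro AE_I2) (simp add: indicator_def)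
  qed
  have "(LINT s:{0..T}|lborel. (c * f s + d * g s)\<^sup>2)
      = (\<integral>s. c\<^sup>2 * (indicator {0..T} s * (f s)\<^sup>2) + 2 * c * d * (indicator {0..T} s * (f s * g s))
          + d\<^sup>2 * (indicator {0..T} s * (g s)\<^sup>2) \<partial>lborel)"
    unfolding set_lebesgue_integral_def
    by (intro Bochner_Integration.integral_cong refl) (simp add: power2_eq_square algebra_simps)
  also have "\<dots> = c\<^sup>2 * (LINT s:{0..T}|lborel. (f s)\<^sup>2)
    + 2 * c * d * (LINT s:{0..T}|lborel. f s * g s) + d\<^sup>2 * (LINT s:{0..T}|lborel. (g s)\<^sup>2)"
    using f2 g2 fg by (simp add: set_lebesgue_integral_def)
  finally show ?thesis .
qed

text \<open>The positive part vanishes, so the extended expectation is never infinity minus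
  infinity, and maximizing utility becomes minimizing a nonnegative integral.\<close>

lemma ext_expectation_neg_exp:
  "ext_expectation P (\<lambda>w. - exp (Z w)) = - enn2ereal (\<integral>\<^sup>+ w. ennreal (exp (Z w)) \<partial>P)"
  by (simp add: ext_expectation_def ennreal_neg zero_ennreal.rep_eq)

lemma jointly_measurable_square_integral:
  assumes "jointly_measurable t N H"
  shows "(\<lambda>w. LINT s:{0..t}|lborel. (H s w)\<^sup>2) \<in> borel_measurable N"
proof -
  have [measurable]: "(\<lambda>(w, s). H s w * indicator {0..t} s) \<in> borel_measurable (N \<Otimes>\<^sub>M lborel)"
    using assms by (simp add: jointly_measurable_def)
  have "(\<lambda>p. ((\<lambda>(w, s). H s w * indicator {0..t} s) p)\<^sup>2) \<in> borel_measurable (N \<Otimes>\<^sub>M lborel)"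
    by measurable
  also have "(\<lambda>p. ((\<lambda>(w, s). H s w * indicator {0..t} s) p)\<^sup>2) = (\<lambda>(w, s). indicator {0..t} s *\<^sub>R (H s w)\<^sup>2)"
    by (auto simp: fun_eq_iff indicator_def)
  finally show ?thesis
    unfolding set_lebesgue_integral_def by (rule lborel.borel_measurable_lebesgue_integral)
qed

context brownian_space
begin

section \<open>Linear operations on admissible processes, their Ito integrals and energies\<close>

abbreviation energy :: "(real \<Rightarrow> 'a \<Rightarrow> real) \<Rightarrow> 'a \<Rightarrow> real" where
  "energy H w \<equiv> LINT s:{0..T}|lborel. (H s w)\<^sup>2"

abbreviation ito :: "(real \<Rightarrow> 'a \<Rightarrow> real) \<Rightarrow> 'a \<Rightarrow> real" where
  "ito H \<equiv> ito_integral M F B T H"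

lemma admissible_lincomb:
  assumes "a \<in> admissible M F T" "b \<in> admissible M F T"
  shows "(\<lambda>s w. c * a s w + d * b s w) \<in> admissible M F T"
proof -
  obtain A where A: "0 < A" "AE w in M. sq_integral T (\<lambda>s. a s w) \<le> ennreal A"
    using assms(1) by (rule admissible_bound)
  obtain A' where A': "0 < A'" "AE w in M. sq_integral T (\<lambda>s. b s w) \<le> ennreal A'"
    using assms(2) by (rule admissible_bound)
  note pa = admissible_progressive[OF assms(1)] and pb = admissible_progressive[OF assms(2)]
  have prog: "progressively_measurable F T (\<lambda>s w. c * a s w + d * b s w)"
    unfolding progressively_measurable_def
  proof
    fix t assume "t \<in> {0..T}"
    then have "(\<lambda>p. c * (\<lambda>(s, w). a s w) p + d * (\<lambda>(s, w). b s w) p) \<in> borel_measurable (restrict_space borel {0..t} \<Otimes>\<^sub>M F t)"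
      using pa pb unfolding progressively_measurable_def
      by (intro borel_measurable_add borel_measurable_times borel_measurable_const) blast+
    then show "(\<lambda>(s, w). c * a s w + d * b s w) \<in> borel_measurable (restrict_space borel {0..t} \<Otimes>\<^sub>M F t)"
      by (simp add: case_prod_beta')
  qed
  \<comment> \<open>The added 1 keeps the bound strictly positive when c = d = 0.\<close>
  define C where "C = 2 * (c\<^sup>2 * A + d\<^sup>2 * A') + 1"
  have "0 < C"
    using A(1) A'(1) by (auto simp: C_def intro!: add_nonneg_pos mult_nonneg_nonneg add_nonneg_nonneg)
  have "AE w in M. sq_integral T (\<lambda>s. c * a s w + d * b s w) \<le> ennreal C"
    using A(2) A'(2) AE_space
  proof eventually_elim
    fix w assume le: "sq_integral T (\<lambda>s. a s w) \<le> ennreal A" "sq_integral T (\<lambda>s. b s w) \<le> ennreal A'" and w: "w \<in> space M"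
    note sec = jointly_measurable_section[OF progressive_jointly_measurable[OF pa] w]
      jointly_measurable_section[OF progressive_jointly_measurable[OF pb] w]
    have "sq_integral T (\<lambda>s. c * a s w + d * b s w)
        \<le> 2 * (ennreal (d\<^sup>2) * sq_integral T (\<lambda>s. b s w) + ennreal (c\<^sup>2) * sq_integral T (\<lambda>s. a s w))"
      using sq_integral_lincomb_le[of "UNIV :: bool set" "\<lambda>i. if i then (\<lambda>s. a s w) else (\<lambda>s. b s w)" T "\<lambda>i. if i then c else d"] sec
      by (simp add: UNIV_bool add.commute)
    also have "\<dots> \<le> 2 * (ennreal (d\<^sup>2) * ennreal A' + ennreal (c\<^sup>2) * ennreal A)"
      by (intro mult_left_mono add_mono le) auto
    also have "\<dots> = ennreal (2 * (d\<^sup>2 * A' + c\<^sup>2 * A))"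
    proof -
      have "ennreal (d\<^sup>2) * ennreal A' + ennreal (c\<^sup>2) * ennreal A = ennreal (d\<^sup>2 * A' + c\<^sup>2 * A)"
        using A(1) A'(1) ennreal_mult[of "d\<^sup>2" A'] ennreal_mult[of "c\<^sup>2" A] by simp
      then show ?thesis
        using A(1) A'(1) ennreal_mult[of 2 "d\<^sup>2 * A' + c\<^sup>2 * A"] by (simp del: ennreal_plus)
    qed
    also have "\<dots> \<le> ennreal C"
      by (intro ennreal_leI) (simp add: C_def)
    finally show "sq_integral T (\<lambda>s. c * a s w + d * b s w) \<le> ennreal C" .
  qed
  with prog \<open>0 < C\<close> show ?thesis
    unfolding admissible_def by blast
qed

lemma admissible_scale:
  "a \<in> admissible M F T \<Longrightarrow> (\<lambda>s w. c * a s w) \<in> admissible M F T"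
  using admissible_lincomb[of a a c 0] by simp

lemma admissible_deterministic:
  assumes k: "k \<in> borel_measurable (restrict_space borel {0..T})" and fin: "sq_integral T k < \<infinity>"
  shows "(\<lambda>s w. k s) \<in> admissible M F T"
proof -
  have "(\<lambda>(s, w). k s) \<in> borel_measurable (restrict_space borel {0..t} \<Otimes>\<^sub>M F t)" if "t \<in> {0..T}" for t
  proof -
    have "k \<in> borel_measurable (restrict_space borel {0..t})"
      by (rule measurable_restrict_mono[OF k]) (use that in auto)
    from measurable_compose[OF measurable_fst this] show ?thesis
      by (simp add: case_prod_beta')
  qed
  moreover have "\<exists>A>0. sq_integral T k \<le> ennreal A"
  proof (cases "sq_integral T k")
    case (real x)
    then show ?thesis by (intro exI[of _ "x + 1"]) (auto intro: ennreal_leI)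
  qed (use fin in simp)
  ultimately show ?thesis
    by (auto simp: admissible_def progressively_measurable_def)
qed

lemma ito_lincomb:
  assumes "a \<in> admissible M F T" "b \<in> admissible M F T"
  shows "AE w in M. ito (\<lambda>s w. c * a s w + d * b s w) w = c * ito a w + d * ito b w"
proof -
  have "AE w in M. ito (\<lambda>s w. c * a s w + d * b s w) w
      = (\<Sum>i\<in>(UNIV :: bool set). (if i then c else d) * ito (if i then a else b) w)"
    using assms by (intro ito_integral_lincomb admissible_lincomb) (auto simp: UNIV_bool)
  then show ?thesis
    by eventually_elim (simp add: UNIV_bool)
qed

text \<open>Serves processes known only up to null sets, such as the agent's chosen effort: integral
  and energy follow from an almost everywhere relation.\<close>

lemma ito_scale_cong:
  assumes "a \<in> admissible M F T" "b \<in> admissible M F T"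
    and eq: "AE w in M. AE s in lborel. s \<in> {0..T} \<longrightarrow> a s w = c * b s w"
  shows "AE w in M. ito a w = c * ito b w" "AE w in M. energy a w = c\<^sup>2 * energy b w"
proof -
  have "AE w in M. ito a w = (\<Sum>i\<in>{()}. c * ito b w)"
    using assms by (intro ito_integral_lincomb[where H = "\<lambda>_. b"]) auto
  then show "AE w in M. ito a w = c * ito b w" by simp
  show "AE w in M. energy a w = c\<^sup>2 * energy b w"
    using eq AE_space
  proof eventually_elim
    fix w assume "AE s in lborel. s \<in> {0..T} \<longrightarrow> a s w = c * b s w" and w: "w \<in> space M"
    then have *: "AE s in lborel. (a s w * indicator {0..T} s)\<^sup>2 = c\<^sup>2 * (b s w * indicator {0..T} s)\<^sup>2"
      by (auto elim!: eventually_mono simp: power_mult_distrib indicator_def)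
    have ind: "energy H w = (\<integral>s. (H s w * indicator {0..T} s)\<^sup>2 \<partial>lborel)" for H :: "real \<Rightarrow> 'a \<Rightarrow> real"
      unfolding set_lebesgue_integral_def by (intro Bochner_Integration.integral_cong) (auto simp: indicator_def)
    note sec = jointly_measurable_section[OF progressive_jointly_measurable[OF admissible_progressive[OF assms(1)]] w]
      jointly_measurable_section[OF progressive_jointly_measurable[OF admissible_progressive[OF assms(2)]] w]
    have "energy a w = (\<integral>s. c\<^sup>2 * (b s w * indicator {0..T} s)\<^sup>2 \<partial>lborel)"
      unfolding ind using sec * by (intro integral_cong_AE) auto
    then show "energy a w = c\<^sup>2 * energy b w"
      unfolding ind by simp
  qed
qed

lemma energy_measurable: "a \<in> admissible M F T \<Longrightarrow> energy a \<in> borel_measurable M"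
  by (intro jointly_measurable_square_integral progressive_jointly_measurable admissible_progressive)

text \<open>The quantifiers over c and d stand inside \<open>AE\<close>, so that one exceptional set
  serves all pairs of coefficients.\<close>

lemma energy_lincomb:
  assumes "a \<in> admissible M F T" "b \<in> admissible M F T"
  shows "AE w in M. \<forall>c d. energy (\<lambda>s w. c * a s w + d * b s w) w
    = c\<^sup>2 * energy a w + 2 * c * d * (LINT s:{0..T}|lborel. a s w * b s w) + d\<^sup>2 * energy b w"
proof -
  obtain A where A: "AE w in M. sq_integral T (\<lambda>s. a s w) \<le> ennreal A"
    using assms(1) by (rule admissible_bound)
  obtain A' where A': "AE w in M. sq_integral T (\<lambda>s. b s w) \<le> ennreal A'"
    using assms(2) by (rule admissible_bound)
  note jm = progressive_jointly_measurable[OF admissible_progressive[OF assms(1)]]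
    progressive_jointly_measurable[OF admissible_progressive[OF assms(2)]]
  show ?thesis
    using A A' AE_space
  proof eventually_elim
    fix w assume "sq_integral T (\<lambda>s. a s w) \<le> ennreal A" "sq_integral T (\<lambda>s. b s w) \<le> ennreal A'" and w: "w \<in> space M"
    then have "sq_integral T (\<lambda>s. a s w) < \<infinity>" "sq_integral T (\<lambda>s. b s w) < \<infinity>"
      by (auto intro: le_less_trans)
    then show "\<forall>c d. energy (\<lambda>s w. c * a s w + d * b s w) w
        = c\<^sup>2 * energy a w + 2 * c * d * (LINT s:{0..T}|lborel. a s w * b s w) + d\<^sup>2 * energy b w"
      using w by (intro allI set_integral_square_lincomb jointly_measurable_section[OF jm(1)] jointly_measurable_section[OF jm(2)])
  qed
qed

text \<open>The bound in admissibility rules out that the energy is 0 merely as the default value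
  for a square that is not integrable.\<close>

lemma energy_zero_AE:
  assumes "a \<in> admissible M F T" and "AE w in M. energy a w = 0"
  shows "AE w in M. AE s in lborel. s \<in> {0..T} \<longrightarrow> a s w = 0"
proof -
  obtain A where A: "AE w in M. sq_integral T (\<lambda>s. a s w) \<le> ennreal A"
    using assms(1) by (rule admissible_bound)
  note jm = progressive_jointly_measurable[OF admissible_progressive[OF assms(1)]]
  show ?thesis
    using A assms(2) AE_space
  proof eventually_elim
    fix w assume le: "sq_integral T (\<lambda>s. a s w) \<le> ennreal A" and zero: "energy a w = 0" and w: "w \<in> space M"
    let ?f = "\<lambda>s. a s w * indicator {0..T} s"
    have [measurable]: "?f \<in> borel_measurable borel"
      by (rule jointly_measurable_section[OF jm w])
    have fin: "sq_integral T ?f < \<infinity>"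
      unfolding sq_integral_indicator using le by (rule le_less_trans) simp
    have "(LINT s:{0..T}|lborel. (?f s)\<^sup>2) = energy a w"
      unfolding set_lebesgue_integral_def by (intro Bochner_Integration.integral_cong) (auto simp: indicator_def)
    then have "sq_integral T ?f = 0"
      using nn_integral_square_eq[OF _ fin] zero by simp
    then have "AE s in lborel. ennreal ((?f s)\<^sup>2) * indicator {0..T} s = 0"
      by (subst (asm) nn_integral_0_iff_AE) auto
    then show "AE s in lborel. s \<in> {0..T} \<longrightarrow> a s w = 0"
      by eventually_elim auto
  qed
qed

text \<open>
  Completing the square in the exponent brings the expected utilities of both the agent and the
  principal into this form.
\<close>

lemma weighted_exponential:
  assumes a: "a \<in> admissible M F T" and h: "h \<in> admissible M F T" and g: "g \<in> admissible M F T"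
    and Z: "Z \<in> borel_measurable M" and "0 < \<theta>"
    and eq: "AE w in M. ito a w - 1 / 2 * energy a w + Z w = ito h w - 1 / 2 * energy h w + r + \<theta> * energy g w"
  shows "ennreal (exp r) \<le> (\<integral>\<^sup>+ w. ennreal (exp (Z w)) \<partial>effort_measure M F B T a)"
    and "(\<integral>\<^sup>+ w. ennreal (exp (Z w)) \<partial>effort_measure M F B T a) = ennreal (exp r)
      \<longleftrightarrow> (AE w in M. AE s in lborel. s \<in> {0..T} \<longrightarrow> g s w = 0)"
proof -
  have [measurable]: "ito a \<in> borel_measurable M" "ito h \<in> borel_measurable M" "energy a \<in> borel_measurable M"
      "energy h \<in> borel_measurable M" "energy g \<in> borel_measurable M" "Z \<in> borel_measurable M"
    using a h g Z by (auto intro: ito_integral_measurable energy_measurable)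
  define E where "E w = exp (ito h w - 1 / 2 * energy h w)" for w
  \<comment> \<open>D is the excess over exp r, measured in units of exp r: exp (\<theta> energy) is
    split into 1 and a nonnegative remainder, and the weight E has mean 1.\<close>
  define D where "D = (\<integral>\<^sup>+ w. ennreal (E w) * ennreal (exp (\<theta> * energy g w) - 1) \<partial>M)"
  have [measurable]: "E \<in> borel_measurable M"
    unfolding E_def[abs_def] by measurable
  have g0: "0 \<le> energy g w" for w
    unfolding set_lebesgue_integral_def by (intro Bochner_Integration.integral_nonneg) simp
  have E1: "(\<integral>\<^sup>+ w. ennreal (E w) \<partial>M) = 1"
    unfolding E_def by (rule stochastic_exponential_mean[OF h])
  have "(\<integral>\<^sup>+ w. ennreal (exp (Z w)) \<partial>effort_measure M F B T a)
      = (\<integral>\<^sup>+ w. ennreal (exp (ito a w - 1 / 2 * energy a w)) * ennreal (exp (Z w)) \<partial>M)"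
    unfolding effort_measure_def by (rule nn_integral_density) measurable
  also have "\<dots> = (\<integral>\<^sup>+ w. ennreal (exp r) * (ennreal (E w) + ennreal (E w) * ennreal (exp (\<theta> * energy g w) - 1)) \<partial>M)"
  proof (rule nn_integral_cong_AE, use eq in eventually_elim)
    fix w
    assume "ito a w - 1 / 2 * energy a w + Z w = ito h w - 1 / 2 * energy h w + r + \<theta> * energy g w"
    then have "exp (ito a w - 1 / 2 * energy a w) * exp (Z w) = exp r * (E w * exp (\<theta> * energy g w))"
      unfolding E_def mult_exp_exp by (simp add: algebra_simps)
    moreover have "1 \<le> exp (\<theta> * energy g w)"
      using g0[of w] \<open>0 < \<theta>\<close> by simp
    then have "ennreal (E w) + ennreal (E w) * ennreal (exp (\<theta> * energy g w) - 1) = ennreal (E w * exp (\<theta> * energy g w))"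
      by (subst ennreal_mult[symmetric], simp add: E_def, simp, subst ennreal_plus[symmetric])
         (simp_all add: E_def algebra_simps)
    ultimately show "ennreal (exp (ito a w - 1 / 2 * energy a w)) * ennreal (exp (Z w))
        = ennreal (exp r) * (ennreal (E w) + ennreal (E w) * ennreal (exp (\<theta> * energy g w) - 1))"
      by (simp add: ennreal_mult[symmetric] E_def)
  qed
  also have "\<dots> = ennreal (exp r) * (1 + D)"
    by (subst nn_integral_cmult, simp, subst nn_integral_add) (auto simp: E1 D_def)
  finally have val: "(\<integral>\<^sup>+ w. ennreal (exp (Z w)) \<partial>effort_measure M F B T a) = ennreal (exp r) * (1 + D)" .
  have "ennreal (exp r) * 1 \<le> ennreal (exp r) * (1 + D)"
    by (intro mult_left_mono) auto
  then show "ennreal (exp r) \<le> (\<integral>\<^sup>+ w. ennreal (exp (Z w)) \<partial>effort_measure M F B T a)"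
    unfolding val by simp
  \<comment> \<open>D may be infinite, and then equality fails; a finite D must be 0 because exp r
    is positive and finite.\<close>
  have "ennreal (exp r) * (1 + D) = ennreal (exp r) \<longleftrightarrow> D = 0"
  proof (cases D)
    case (real x)
    then have "ennreal (exp r) * (1 + D) = ennreal (exp r * (1 + x))"
      by (simp add: ennreal_mult)
    then show ?thesis using real by (simp add: ennreal_inj)
  next
    case top
    then show ?thesis by (simp add: ennreal_mult_top)
  qed
  also have "D = 0 \<longleftrightarrow> (AE w in M. ennreal (E w) * ennreal (exp (\<theta> * energy g w) - 1) = 0)"
    unfolding D_def by (rule nn_integral_0_iff_AE) measurable
  also have "\<dots> \<longleftrightarrow> (AE w in M. energy g w = 0)"
  proof (rule eventually_cong)
    show "AE w in M. True" by simp
    fix w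
    define y where "y = energy g w"
    have "0 \<le> y" unfolding y_def by (rule g0)
    have "ennreal (E w) \<noteq> 0" by (simp add: E_def)
    then have "ennreal (E w) * ennreal (exp (\<theta> * y) - 1) = 0 \<longleftrightarrow> exp (\<theta> * y) - 1 \<le> 0"
      unfolding mult_eq_0_iff ennreal_eq_0_iff by blast
    also have "\<dots> \<longleftrightarrow> \<theta> * y \<le> 0" by simp
    also have "\<dots> \<longleftrightarrow> y = 0" using \<open>0 \<le> y\<close> \<open>0 < \<theta>\<close> by (auto simp: mult_le_0_iff)
    finally show "ennreal (E w) * ennreal (exp (\<theta> * energy g w) - 1) = 0 \<longleftrightarrow> energy g w = 0"
      unfolding y_def .
  qed
  also have "\<dots> \<longleftrightarrow> (AE w in M. AE s in lborel. s \<in> {0..T} \<longrightarrow> g s w = 0)"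
  proof
    assume "AE w in M. AE s in lborel. s \<in> {0..T} \<longrightarrow> g s w = 0"
    then have "AE w in M. energy g w = 0\<^sup>2 * energy g w"
      using g by (intro ito_scale_cong(2)) auto
    then show "AE w in M. energy g w = 0" by simp
  qed (rule energy_zero_AE[OF g])
  finally show "(\<integral>\<^sup>+ w. ennreal (exp (Z w)) \<partial>effort_measure M F B T a) = ennreal (exp r)
      \<longleftrightarrow> (AE w in M. AE s in lborel. s \<in> {0..T} \<longrightarrow> g s w = 0)"
    unfolding val .
qed


text \<open>Makes explicit the data y and \<beta> that \<open>contracts\<close> quantifies
  existentially, with measurability in \<open>M\<close>. The bound y \<ge> y0 is left to the final
  comparison of contracts.\<close>

definition contract_of :: "real \<Rightarrow> real \<Rightarrow> real \<Rightarrow> (real \<Rightarrow> 'a \<Rightarrow> real) \<Rightarrow> ('a \<Rightarrow> real) \<Rightarrow> bool" where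
  "contract_of \<gamma>A \<kappa> y \<beta> \<xi> \<longleftrightarrow> \<xi> \<in> borel_measurable M \<and> \<beta> \<in> admissible M F T \<and>
     (AE w in M. \<xi> w = y + (LINT s:{0..T}|lborel. fstar \<gamma>A \<kappa> (\<beta> s w)) + ito \<beta> w)"

lemma contract_of_eq:
  assumes "contract_of \<gamma>A \<kappa> y \<beta> \<xi>" "0 < \<kappa>"
  shows "AE w in M. \<xi> w = y + (\<kappa> * \<gamma>A - 1) / (2 * \<kappa>) * energy \<beta> w + ito \<beta> w"
proof -
  have "(LINT s:{0..T}|lborel. fstar \<gamma>A \<kappa> (\<beta> s w)) = (\<kappa> * \<gamma>A - 1) / (2 * \<kappa>) * energy \<beta> w" for w
    unfolding fstar_eq[OF assms(2)] by (rule set_integral_mult_right)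
  then show ?thesis
    using assms(1) by (simp add: contract_of_def)
qed

section \<open>The agent's best response\<close>

lemma agent_objective_eq:
  "agent_objective M F B T \<gamma>A \<kappa> \<xi> a = - enn2ereal (\<integral>\<^sup>+ w. ennreal (exp (- \<gamma>A * (\<xi> w - \<kappa> / 2 * energy a w))) \<partial>effort_measure M F B T a)"
proof -
  have "(LINT s:{0..T}|lborel. effort_cost \<kappa> (a s w)) = \<kappa> / 2 * energy a w" for w
    unfolding effort_cost_def set_integral_mult_right[symmetric] by simp
  then show ?thesis
    by (simp only: agent_objective_def cara_utility_def ext_expectation_neg_exp)
qed

text \<open>The coefficient of \<open>fstar\<close> is the one for which the \<beta>^2 terms match:
  multiplied by -\<gamma>A it gives -\<gamma>A^2/2, the share of the stochastic exponential of a -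
  \<gamma>A \<beta>, plus \<gamma>A/(2 \<kappa>), the share of the weighted square of a -
  \<beta>/\<kappa>.\<close>

lemma agent_weighted:
  assumes \<xi>: "contract_of \<gamma>A \<kappa> y \<beta> \<xi>" and "0 < \<kappa>" "0 < \<gamma>A" and a: "a \<in> admissible M F T"
  defines "V \<equiv> \<integral>\<^sup>+ w. ennreal (exp (- \<gamma>A * (\<xi> w - \<kappa> / 2 * energy a w))) \<partial>effort_measure M F B T a"
  shows "ennreal (exp (- \<gamma>A * y)) \<le> V"
    and "V = ennreal (exp (- \<gamma>A * y)) \<longleftrightarrow> (AE w in M. AE s in lborel. s \<in> {0..T} \<longrightarrow> a s w = \<beta> s w / \<kappa>)"
proof -
  have \<beta>: "\<beta> \<in> admissible M F T" and \<xi>M: "\<xi> \<in> borel_measurable M"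
    using \<xi> by (auto simp: contract_of_def)
  let ?h = "\<lambda>s w. 1 * a s w + (- \<gamma>A) * \<beta> s w"
  let ?g = "\<lambda>s w. 1 * a s w + (- 1 / \<kappa>) * \<beta> s w"
  have h: "?h \<in> admissible M F T" and g: "?g \<in> admissible M F T"
    by (intro admissible_lincomb a \<beta>)+
  have Z: "(\<lambda>w. - \<gamma>A * (\<xi> w - \<kappa> / 2 * energy a w)) \<in> borel_measurable M"
    using \<xi>M energy_measurable[OF a] by measurable
  have "0 < \<gamma>A * \<kappa> / 2" using \<open>0 < \<kappa>\<close> \<open>0 < \<gamma>A\<close> by simp
  have "AE w in M. ito a w - 1 / 2 * energy a w + (- \<gamma>A * (\<xi> w - \<kappa> / 2 * energy a w))
      = ito ?h w - 1 / 2 * energy ?h w + (- \<gamma>A * y) + \<gamma>A * \<kappa> / 2 * energy ?g w"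
    using contract_of_eq[OF \<xi> \<open>0 < \<kappa>\<close>] ito_lincomb[OF a \<beta>, of 1 "- \<gamma>A"] energy_lincomb[OF a \<beta>]
  proof eventually_elim
    case (elim w)
    \<comment> \<open>Naming the energies and m = 1/\<kappa> reduces the claim to a polynomial
      identity modulo \<kappa> m = 1.\<close>
    define a2 where "a2 = energy a w"
    define b2 where "b2 = energy \<beta> w"
    define ab where "ab = (LINT s:{0..T}|lborel. a s w * \<beta> s w)"
    define m where "m = 1 / \<kappa>"
    have km: "\<kappa> * m = 1" and half: "(\<kappa> * \<gamma>A - 1) / (2 * \<kappa>) = (\<gamma>A - m) / 2"
      using \<open>0 < \<kappa>\<close> by (simp_all add: m_def field_simps)
    have hh: "energy ?h w = a2 - 2 * \<gamma>A * ab + \<gamma>A\<^sup>2 * b2"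
      using elim(3)[rule_format, of 1 "- \<gamma>A"] by (simp add: a2_def b2_def ab_def)
    have gg0: "energy ?g w = a2 - 2 * m * ab + m\<^sup>2 * b2"
      using elim(3)[rule_format, of 1 "- 1 / \<kappa>"] by (simp add: a2_def b2_def ab_def m_def power_divide)
    have "\<gamma>A * \<kappa> / 2 * energy ?g w = \<gamma>A * \<kappa> / 2 * a2 - \<gamma>A * (\<kappa> * m) * ab + \<gamma>A * (\<kappa> * m) * m / 2 * b2"
      unfolding gg0 by (simp add: algebra_simps power2_eq_square)
    then have gg: "\<gamma>A * \<kappa> / 2 * energy ?g w = \<gamma>A * \<kappa> / 2 * a2 - \<gamma>A * ab + \<gamma>A * m / 2 * b2"
      unfolding km by simp
    have e: "\<xi> w = y + (\<gamma>A - m) / 2 * b2 + ito \<beta> w" "ito ?h w = 1 * ito a w + (- \<gamma>A) * ito \<beta> w"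
      using elim(1,2) unfolding half b2_def[symmetric] by simp_all
    show ?case
      unfolding gg hh e a2_def[symmetric] by (simp add: field_simps power2_eq_square)
  qed
  note * = weighted_exponential[OF a h g Z \<open>0 < \<gamma>A * \<kappa> / 2\<close> this]
  show "ennreal (exp (- \<gamma>A * y)) \<le> V"
    unfolding V_def by (rule *(1))
  have "?g s w = 0 \<longleftrightarrow> a s w = \<beta> s w / \<kappa>" for s w
    by auto
  then show "V = ennreal (exp (- \<gamma>A * y)) \<longleftrightarrow> (AE w in M. AE s in lborel. s \<in> {0..T} \<longrightarrow> a s w = \<beta> s w / \<kappa>)"
    using *(2) unfolding V_def by simp
qed

text \<open>The sharp bound on the disutility involves the contract only through y, so \<beta> has
  no influence on the agent's value and alone decides the effort. The equality case yields
  uniqueness up to null sets.\<close>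

lemma
  assumes \<xi>: "contract_of \<gamma>A \<kappa> y \<beta> \<xi>" and "0 < \<kappa>" "0 < \<gamma>A"
  shows agent_value_contract: "agent_value M F B T \<gamma>A \<kappa> \<xi> = ereal (cara_utility \<gamma>A y)"
    and optimal_effort_iff: "optimal_effort M F B T \<gamma>A \<kappa> \<xi> a
      \<longleftrightarrow> a \<in> admissible M F T \<and> (AE w in M. AE s in lborel. s \<in> {0..T} \<longrightarrow> a s w = \<beta> s w / \<kappa>)"
proof -
  have \<beta>: "(\<lambda>s w. 1 / \<kappa> * \<beta> s w) \<in> admissible M F T"
    using \<xi> by (intro admissible_scale) (simp add: contract_of_def)
  have val: "ereal (cara_utility \<gamma>A y) = - enn2ereal (ennreal (exp (- \<gamma>A * y)))"
    by (simp add: cara_utility_def enn2ereal_ennreal)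
  have le: "agent_objective M F B T \<gamma>A \<kappa> \<xi> a \<le> ereal (cara_utility \<gamma>A y)" if "a \<in> admissible M F T" for a
    using agent_weighted(1)[OF assms that]
    by (simp only: agent_objective_eq val ereal_minus_le_minus less_eq_ennreal.rep_eq)
  have iff: "agent_objective M F B T \<gamma>A \<kappa> \<xi> a = ereal (cara_utility \<gamma>A y)
      \<longleftrightarrow> (AE w in M. AE s in lborel. s \<in> {0..T} \<longrightarrow> a s w = \<beta> s w / \<kappa>)" if "a \<in> admissible M F T" for a
  proof -
    have "agent_objective M F B T \<gamma>A \<kappa> \<xi> a = ereal (cara_utility \<gamma>A y)
        \<longleftrightarrow> (\<integral>\<^sup>+ w. ennreal (exp (- \<gamma>A * (\<xi> w - \<kappa> / 2 * energy a w))) \<partial>effort_measure M F B T a) = ennreal (exp (- \<gamma>A * y))"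
      by (simp only: agent_objective_eq val ereal_uminus_eq_iff enn2ereal_inject)
    then show ?thesis
      using agent_weighted(2)[OF assms that] by blast
  qed
  have "agent_objective M F B T \<gamma>A \<kappa> \<xi> (\<lambda>s w. 1 / \<kappa> * \<beta> s w) = ereal (cara_utility \<gamma>A y)"
    unfolding iff[OF \<beta>] by simp
  then show val_eq: "agent_value M F B T \<gamma>A \<kappa> \<xi> = ereal (cara_utility \<gamma>A y)"
    unfolding agent_value_def using le \<beta>
    by (intro antisym SUP_least) (auto intro: SUP_upper2)
  show "optimal_effort M F B T \<gamma>A \<kappa> \<xi> a
      \<longleftrightarrow> a \<in> admissible M F T \<and> (AE w in M. AE s in lborel. s \<in> {0..T} \<longrightarrow> a s w = \<beta> s w / \<kappa>)"
    unfolding optimal_effort_def val_eq using iff by blast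
qed

text \<open>\<open>best_effort\<close> is a \<open>SOME\<close>-choice; exhibiting one optimal
  effort makes the chosen one optimal.\<close>

lemma
  assumes \<xi>: "contract_of \<gamma>A \<kappa> y \<beta> \<xi>" and "0 < \<kappa>" "0 < \<gamma>A"
  shows optimal_effort_scaled: "optimal_effort M F B T \<gamma>A \<kappa> \<xi> (\<lambda>s w. \<beta> s w / \<kappa>)"
    and best_effort_optimal: "optimal_effort M F B T \<gamma>A \<kappa> \<xi> (best_effort M F B T \<gamma>A \<kappa> \<xi>)"
proof -
  show opt: "optimal_effort M F B T \<gamma>A \<kappa> \<xi> (\<lambda>s w. \<beta> s w / \<kappa>)"
    unfolding optimal_effort_iff[OF assms]
    using \<xi> admissible_scale[of \<beta> "1 / \<kappa>"] by (simp add: contract_of_def)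
  show "optimal_effort M F B T \<gamma>A \<kappa> \<xi> (best_effort M F B T \<gamma>A \<kappa> \<xi>)"
    unfolding best_effort_def by (rule someI[of "optimal_effort M F B T \<gamma>A \<kappa> \<xi>", OF opt])
qed

text \<open>
  With \<open>D = \<gamma>A + \<gamma>P + 1/\<kappa>\<close> and \<open>c = (\<gamma>P + 1/\<kappa>)/D\<close>, the part of the exponent that is quadratic in
  \<open>(\<beta>, k)\<close> equals \<open>\<gamma>P D/2 (\<beta> - c k)\<^sup>2 + (\<gamma>P\<^sup>2 - \<gamma>P D c\<^sup>2)/2 k\<^sup>2\<close>.
\<close>

lemma principal_objective_contract:
  assumes \<xi>: "contract_of \<gamma>A \<kappa> y \<beta> \<xi>" and pos: "0 < \<kappa>" "0 < \<gamma>A" "0 < \<gamma>P"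
    and k: "(\<lambda>s w. k s) \<in> admissible M F T"
    and X: "X T \<in> borel_measurable M" "AE w in M. X T w = x0 + ito (\<lambda>s w. k s) w"
    and c: "c = (\<gamma>P + 1 / \<kappa>) / (\<gamma>A + \<gamma>P + 1 / \<kappa>)"
  defines "r \<equiv> \<gamma>P * y - \<gamma>P * x0 + (\<gamma>P\<^sup>2 - \<gamma>P * (\<gamma>A + \<gamma>P + 1 / \<kappa>) * c\<^sup>2) / 2 * (LINT s:{0..T}|lborel. (k s)\<^sup>2)"
  shows "principal_objective M F B T X \<gamma>P \<gamma>A \<kappa> \<xi> \<le> ereal (- exp r)"
    and "(AE w in M. AE s in lborel. s \<in> {0..T} \<longrightarrow> \<beta> s w = c * k s)
      \<Longrightarrow> principal_objective M F B T X \<gamma>P \<gamma>A \<kappa> \<xi> = ereal (- exp r)"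
proof -
  define a where "a = best_effort M F B T \<gamma>A \<kappa> \<xi>"
  define D where "D = \<gamma>A + \<gamma>P + 1 / \<kappa>"
  have "0 < D" using pos by (simp add: D_def add_pos_pos)
  have \<beta>: "\<beta> \<in> admissible M F T" and \<xi>M: "\<xi> \<in> borel_measurable M"
    using \<xi> by (auto simp: contract_of_def)
  \<comment> \<open>The chosen effort equals \<beta>/\<kappa> only almost everywhere, which is
    enough for its integral and energy.\<close>
  have a: "a \<in> admissible M F T" and ab: "AE w in M. AE s in lborel. s \<in> {0..T} \<longrightarrow> a s w = 1 / \<kappa> * \<beta> s w"
    using best_effort_optimal[OF \<xi> pos(1,2)] unfolding optimal_effort_iff[OF \<xi> pos(1,2)] a_def by simp_all
  let ?k = "\<lambda>s w. k s"
  \<comment> \<open>The coefficient collects \<beta>/\<kappa> from the change of measure, \<gamma>P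
    \<beta> from the payment and -\<gamma>P k from the output.\<close>
  let ?h = "\<lambda>s w. (\<gamma>P + 1 / \<kappa>) * \<beta> s w + (- \<gamma>P) * k s"
  let ?g = "\<lambda>s w. 1 * \<beta> s w + (- c) * k s"
  have h: "?h \<in> admissible M F T" and g: "?g \<in> admissible M F T"
    by (intro admissible_lincomb \<beta> k)+
  have Z: "(\<lambda>w. - \<gamma>P * (X T w - \<xi> w)) \<in> borel_measurable M"
    using \<xi>M X(1) by measurable
  have \<theta>: "0 < \<gamma>P * D / 2" using pos \<open>0 < D\<close> by simp
  have "c = (\<gamma>P + 1 / \<kappa>) / D" by (simp add: c D_def)
  \<comment> \<open>This relation matches the cross terms between \<beta> and k and thereby
    determines c.\<close>
  then have cD: "c * D = \<gamma>P + 1 / \<kappa>" using \<open>0 < D\<close> by simp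
  have r: "r = \<gamma>P * y - \<gamma>P * x0 + (\<gamma>P\<^sup>2 - \<gamma>P * D * c\<^sup>2) / 2 * (LINT s:{0..T}|lborel. (k s)\<^sup>2)"
    by (simp add: r_def D_def)
  have "AE w in M. ito a w - 1 / 2 * energy a w + (- \<gamma>P * (X T w - \<xi> w))
      = ito ?h w - 1 / 2 * energy ?h w + r + \<gamma>P * D / 2 * energy ?g w"
    using contract_of_eq[OF \<xi> pos(1)] X(2) ito_scale_cong[OF a \<beta> ab]
      ito_lincomb[OF \<beta> k, of "\<gamma>P + 1 / \<kappa>" "- \<gamma>P"] energy_lincomb[OF \<beta> k]
  proof eventually_elim
    case (elim w)
    define b2 where "b2 = energy \<beta> w"
    define bk where "bk = (LINT s:{0..T}|lborel. \<beta> s w * k s)"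
    define k2 where "k2 = energy ?k w"
    define m where "m = 1 / \<kappa>"
    have hh: "energy ?h w = (\<gamma>P + m)\<^sup>2 * b2 - 2 * (\<gamma>P + m) * \<gamma>P * bk + \<gamma>P\<^sup>2 * k2"
      using elim(6)[rule_format, of "\<gamma>P + 1 / \<kappa>" "- \<gamma>P"] by (simp add: b2_def bk_def k2_def m_def)
    have gg: "energy ?g w = b2 - 2 * c * bk + c\<^sup>2 * k2"
      using elim(6)[rule_format, of 1 "- c"] by (simp add: b2_def bk_def k2_def)
    have half: "(\<kappa> * \<gamma>A - 1) / (2 * \<kappa>) = (\<gamma>A - m) / 2"
      using pos by (simp add: m_def field_simps)
    have cD': "c * D = \<gamma>P + m" unfolding m_def by (rule cD)
    have D': "D = \<gamma>A + \<gamma>P + m" by (simp add: D_def m_def)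
    have "\<gamma>P * D / 2 * (b2 - 2 * c * bk + c\<^sup>2 * k2) = \<gamma>P * D / 2 * b2 - \<gamma>P * (c * D) * bk + \<gamma>P * D * c\<^sup>2 / 2 * k2"
      by (simp add: algebra_simps)
    also have "\<dots> = \<gamma>P * (\<gamma>A + \<gamma>P + m) / 2 * b2 - \<gamma>P * (\<gamma>P + m) * bk + \<gamma>P * D * c\<^sup>2 / 2 * k2"
      unfolding cD' by (simp add: D')
    finally have gg': "\<gamma>P * D / 2 * energy ?g w
        = \<gamma>P * (\<gamma>A + \<gamma>P + m) / 2 * b2 - \<gamma>P * (\<gamma>P + m) * bk + \<gamma>P * D * c\<^sup>2 / 2 * k2"
      unfolding gg .
    have r': "r = \<gamma>P * y - \<gamma>P * x0 + (\<gamma>P\<^sup>2 - \<gamma>P * D * c\<^sup>2) / 2 * k2"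
      by (simp add: r k2_def)
    have e: "\<xi> w = y + (\<gamma>A - m) / 2 * b2 + ito \<beta> w" "ito a w = m * ito \<beta> w" "energy a w = m\<^sup>2 * b2"
        "ito ?h w = (\<gamma>P + m) * ito \<beta> w + (- \<gamma>P) * ito ?k w"
      using elim(1,3,4,5) unfolding half b2_def[symmetric] m_def[symmetric] by simp_all
    show ?case
      unfolding gg' hh r' e elim(2)
      by (simp add: field_simps power2_eq_square)
  qed
  note * = weighted_exponential[OF a h g Z \<theta> this]
  have obj: "principal_objective M F B T X \<gamma>P \<gamma>A \<kappa> \<xi>
      = - enn2ereal (\<integral>\<^sup>+ w. ennreal (exp (- \<gamma>P * (X T w - \<xi> w))) \<partial>effort_measure M F B T a)"
    unfolding principal_objective_def cara_utility_def a_def by (rule ext_expectation_neg_exp)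
  have val: "ereal (- exp r) = - enn2ereal (ennreal (exp r))"
    by (simp add: enn2ereal_ennreal)
  show "principal_objective M F B T X \<gamma>P \<gamma>A \<kappa> \<xi> \<le> ereal (- exp r)"
    using *(1) by (simp only: obj val ereal_minus_le_minus less_eq_ennreal.rep_eq)
  assume "AE w in M. AE s in lborel. s \<in> {0..T} \<longrightarrow> \<beta> s w = c * k s"
  with *(2) show "principal_objective M F B T X \<gamma>P \<gamma>A \<kappa> \<xi> = ereal (- exp r)"
    unfolding obj val by simp
qed

text \<open>Null sections give a null set of the product only when the set is measurable.
  Progressive measurability at time T supplies this, and then the two almost everywhere quantifiers
  may be exchanged.\<close>

lemma AE_progressive_product:
  assumes a: "progressively_measurable F T a" and b: "b \<in> borel_measurable (restrict_space borel {0..T})"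
    and AE: "AE w in M. AE s in lborel. s \<in> {0..T} \<longrightarrow> a s w = b s"
  shows "AE (s, w) in restrict_space lborel {0..T} \<Otimes>\<^sub>M M. a s w = b s"
proof -
  let ?R = "restrict_space lborel {0..T}"
  interpret R: finite_measure ?R
    by (rule finite_measureI) (simp add: emeasure_restrict_space space_restrict_space emeasure_lborel_Icc_eq)
  interpret P: pair_sigma_finite ?R M ..
  have R[measurable_cong]: "sets ?R = sets (restrict_space borel {0..T})"
    by (simp add: sets_restrict_space)
  have "fst \<in> measurable (?R \<Otimes>\<^sub>M M) (restrict_space borel {0..T})"
    using measurable_cong_sets[OF refl R] by (metis measurable_fst)
  moreover have "snd \<in> measurable (?R \<Otimes>\<^sub>M M) (F T)"
    using measurable_F_M[of T "\<lambda>w. w" "F T"] T_pos by simp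
  ultimately have "(\<lambda>p. (fst p, snd p)) \<in> measurable (?R \<Otimes>\<^sub>M M) (restrict_space borel {0..T} \<Otimes>\<^sub>M F T)"
    by (rule measurable_Pair)
  moreover have "(\<lambda>(s, w). a s w) \<in> borel_measurable (restrict_space borel {0..T} \<Otimes>\<^sub>M F T)"
    using a T_pos by (auto simp: progressively_measurable_def)
  ultimately have [measurable]: "(\<lambda>p. a (fst p) (snd p)) \<in> borel_measurable (?R \<Otimes>\<^sub>M M)"
    using measurable_compose by (fastforce simp: case_prod_beta')
  have [measurable]: "(\<lambda>p. b (fst p)) \<in> borel_measurable (?R \<Otimes>\<^sub>M M)"
    using measurable_compose[OF measurable_fst, of b ?R borel M] b measurable_cong_sets[OF R refl, of borel] by simp
  have meas: "{p \<in> space (?R \<Otimes>\<^sub>M M). a (fst p) (snd p) = b (fst p)} \<in> sets (?R \<Otimes>\<^sub>M M)"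
    by measurable
  have "AE w in M. AE s in ?R. a s w = b s"
    using AE by (simp add: AE_restrict_space_iff)
  then have "AE s in ?R. AE w in M. a s w = b s"
    by (subst P.AE_commute) (use meas in auto)
  then have "AE p in ?R \<Otimes>\<^sub>M M. a (fst p) (snd p) = b (fst p)"
    by (intro P.AE_pair_measure meas) simp
  then show ?thesis
    by (simp add: case_prod_beta')
qed

end

theorem theorem2p1:
  fixes M :: "'a measure"
    and F :: "real \<Rightarrow> 'a measure"
    and B X :: "real \<Rightarrow> 'a \<Rightarrow> real"
    and K :: "real \<Rightarrow> real \<Rightarrow> real"
    and g0 :: "real \<Rightarrow> real"
    and T \<gamma>A \<gamma>P \<kappa> y0 R0 c :: real
    and \<beta>s :: "real \<Rightarrow> real"
    and \<xi>s :: "'a \<Rightarrow> real"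
  assumes "T > 0"
    and "filtered_prob_space M F T"
    and "brownian_motion M F T B"
    and "g0 \<in> borel_measurable (restrict_space borel {0..T})"
    and "volterra_kernel T K"
    and "volterra_output M F B T g0 K X"
    and "\<gamma>A > 0" and "\<gamma>P > 0" and "\<kappa> > 0"
    and "R0 = cara_utility \<gamma>A y0"
    and c_def: "c = (\<gamma>P + 1 / \<kappa>) / (\<gamma>A + \<gamma>P + 1 / \<kappa>)"
    and \<beta>s_def: "\<And>t. \<beta>s t = c * K T t"
    and \<xi>s_def: "\<And>w. \<xi>s w = y0 - c * g0 T
            + (\<kappa> * \<gamma>A - 1) / (2 * \<kappa>) * (LINT s:{0..T}|lborel. (\<beta>s s)\<^sup>2) + c * X T w"
  shows "\<xi>s \<in> contracts M F B T X \<gamma>A \<kappa> y0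
     \<and> incentive_compatible M F B T \<gamma>A \<kappa> \<xi>s
     \<and> participation M F B T \<gamma>A \<kappa> R0 \<xi>s
     \<and> principal_objective M F B T X \<gamma>P \<gamma>A \<kappa> \<xi>s = principal_value M F B T X \<gamma>P \<gamma>A \<kappa> y0 R0
     \<and> optimal_effort M F B T \<gamma>A \<kappa> \<xi>s (\<lambda>t w. \<beta>s t / \<kappa>)
     \<and> (\<forall>a. optimal_effort M F B T \<gamma>A \<kappa> \<xi>s a \<longrightarrow>
           (AE (t, w) in restrict_space lborel {0..T} \<Otimes>\<^sub>M M. a t w = \<beta>s t / \<kappa>))"
proof -
  interpret brownian_space M F T B
    using assms(1-3) by unfold_locales
  note pos = \<open>\<kappa> > 0\<close> \<open>\<gamma>A > 0\<close>
  let ?k = "\<lambda>s (w :: 'a). K T s"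
  have K: "K T \<in> borel_measurable (restrict_space borel {0..T})"
  proof -
    have "T \<in> space (restrict_space borel {0..T})"
      using T_pos by (simp add: space_restrict_space)
    from measurable_compose[OF measurable_Pair1'[OF this, of "restrict_space borel {0..T}"], of "\<lambda>(t, s). K t s" borel] show ?thesis
      using assms(5) by (simp add: volterra_kernel_def)
  qed
  \<comment> \<open>The kernel bound is uniform in t; taken at t = T it makes K(T,.) an admissible
    deterministic process.\<close>
  have Kfin: "sq_integral T (K T) < \<infinity>"
  proof -
    have "sq_integral T (K T) \<le> (SUP t\<in>{0..T}. sq_integral T (K t))"
      using T_pos by (intro SUP_upper) simp
    also have "\<dots> < \<infinity>" using assms(5) by (simp add: volterra_kernel_def)
    finally show ?thesis .
  qed
  have k: "?k \<in> admissible M F T"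
    by (rule admissible_deterministic[OF K Kfin])
  have \<beta>: "(\<lambda>s w. \<beta>s s) \<in> admissible M F T"
    using admissible_scale[OF k, of c] by (simp add: \<beta>s_def)
  have X: "X t \<in> borel_measurable M" if "t \<in> {0..T}" for t
    using assms(6) that by (simp add: volterra_output_def)
  have XT: "AE w in M. X T w = g0 T + ito ?k w"
    using assms(6) T_pos by (simp add: volterra_output_def)
  \<comment> \<open>The augmentation adds only null sets of \<open>M\<close>, so the filtration of X
    stays inside \<open>M\<close> and every contract is \<open>M\<close>-measurable.\<close>
  have contracts: "\<exists>y\<ge>y0. \<exists>\<beta>. contract_of \<gamma>A \<kappa> y \<beta> \<xi>" if "\<xi> \<in> contracts M F B T X \<gamma>A \<kappa> y0" for \<xi>
  proof -
    let ?G = "{X s -` A \<inter> space M | s A. s \<in> {0..T} \<and> A \<in> sets borel} \<union> null_sets M"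
    have "?G \<subseteq> sets M"
      using X by (auto intro: measurable_sets)
    then have "sigma_sets (space M) ?G \<subseteq> sets M"
      by (rule sets.sigma_sets_subset)
    moreover have "?G \<subseteq> Pow (space M)"
      using \<open>?G \<subseteq> sets M\<close> sets.sets_into_space by blast
    ultimately have "subalgebra M (augmented_filtration M X T)"
      unfolding augmented_filtration_def by (simp add: subalgebra_def sets_measure_of)
    then have "\<xi> \<in> borel_measurable M"
      using that by (auto simp: contracts_def intro: measurable_from_subalg)
    with that show ?thesis
      by (auto simp: contracts_def contract_of_def)
  qed
  have \<xi>s_AE: "AE w in M. \<xi>s w = y0 + (LINT s:{0..T}|lborel. fstar \<gamma>A \<kappa> (\<beta>s s)) + ito (\<lambda>s w. \<beta>s s) w"
  proof -
    \<comment> \<open>In c X_T the part c g0(T) cancels against the constant term of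
      \<open>\<xi>s\<close>, and the rest is c times the integral of K(T,.), which is the integral
      of \<open>\<beta>s\<close>.\<close>
    have AE_ito: "AE w in M. ito (\<lambda>s w. \<beta>s s) w = c * ito ?k w"
      using \<beta> k by (intro ito_scale_cong(1)) (auto simp: \<beta>s_def)
    have cost: "(LINT s:{0..T}|lborel. fstar \<gamma>A \<kappa> (\<beta>s s))
        = (\<kappa> * \<gamma>A - 1) / (2 * \<kappa>) * (LINT s:{0..T}|lborel. (\<beta>s s)\<^sup>2)"
      unfolding fstar_eq[OF \<open>\<kappa> > 0\<close>] by (rule set_integral_mult_right)
    show ?thesis
      using XT AE_ito by eventually_elim (simp add: \<xi>s_def cost distrib_left)
  qed
  have XF: "X T \<in> borel_measurable (augmented_filtration M X T)"
  proof (rule measurableI)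
    let ?G = "{X s -` A \<inter> space M | s A. s \<in> {0..T} \<and> A \<in> sets borel} \<union> null_sets M"
    have G: "?G \<subseteq> Pow (space M)"
      using sets.sets_into_space by (auto dest: null_setsD2)
    fix A :: "real set" assume "A \<in> sets borel"
    then have "X T -` A \<inter> space M \<in> ?G"
      using T_pos by (intro UnI1 CollectI exI[of _ T] exI[of _ A]) auto
    then show "X T -` A \<inter> space (augmented_filtration M X T) \<in> sets (augmented_filtration M X T)"
      unfolding augmented_filtration_def using G by (simp add: sets_measure_of space_measure_of)
  qed simp
  have "\<xi>s \<in> borel_measurable (augmented_filtration M X T)"
    unfolding \<xi>s_def[abs_def] using XF by measurable
  with \<xi>s_AE \<beta> have \<xi>s: "\<xi>s \<in> contracts M F B T X \<gamma>A \<kappa> y0"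
    unfolding contracts_def by (intro CollectI conjI exI[of _ y0] bexI[of _ "\<lambda>s w. \<beta>s s"]) simp_all
  have XM: "X T \<in> borel_measurable M" using X T_pos by simp
  have co: "contract_of \<gamma>A \<kappa> y0 (\<lambda>s w. \<beta>s s) \<xi>s"
    unfolding contract_of_def \<xi>s_def[abs_def] using XM \<beta> \<xi>s_AE by (simp add: \<xi>s_def)
  note opt = optimal_effort_scaled[OF co pos]
  have ic: "incentive_compatible M F B T \<gamma>A \<kappa> \<xi>s"
    unfolding incentive_compatible_def agent_value_contract[OF co pos] using opt by auto
  have part: "participation M F B T \<gamma>A \<kappa> R0 \<xi>s"
    using best_effort_optimal[OF co pos]
    unfolding participation_def optimal_effort_def agent_value_contract[OF co pos] by (simp add: \<open>R0 = _\<close>)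
  \<comment> \<open>exp (r y) bounds the principal's expected disutility from below for all
    contracts with constant y, whatever their \<beta>.\<close>
  define r where "r y = \<gamma>P * y - \<gamma>P * g0 T
      + (\<gamma>P\<^sup>2 - \<gamma>P * (\<gamma>A + \<gamma>P + 1 / \<kappa>) * c\<^sup>2) / 2 * (LINT s:{0..T}|lborel. (K T s)\<^sup>2)" for y
  have obj: "principal_objective M F B T X \<gamma>P \<gamma>A \<kappa> \<xi>s = ereal (- exp (r y0))"
    unfolding r_def
    by (rule principal_objective_contract(2)[where k = "K T" and X = X, OF co pos \<open>\<gamma>P > 0\<close> k XM XT c_def]) (simp add: \<beta>s_def)
  have "principal_objective M F B T X \<gamma>P \<gamma>A \<kappa> \<xi> \<le> ereal (- exp (r y0))" if "\<xi> \<in> contracts M F B T X \<gamma>A \<kappa> y0" for \<xi>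
  proof -
    from contracts[OF that] obtain y \<beta> where "y0 \<le> y" and y: "contract_of \<gamma>A \<kappa> y \<beta> \<xi>"
      by blast
    have "principal_objective M F B T X \<gamma>P \<gamma>A \<kappa> \<xi> \<le> ereal (- exp (r y))"
      unfolding r_def by (rule principal_objective_contract(1)[where k = "K T" and X = X, OF y pos \<open>\<gamma>P > 0\<close> k XM XT c_def])
    \<comment> \<open>r increases with y because \<gamma>P > 0, so the smallest constant y0 is the
      best for the principal.\<close>
    also have "\<dots> \<le> ereal (- exp (r y0))"
      using \<open>y0 \<le> y\<close> \<open>\<gamma>P > 0\<close> by (simp add: r_def)
    finally show ?thesis .
  qed
  \<comment> \<open>The bound holds on all contracts, in particular on those satisfying
    participation, and \<open>\<xi>s\<close> is one of these and attains it.\<close>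
  then have attained: "principal_objective M F B T X \<gamma>P \<gamma>A \<kappa> \<xi>s = principal_value M F B T X \<gamma>P \<gamma>A \<kappa> y0 R0"
    unfolding principal_value_def using \<xi>s part obj
    by (intro antisym[OF SUP_upper SUP_least]) auto
  have "AE (t, w) in restrict_space lborel {0..T} \<Otimes>\<^sub>M M. a t w = \<beta>s t / \<kappa>"
    if "optimal_effort M F B T \<gamma>A \<kappa> \<xi>s a" for a
  proof (rule AE_progressive_product)
    show "progressively_measurable F T a" "AE w in M. AE s in lborel. s \<in> {0..T} \<longrightarrow> a s w = \<beta>s s / \<kappa>"
      using that unfolding optimal_effort_iff[OF co pos] by (auto intro: admissible_progressive)
    show "(\<lambda>s. \<beta>s s / \<kappa>) \<in> borel_measurable (restrict_space borel {0..T})"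
      unfolding \<beta>s_def using K by measurable
  qed
  with \<xi>s ic part attained opt show ?thesis by blast
qed

end
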